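(* Let $q=2^n$ with $n\ge 3$, let $h$ be a positive integer with $\gcd(n,h)=1$, let $q\equiv\xi\pmod 3$ with $\xi\in\{1,-1\}$, and let $G_h$ be the group of projectivities of $\mathrm{PG}(3,q)$ defined in the context. Then $G_h$ has exactly $2q+7+\xi$ orbits on the lines of $\mathrm{PG}(3,q)$, namely: - $2$ orbits of size $q+1$; - $2$ orbits of size $q(q-1)/2$; - $2$ orbits of size $q(q+1)/2$; - one orbit of size $q^2-1$; - $2+\xi$ orbits of size $\frac{q^3-q}{2+\xi}$; - $2(q-2)$ orbits of size $(q^3-q)/2$; - $2$ orbits of size $q^3-q$.
   Context: Points of $\mathrm{PG}(3,q)$ have homogeneous coordinates $(X_1,X_2,X_3,X_4)$, written as column vectors when acted on by matrices. $\mathcal A=\{(1,t,t^{2^h},t^{2^h+1})\mid t\in\mathbb F_q\}\cup\{(0,0,0,1)\}$. $G_h\simeq \mathrm{PGL}(2,q)$ is the group of projectivities of $\mathrm{PG}(3,q)$ stabilizing $\mathcal A$; its elements are represented by the matrices $$M_{a,b,c,d}=\begin{pmatrix} a^{2^h+1}&a^{2^h}b&ab^{2^h}&b^{2^h+1}\\ a^{2^h}c&a^{2^h}d&b^{2^h}c&b^{2^h}d\\ ac^{2^h}&bc^{2^h}&ad^{2^h}&bd^{2^h}\\ c^{2^h+1}&c^{2^h}d&cd^{2^h}&d^{2^h+1}\end{pmatrix},\quad a,b,c,d\in\mathbb F_q,\ ad+bc=1.$$ *)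

theory Defs
  imports
    "HOL-Analysis.Analysis"
    "HOL-Algebra.Bij"
    "HOL-Algebra.Group_Action"
    "HOL-Number_Theory.Cong"
    "HOL-Library.Multiset"
begin

text \<open>
  The subspaces of \<open>PG(3,F)\<close> are the linear subspaces of \<open>F\<^sup>4\<close>; points and lines are those of
  vector space dimension 1 and 2.  Subspaces over a general field are taken with respect to
  \<open>(*s)\<close>, hence the prefix \<open>vec\<close>.
\<close>

definition PG3_subspaces :: "('a::field^4) set set" where
  "PG3_subspaces = {U. vec.subspace U}"

definition PG3_points :: "('a::field^4) set set" where
  "PG3_points = {P. vec.subspace P \<and> vec.dim P = 1}"

definition PG3_lines :: "('a::field^4) set set" where
  "PG3_lines = {L. vec.subspace L \<and> vec.dim L = 2}"

definition PG3_point :: "'a::field \<Rightarrow> 'a \<Rightarrow> 'a \<Rightarrow> 'a \<Rightarrow> ('a^4) set" where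
  "PG3_point x1 x2 x3 x4 = vec.span {vector [x1, x2, x3, x4]}"

text \<open>
  A projectivity is the map induced by an invertible matrix on the subspaces of \<open>PG(3,F)\<close>.
  As it is made undefined outside \<open>PG3_subspaces\<close>, matrices that differ by a nonzero
  scalar give the same projectivity.
\<close>

definition projectivity :: "'a::field^4^4 \<Rightarrow> ('a^4) set \<Rightarrow> ('a^4) set" where
  "projectivity M = (\<lambda>U\<in>PG3_subspaces. (\<lambda>v. M *v v) ` U)"

definition PGL4 :: "(('a::field^4) set \<Rightarrow> ('a^4) set) monoid" where
  "PGL4 = (BijGroup PG3_subspaces) \<lparr>carrier := {projectivity M |M. invertible M}\<rparr>"

definition arc :: "nat \<Rightarrow> ('a::field^4) set set" where
  "arc h = {PG3_point 1 t (t ^ (2^h)) (t ^ (2^h + 1)) |t. True} \<union> {PG3_point 0 0 0 1}"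

definition G_arc :: "nat \<Rightarrow> (('a::field^4) set \<Rightarrow> ('a^4) set) monoid" where
  "G_arc h = PGL4 \<lparr>carrier := {g \<in> carrier PGL4. g ` arc h = arc h}\<rparr>"

definition G_arc_line_orbits :: "nat \<Rightarrow> ('a::field^4) set set set" where
  "G_arc_line_orbits h = orbits (G_arc h) PG3_lines (\<lambda>g L. g L)"


lemma vec4_nth [simp]:
  "(vector [x1, x2, x3, x4] :: 'a::zero^4) $ 1 = x1"
  "(vector [x1, x2, x3, x4] :: 'a^4) $ 2 = x2"
  "(vector [x1, x2, x3, x4] :: 'a^4) $ 3 = x3"
  "(vector [x1, x2, x3, x4] :: 'a^4) $ 4 = x4"
  by (simp_all add: vector_def)

lemma subspace_image_mult: "vec.subspace U \<Longrightarrow> vec.subspace ((\<lambda>v. M *v v) ` U)"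
  for M :: "'a::field^4^4"
  by (rule vec.subspace_image)

lemma projectivity_mult:
  "compose PG3_subspaces (projectivity M) (projectivity N) = projectivity (M ** N)"
  by (rule ext) (auto simp: compose_def projectivity_def PG3_subspaces_def
      subspace_image_mult image_image matrix_vector_mul_assoc)

lemma projectivity_one: "projectivity (mat 1) = (\<lambda>U\<in>PG3_subspaces. U)"
  by (simp add: projectivity_def)

lemma projectivity_Bij:
  assumes "invertible M"
  shows "projectivity M \<in> Bij PG3_subspaces"
proof -
  obtain N where N: "M ** N = mat 1" "N ** M = mat 1"
    using assms unfolding invertible_def by blast
  have cancel: "projectivity A (projectivity B U) = U"
    if "A ** B = mat 1" "U \<in> PG3_subspaces" for A B :: "'a^4^4" and U
    using projectivity_mult[of A B] projectivity_one that by (metis compose_eq restrict_apply')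
  have maps: "projectivity A U \<in> PG3_subspaces" if "U \<in> PG3_subspaces" for A :: "'a^4^4" and U
    using that by (simp add: projectivity_def PG3_subspaces_def subspace_image_mult)
  have "bij_betw (projectivity M) PG3_subspaces PG3_subspaces"
    by (rule bij_betw_byWitness[where f' = "projectivity N"])
       (use cancel N maps in auto)
  then show ?thesis
    by (simp add: Bij_def projectivity_def)
qed

lemma subgroup_PGL4:
  "subgroup (carrier (PGL4 :: (('a::field^4) set \<Rightarrow> ('a^4) set) monoid)) (BijGroup PG3_subspaces)"
proof -
  let ?B = "BijGroup PG3_subspaces :: (('a^4) set \<Rightarrow> ('a^4) set) monoid"
  let ?P = "PGL4 :: (('a^4) set \<Rightarrow> ('a^4) set) monoid"
  interpret group "?B" by (rule group_BijGroup)
  show ?thesis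
  proof (rule subgroupI)
    show "carrier ?P \<subseteq> carrier (?B)"
      by (auto simp: PGL4_def BijGroup_def projectivity_Bij)
    show "carrier ?P \<noteq> {}"
      proof -
      have "invertible (mat 1 :: 'a^4^4)" unfolding invertible_def by (metis matrix_mul_lid)
      then show ?thesis by (auto simp: PGL4_def)
    qed
    fix f g assume "f \<in> carrier ?P" "g \<in> carrier ?P"
    then obtain M N where MN: "f = projectivity M" "invertible M" "g = projectivity N" "invertible N"
      by (auto simp: PGL4_def)
    then show "f \<otimes>\<^bsub>?B\<^esub> g \<in> carrier ?P"
      by (auto simp: PGL4_def BijGroup_def projectivity_Bij projectivity_mult intro: invertible_mult)
    obtain M' where M': "M ** M' = mat 1" "M' ** M = mat 1"
      using MN(2) unfolding invertible_def by blast
    then have inv: "invertible M'" unfolding invertible_def by blast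
    have "inv\<^bsub>?B\<^esub> f = projectivity M'"
    proof (rule inv_equality)
      show "projectivity M' \<otimes>\<^bsub>?B\<^esub> f = \<one>\<^bsub>?B\<^esub>"
        using MN inv by (simp add: BijGroup_def projectivity_Bij projectivity_mult projectivity_one M')
    qed (use MN inv in \<open>simp_all add: BijGroup_def projectivity_Bij\<close>)
    then show "inv\<^bsub>?B\<^esub> f \<in> carrier ?P"
      using inv by (auto simp: PGL4_def)
  qed
qed

lemma PG3_point_in_points:
  assumes "(x1, x2, x3, x4) \<noteq> (0, 0, 0, 0)"
  shows "PG3_point x1 x2 x3 x4 \<in> PG3_points"
proof -
  have "vector [x1, x2, x3, x4] \<noteq> (0 :: 'a^4)"
    using assms by (auto simp: vec_eq_iff forall_4)
  then show ?thesis
    by (simp add: PG3_points_def PG3_point_def vec.dim_eq_card_independent)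
qed

lemma arc_subset_points: "arc h \<subseteq> PG3_points"
  by (auto simp: arc_def intro!: PG3_point_in_points)

lemma group_PGL4: "group (PGL4 :: (('a::field^4) set \<Rightarrow> ('a^4) set) monoid)"
proof -
  have "group ((BijGroup PG3_subspaces) \<lparr>carrier := carrier (PGL4 :: (('a^4) set \<Rightarrow> ('a^4) set) monoid)\<rparr>)"
    by (rule subgroup.subgroup_is_group[OF subgroup_PGL4 group_BijGroup])
  then show ?thesis by (simp add: PGL4_def)
qed

lemma group_G_arc: "group (G_arc h :: (('a::field^4) set \<Rightarrow> ('a^4) set) monoid)"
proof -
  let ?P = "PGL4 :: (('a^4) set \<Rightarrow> ('a^4) set) monoid"
  have sub: "arc h \<subseteq> (PG3_subspaces :: ('a^4) set set)"
    using arc_subset_points by (auto simp: PG3_points_def PG3_subspaces_def)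
  have bij: "g \<in> Bij PG3_subspaces" if "g \<in> carrier ?P" for g
    using that by (auto simp: PGL4_def projectivity_Bij)
  have mult: "(f \<otimes>\<^bsub>?P\<^esub> g) ` arc h = f ` g ` arc h"
    if "f \<in> carrier ?P" "g \<in> carrier ?P" for f g
  proof -
    have "f \<otimes>\<^bsub>?P\<^esub> g = compose PG3_subspaces f g"
      using bij that by (simp add: PGL4_def BijGroup_def)
    then show ?thesis using sub by (force simp: compose_def)
  qed
  have one: "\<one>\<^bsub>?P\<^esub> ` arc h = arc h"
    using sub by (force simp: PGL4_def BijGroup_def)
  interpret group ?P by (rule group_PGL4)
  have "subgroup {g \<in> carrier ?P. g ` arc h = arc h} ?P"
  proof (rule subgroupI)
    show "{g \<in> carrier ?P. g ` arc h = arc h} \<noteq> {}" using one by blast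
    fix g assume g: "g \<in> {g \<in> carrier ?P. g ` arc h = arc h}"
    then have "(inv\<^bsub>?P\<^esub> g) ` g ` arc h = arc h"
      using mult[of "inv\<^bsub>?P\<^esub> g" g] one by simp
    then show "inv\<^bsub>?P\<^esub> g \<in> {g \<in> carrier ?P. g ` arc h = arc h}" using g by simp
  qed (auto simp: mult)
  then show ?thesis
    unfolding G_arc_def by (rule subgroup.subgroup_is_group) (rule group_PGL4)
qed

end

theory Submission
  imports Defs "HOL-Computational_Algebra.Polynomial"
begin

text \<open>
  The matrices \<open>M_{a,b,c,d}\<close> act on \<open>V \<otimes> V'\<close>, where \<open>V'\<close> is the Frobenius twist of \<open>V = F\<^sup>2\<close>; they
  preserve the quadric \<open>X1 X4 = X2 X3\<close> and its polar symplectic form, whose value on a line is the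
  Pluecker coordinate sum \<open>p14 + p23\<close>.  On a line where it is normalised to 1, \<open>(p13, p24)\<close> and the
  untwisted \<open>(p12, p34)\<close> are two binary quadratic forms \<open>z X\<^sup>2 + X Y + w Y\<^sup>2\<close> on which \<open>SL(2, q)\<close> acts
  alike, and \<open>p14\<close> fixes a matching of their roots.  The stabilizer consists of the pairs of rotations
  or of reflections common to the two orthogonal groups, so it has order \<open>2(q - 1)\<close> or \<open>2(q + 1)\<close> when
  the forms agree, and 1 or 2 otherwise, according as they share a root or not.  A line on which the
  symplectic form vanishes is, after taking roots in characteristic two, a pair of vectors \<open>x, y\<close>
  of \<open>F\<^sup>2\<close> up to \<open>(x, y) \<sim> (m\<^sup>s x, m y)\<close> with \<open>s = 2\<^sup>h\<close>: its stabilizer has order \<open>q(q - 1)\<close> if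
  one of them is zero, \<open>q\<close> if they are parallel, and \<open>gcd (s + 1) (q - 1) = 2 + \<xi>\<close> if they are
  independent.  Counting the parameters of each kind of line gives the number of orbits.

  That no other projectivity stabilizes the arc is checked for one that fixes the points
  \<open>t = 0, 1, \<infinity>\<close>: the equations of the arc become polynomial identities in \<open>t\<close> of degree less than \<open>q\<close>.
\<close>

section \<open>Finite fields of characteristic two\<close>

text \<open>No orbit representatives are chosen: for every m, m times the number of orbits of size m
  is the number of lines whose orbit has size m, and that number is read off from the stabilizer
  orders. Summands \<open>if s = m then k else 0\<close> are kept throughout because sizes can
  coincide: for 2 + \<xi> = 1 the size (q^3 - q) / (2 + \<xi>) is q^3 - q. The obstacle to counting
  is the Pluecker relation, which mixes a product N of untwisted coordinates with
  \<open>fr N\<close>. The partial trace \<open>tr\<close> satisfies tr N^2 + tr N = fr N + N, so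
  shifting p14 by \<open>tr N\<close> removes \<open>fr\<close> altogether; what remains is linear
  in (z, w) for fixed (u, v) and e. Coprimality of n and h enters through the fixed field of
  \<open>fr\<close> being F_2 and through gcd n (2 h) = gcd n 2. The bound n \<ge> 3 gives q \<ge>
  8, which exceeds the degree 5 met in the rigidity argument when h is 1 mod n, and keeps
  \<open>fr\<close> from being an involution.\<close>

lemma card_pairs:
  fixes P :: "'a::finite \<Rightarrow> 'b::finite \<Rightarrow> bool"
  shows "card {(x, y). P x y} = (\<Sum>x\<in>UNIV. card {y. P x y})"
proof -
  have "{(x, y). P x y} = (SIGMA x:UNIV. {y. P x y})" by auto
  then show ?thesis by simp
qed

lemma sum_UNIV_If_eq:
  fixes z :: "'a::finite" and A B :: nat
  shows "(\<Sum>x\<in>UNIV. if x = z then A else B) = A + (CARD('a) - 1) * B"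
proof -
  have "(\<Sum>x\<in>UNIV. if x = z then A else B) = A + (\<Sum>x\<in>UNIV - {z}. B)"
    by (subst sum.remove[of _ z]) (auto intro!: sum.cong)
  then show ?thesis by simp
qed

lemma card_Collect_not:
  fixes P :: "'a::finite \<Rightarrow> bool"
  shows "card {x. \<not> P x} = CARD('a) - card {x. P x}"
proof -
  have "{x. \<not> P x} = UNIV - {x. P x}" by auto
  then show ?thesis by (simp add: card_Diff_subset)
qed

lemma card_uniform_fibres:
  assumes "finite X" and "\<And>x. x \<in> X \<Longrightarrow> card {y \<in> X. f y = f x} = k"
  shows "card X = k * card (f ` X)"
proof -
  have "card X = (\<Sum>z\<in>f ` X. card {y \<in> X. f y = z})"
    using assms(1) by (subst sum.image_gen[where g = f and h="\<lambda>_. 1::nat", simplified, symmetric]) auto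
  also have "\<dots> = (\<Sum>z\<in>f ` X. k)" by (rule sum.cong) (use assms(2) in auto)
  finally show ?thesis by simp
qed

text \<open>Multiplication by a nonzero \<open>x\<close> permutes the nonzero elements, so their
  product absorbs a factor \<open>x ^ (q - 1)\<close>.\<close>

lemma power_card_eq_same:
  fixes x :: "'a::{field,finite}"
  shows "x ^ CARD('a) = x"
proof (cases "x = 0")
  case False
  have "(\<Prod>y\<in>UNIV-{0}. x * y) = (\<Prod>y\<in>UNIV-{0}. y)"
    by (rule prod.reindex_bij_witness[of _ "\<lambda>y. y / x" "\<lambda>y. x * y"]) (use False in auto)
  then have "x ^ (CARD('a) - 1) = 1" by (simp add: prod.distrib)
  moreover have "CARD('a) = Suc (CARD('a) - 1)" using finite_UNIV_card_ge_0[where ?'a='a] by simp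
  ultimately show ?thesis by (metis power_Suc mult.right_neutral)
qed (use finite_UNIV_card_ge_0[where ?'a='a] in auto)

lemma poly_eq_0_finite_field:
  fixes p :: "'a::{field,finite} poly"
  assumes "\<And>x. poly p x = 0" and "degree p < CARD('a)"
  shows "p = 0"
  by (rule poly_eqI_degree[of UNIV]) (use assms in auto)

locale twisted_field =
  fixes n h :: nat and F :: "'a::{field,finite} itself"
  assumes card_UNIV: "CARD('a) = 2 ^ n" and n_ge_3: "3 \<le> n" and h_pos: "0 < h"
    and coprime_nh: "gcd n h = 1"
begin


lemma q_ge_8: "8 \<le> CARD('a)"
  unfolding card_UNIV using power_increasing[OF n_ge_3, of "2::nat"] by simp

text \<open>The shift by 1 permutes the field; comparing the sums of all elements gives q = 0 in the
  field, and q is a power of 2.\<close>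

lemma two_eq_0: "(2::'a) = 0"
proof -
  have "(\<Sum>x\<in>UNIV. x + 1) = (\<Sum>x\<in>UNIV. x :: 'a)"
    by (rule sum.reindex_bij_witness[of _ "\<lambda>x. x - 1" "\<lambda>x. x + 1"]) auto
  then have "of_nat CARD('a) = (0::'a)" by (simp add: sum.distrib)
  then have "(2::'a) ^ n = 0" by (simp add: card_UNIV)
  then show ?thesis by simp
qed

lemma add_self: "x + x = (0::'a)"
  by (metis mult_2 mult_zero_left two_eq_0)

lemma add_self_left: "x + (x + y) = (y::'a)"
  by (simp add: add.assoc[symmetric] add_self)

lemma uminus_eq: "- x = (x::'a)"
  using add_self[of x] by (simp add: eq_neg_iff_add_eq_0 minus_equation_iff)

lemma minus_eq: "x - y = x + (y::'a)"
  by (simp only: diff_conv_add_uminus uminus_eq)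

lemma add_eq_0: "x + y = 0 \<longleftrightarrow> x = (y::'a)"
  by (metis add_self add_self_left add.right_neutral)

lemma add_eq_iff: "x + y = z \<longleftrightarrow> x = y + (z::'a)"
  by (metis add_self_left add.commute)

lemmas char2 = add_self add_self_left uminus_eq minus_eq two_eq_0

lemma add_square: "(x + y)\<^sup>2 = x\<^sup>2 + (y::'a)\<^sup>2"
  by (simp add: power2_sum two_eq_0)

lemma add_frob: "(x + y) ^ (2 ^ k) = x ^ (2 ^ k) + (y::'a) ^ (2 ^ k)"
  by (induction k arbitrary: x y) (simp_all add: power_mult add_square)

lemma square_eq_iff: "x\<^sup>2 = y\<^sup>2 \<longleftrightarrow> x = (y::'a)"
  by (metis add_square add_eq_0 zero_eq_power2)

lemma square_surj: "\<exists>x. y = (x::'a)\<^sup>2"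
proof -
  have "surj (\<lambda>x::'a. x\<^sup>2)" by (rule finite_UNIV_inj_surj) (auto simp: inj_def square_eq_iff)
  then show ?thesis by (metis surjD)
qed

lemma square_eq_1: "x\<^sup>2 = 1 \<longleftrightarrow> x = (1::'a)"
  using square_eq_iff[of x 1] by simp

lemma frob_eq_iff: "x ^ (2 ^ k) = y ^ (2 ^ k) \<longleftrightarrow> x = (y::'a)"
  by (induction k arbitrary: x y) (simp_all add: power_mult square_eq_iff)

definition fr :: "'a \<Rightarrow> 'a" where "fr x = x ^ (2 ^ h)"

lemma fr_simps [simp]: "fr 0 = 0" "fr 1 = 1" "fr (x + y) = fr x + fr y" "fr (x * y) = fr x * fr y"
  "fr (x ^ k) = fr x ^ k" "fr (inverse x) = inverse (fr x)" "fr (x / y) = fr x / fr y"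
  by (simp_all add: fr_def add_frob power_mult_distrib power_inverse power_divide power_commutes
      power_mult[symmetric] mult.commute)
lemma fr_eq_iff [simp]: "fr x = fr y \<longleftrightarrow> x = y"
  by (simp add: fr_def frob_eq_iff)

lemma fr_eq_0 [simp]: "fr x = 0 \<longleftrightarrow> x = 0"
  using fr_eq_iff[of x 0] by simp

lemma fr_surj: "\<exists>x. y = fr x"
proof -
  have "surj fr" by (rule finite_UNIV_inj_surj) (auto simp: inj_def)
  then show ?thesis by (metis surjD)
qed

lemma frob_period: "(x::'a) ^ (2 ^ (n * k)) = x"
proof (induction k)
  case (Suc k)
  then show ?case
    by (metis card_UNIV power_card_eq_same power_mult power_add mult_Suc_right)
qed simp

lemma frob_mult_fixed: "(x::'a) ^ (2 ^ m) = x \<Longrightarrow> x ^ (2 ^ (m * k)) = x"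
  by (induction k) (simp_all add: power_add power_mult)

text \<open>An element fixed by the Frobenius powers of index n and m lies in the intersection of
  the two fixed fields; Bezout expresses the gcd as a difference of multiples of m and n.\<close>

lemma frob_gcd_fixed:
  fixes x :: 'a
  assumes "x ^ (2 ^ m) = x"
  shows "x ^ (2 ^ gcd n m) = x"
proof (cases "m = 0")
  case True
  then show ?thesis using frob_period[of x 1] by simp
next
  case False
  then obtain i j where "m * i = n * j + gcd m n" using bezout_nat by blast
  then have "x = x ^ (2 ^ (n * j + gcd m n))" using frob_mult_fixed[OF assms] by metis
  then show ?thesis by (metis power_add power_mult frob_period gcd.commute)
qed

lemma gcd_double: "gcd n (2 * h) = gcd n 2"
  using coprime_nh by (simp add: gcd_mult_right_right_cancel coprime_iff_gcd_eq_1)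

lemma fr_fixed_iff: "fr x = x \<longleftrightarrow> x = 0 \<or> x = 1"
proof
  assume "fr x = x"
  then have "x\<^sup>2 = x" using frob_gcd_fixed[of x h] coprime_nh by (simp add: fr_def)
  then show "x = 0 \<or> x = 1" by (simp add: power2_eq_square)
qed auto

text \<open>Not the absolute trace: the number of summands is h, so that t^2 + t telescopes to
  \<open>fr x + x\<close>.\<close>

definition tr :: "'a \<Rightarrow> 'a" where "tr x = (\<Sum>i<h. x ^ (2 ^ i))"

lemma tr_square: "(tr x)\<^sup>2 + tr x = fr x + x"
proof -
  have "(\<Sum>i<k. x ^ (2 ^ i))\<^sup>2 + (\<Sum>i<k. x ^ (2 ^ i)) = x ^ (2 ^ k) + x" for k
  proof (induction k)
    case (Suc k)
    have "(\<Sum>i<Suc k. x ^ (2 ^ i))\<^sup>2 + (\<Sum>i<Suc k. x ^ (2 ^ i))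
       = ((\<Sum>i<k. x ^ (2 ^ i))\<^sup>2 + (\<Sum>i<k. x ^ (2 ^ i))) + (x ^ (2 ^ k))\<^sup>2 + x ^ (2 ^ k)"
      by (simp add: add_square ac_simps)
    then show ?case unfolding Suc by (simp add: char2 ac_simps power_mult[symmetric])
  qed (simp add: add_self)
  then show ?thesis by (simp add: tr_def fr_def)
qed

lemma artin_schreier_eq_iff: "e\<^sup>2 + e = r\<^sup>2 + r \<longleftrightarrow> e = r \<or> e = r + (1::'a)"
proof -
  have "e\<^sup>2 + e + (r\<^sup>2 + r) = (e + r) * (e + (r + 1))"
    by (simp add: algebra_simps power2_eq_square char2)
  then show ?thesis by (metis add_eq_0 mult_eq_0_iff)
qed

text \<open>Solvability of t^2 + t = c takes the place of the discriminant: z X^2 + X Y + w Y^2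
  splits into linear factors iff t^2 + t = z w has a root.\<close>

lemma card_artin_schreier:
  "card {m. m\<^sup>2 + m = (c::'a)} = (if \<exists>t. t\<^sup>2 + t = c then 2 else 0)"
proof (cases "\<exists>t. t\<^sup>2 + t = c")
  case True
  then obtain t where "c = t\<^sup>2 + t" by auto
  then have "{m. m\<^sup>2 + m = c} = {t, t + 1}" by (auto simp: artin_schreier_eq_iff)
  with True show ?thesis by simp
qed auto

end

section \<open>Lines in Pluecker coordinates and the twisted action\<close>

lemma vec4_eqI: "x$1 = y$1 \<Longrightarrow> x$2 = y$2 \<Longrightarrow> x$3 = y$3 \<Longrightarrow> x$4 = y$4 \<Longrightarrow> x = (y::'b^4)"
  by (simp add: vec_eq_iff forall_4)

lemma span_pair: "vec.span {x, y :: 'a::field^4} = {\<alpha> *s x + \<beta> *s y | \<alpha> \<beta>. True}"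
proof -
  have "v \<in> vec.span {x, y} \<longleftrightarrow> (\<exists>\<alpha> \<beta>. v - \<alpha> *s x = \<beta> *s y)" for v
    by (auto simp: vec.span_insert vec.span_singleton)
  also have "\<dots> v = (\<exists>\<alpha> \<beta>. v = \<alpha> *s x + \<beta> *s y)" for v
    by (metis add_diff_cancel_left' diff_add_cancel add.commute)
  finally show ?thesis by blast
qed

type_synonym 'b sextuple = "'b \<times> 'b \<times> 'b \<times> 'b \<times> 'b \<times> 'b"

context twisted_field
begin

definition wedge :: "'a^4 \<Rightarrow> 'a^4 \<Rightarrow> 'a sextuple" where
  "wedge x y = (x$1 * y$2 + x$2 * y$1, x$1 * y$3 + x$3 * y$1, x$1 * y$4 + x$4 * y$1,
                x$2 * y$3 + x$3 * y$2, x$2 * y$4 + x$4 * y$2, x$3 * y$4 + x$4 * y$3)"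

text \<open>The four equations are the coordinates of the exterior product of v with the bivector p;
  signs disappear in characteristic two.\<close>

definition line_of :: "'a sextuple \<Rightarrow> ('a^4) set" where
  "line_of = (\<lambda>(p12, p13, p14, p23, p24, p34).
     {v. v$1 * p23 + v$2 * p13 + v$3 * p12 = 0 \<and> v$1 * p24 + v$2 * p14 + v$4 * p12 = 0 \<and>
         v$1 * p34 + v$3 * p14 + v$4 * p13 = 0 \<and> v$2 * p34 + v$3 * p24 + v$4 * p23 = 0})"

definition plucker :: "'a sextuple set" where
  "plucker = {(p12, p13, p14, p23, p24, p34). (p12, p13, p14, p23, p24, p34) \<noteq> (0, 0, 0, 0, 0, 0) \<and>
     p12 * p34 + p13 * p24 + p14 * p23 = 0}"

definition scale6 :: "'a \<Rightarrow> 'a sextuple \<Rightarrow> 'a sextuple" where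
  "scale6 k = (\<lambda>(p12, p13, p14, p23, p24, p34). (k * p12, k * p13, k * p14, k * p23, k * p24, k * p34))"

text \<open>Cramer's rule: a nonzero minor in positions 1, 2 determines the coefficients of a vector
  in the plane of i and j, and the vanishing 3 by 3 determinant gives the third coordinate.
  \<open>pairing_solve_self\<close> covers the positions of the minor itself.\<close>

lemma pairing_solve:
  assumes "i1 * j2 + i2 * j1 = (e::'a)" "e \<noteq> 0"
    and "v1 * (i2 * j3 + i3 * j2) + v2 * (i1 * j3 + i3 * j1) + v3 * (i1 * j2 + i2 * j1) = 0"
  shows "v3 = (v1 * j2 + v2 * j1) / e * i3 + (i1 * v2 + i2 * v1) / e * j3"
proof -
  have "v3 * e + ((v1 * j2 + v2 * j1) * i3 + (i1 * v2 + i2 * v1) * j3) = 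
     v1 * (i2 * j3 + i3 * j2) + v2 * (i1 * j3 + i3 * j1) + v3 * (i1 * j2 + i2 * j1)"
    unfolding assms(1)[symmetric] by (simp add: algebra_simps)
  then have "v3 * e = (v1 * j2 + v2 * j1) * i3 + (i1 * v2 + i2 * v1) * j3"
    using assms(3) add_eq_0 by metis
  then show ?thesis using assms(2) by (simp add: field_simps)
qed

lemma pairing_solve_self:
  assumes "i1 * j2 + i2 * j1 = (e::'a)" "e \<noteq> 0"
  shows "v1 = (v1 * j2 + v2 * j1) / e * i1 + (i1 * v2 + i2 * v1) / e * j1"
    "v2 = (v1 * j2 + v2 * j1) / e * i2 + (i1 * v2 + i2 * v1) / e * j2"
proof -
  have "v1 * e = (v1 * j2 + v2 * j1) * i1 + (i1 * v2 + i2 * v1) * j1"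
    "v2 * e = (v1 * j2 + v2 * j1) * i2 + (i1 * v2 + i2 * v1) * j2"
    unfolding assms(1)[symmetric] by (simp_all add: algebra_simps char2)
  then show "v1 = (v1 * j2 + v2 * j1) / e * i1 + (i1 * v2 + i2 * v1) / e * j1"
    "v2 = (v1 * j2 + v2 * j1) / e * i2 + (i1 * v2 + i2 * v1) / e * j2"
    using assms(2) by (simp_all add: field_simps)
qed

lemma line_of_wedge:
  assumes nz: "wedge x y \<noteq> (0, 0, 0, 0, 0, 0)"
  shows "line_of (wedge x y) = vec.span {x, y}"
proof -
  have "v \<in> vec.span {x, y}" if "v \<in> line_of (wedge x y)" for v
  proof -
    let ?m = "\<lambda>i j. x$i * y$j + x$j * y$i"
    have eqs: "v$i * ?m j k + v$j * ?m i k + v$k * ?m i j = 0"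
      if "i \<noteq> j" "i \<noteq> k" "j \<noteq> k" for i j k :: 4
    proof -
      have "\<forall>i j k :: 4. i \<noteq> j \<longrightarrow> i \<noteq> k \<longrightarrow> j \<noteq> k \<longrightarrow> v$i * ?m j k + v$j * ?m i k + v$k * ?m i j = 0"
        using \<open>v \<in> line_of (wedge x y)\<close> by (simp add: forall_4 line_of_def wedge_def ac_simps)
      with that show ?thesis by blast
    qed
    obtain i j where ij: "i \<noteq> j" "?m i j \<noteq> 0"
    proof -
      have "\<exists>i j :: 4. i \<noteq> j \<and> ?m i j \<noteq> 0"
      proof (rule ccontr)
        assume "\<not> ?thesis"
        then have "\<forall>i j :: 4. i \<noteq> j \<longrightarrow> ?m i j = 0" by blast
        then show False using nz by (simp add: forall_4 wedge_def)
      qed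
      then show ?thesis using that by blast
    qed
    have comp: "v$k = (v$i * y$j + v$j * y$i) / ?m i j * x$k + (x$i * v$j + x$j * v$i) / ?m i j * y$k" for k
    proof (cases "k = i \<or> k = j")
      case True
      then show ?thesis using pairing_solve_self[OF refl ij(2)] by blast
    next
      case False
      then show ?thesis using pairing_solve[OF refl ij(2) eqs[of i j k]] ij(1) by blast
    qed
    have "v = ((v$i * y$j + v$j * y$i) / ?m i j) *s x + ((x$i * v$j + x$j * v$i) / ?m i j) *s y"
      unfolding vec_eq_iff vector_add_component vector_smult_component using comp by (rule allI)
    then show ?thesis unfolding span_pair by blast
  qed
  moreover have "v \<in> line_of (wedge x y)" if "v \<in> vec.span {x, y}" for v
    using that unfolding span_pair
    by (auto simp: line_of_def wedge_def algebra_simps char2)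
  ultimately show ?thesis by blast
qed

lemma wedge_eq_0_dependent:
  assumes "wedge x y = (0, 0, 0, 0, 0, 0)" "x \<noteq> 0"
  shows "\<exists>\<alpha>. y = \<alpha> *s x"
proof -
  have 0: "\<forall>i j :: 4. x$i * y$j + x$j * y$i = 0"
    using assms(1) by (simp add: forall_4 wedge_def add_self ac_simps)
  obtain i where i: "x$i \<noteq> 0" using assms(2) by (auto simp: vec_eq_iff)
  have "y$j = (y$i / x$i) * x$j" for j
    using 0[rule_format, of i j] i by (simp add: add_eq_0 field_simps)
  then have "y = (y$i / x$i) *s x"
    unfolding vec_eq_iff vector_smult_component by (rule allI)
  then show ?thesis by (rule exI)
qed

lemma wedge_nonzero_iff_independent:
  "wedge x y \<noteq> (0, 0, 0, 0, 0, 0) \<longleftrightarrow> x \<noteq> y \<and> vec.independent {x, y}"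
proof -
  have "x \<noteq> 0 \<and> y \<notin> vec.span {x} \<longleftrightarrow> wedge x y \<noteq> (0, 0, 0, 0, 0, 0)"
    using wedge_eq_0_dependent[of x y]
    by (auto simp: vec.span_singleton wedge_def algebra_simps char2)
  moreover have "x \<noteq> y \<and> vec.independent {x, y} \<longleftrightarrow> x \<noteq> 0 \<and> y \<notin> vec.span {x}"
    using vec.independent_insert[of y "{x}"] vec.span_base[of x "{x}"]
    by (auto simp: insert_commute)
  ultimately show ?thesis by blast
qed

lemma PG3_lines_eq_span: "L \<in> PG3_lines \<longleftrightarrow> (\<exists>x y. L = vec.span {x, y} \<and> wedge x y \<noteq> (0, 0, 0, 0, 0, 0))"
proof
  assume L: "L \<in> PG3_lines"
  then have sub: "vec.subspace L" and dim: "vec.dim L = 2" by (auto simp: PG3_lines_def)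
  obtain B where B: "B \<subseteq> L" "vec.independent B" "L \<subseteq> vec.span B" "card B = 2"
    using vec.basis_exists[of L] dim by metis
  then obtain x y where xy: "B = {x, y}" "x \<noteq> y" by (meson card_2_iff)
  have "L = vec.span {x, y}" using B xy sub by (simp add: vec.span_minimal subset_antisym)
  then show "\<exists>x y. L = vec.span {x, y} \<and> wedge x y \<noteq> (0, 0, 0, 0, 0, 0)"
    using B xy wedge_nonzero_iff_independent by blast
next
  assume "\<exists>x y. L = vec.span {x, y} \<and> wedge x y \<noteq> (0, 0, 0, 0, 0, 0)"
  then show "L \<in> PG3_lines"
    by (auto simp: wedge_nonzero_iff_independent PG3_lines_def vec.dim_eq_card_independent)
qed

lemma wedge_in_plucker: "wedge x y \<noteq> (0, 0, 0, 0, 0, 0) \<Longrightarrow> wedge x y \<in> plucker"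
  by (simp add: plucker_def wedge_def algebra_simps char2)

lemma plucker_wedge:
  assumes "p \<in> plucker"
  shows "\<exists>x y. p = wedge x y"
proof -
  obtain p12 p13 p14 p23 p24 p34 where p: "p = (p12, p13, p14, p23, p24, p34)" by (cases p) auto
  have nz: "p12 \<noteq> 0 \<or> p13 \<noteq> 0 \<or> p14 \<noteq> 0 \<or> p23 \<noteq> 0 \<or> p24 \<noteq> 0 \<or> p34 \<noteq> 0"
    and rel: "p12 * p34 + p13 * p24 + p14 * p23 = 0"
    using assms by (auto simp: plucker_def p)
  have rel12: "p12 * p34 = p13 * p24 + p14 * p23" and rel13: "p13 * p24 = p12 * p34 + p14 * p23"
    and rel14: "p14 * p23 = p12 * p34 + p13 * p24"
    using rel by (simp_all add: add_eq_0 add_eq_iff two_eq_0 ac_simps)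
  \<comment> \<open>These are the rows of the alternating matrix of p. It has rank 2, so the rows i
    and j belonging to a nonzero pij span the line, and their wedge is pij times p.\<close>
  define r1 :: "'a^4" where "r1 = vector [0, p12, p13, p14]"
  define r2 :: "'a^4" where "r2 = vector [p12, 0, p23, p24]"
  define r3 :: "'a^4" where "r3 = vector [p13, p23, 0, p34]"
  define r4 :: "'a^4" where "r4 = vector [p14, p24, p34, 0]"
  note defs = p wedge_def r1_def r2_def r3_def r4_def
  from nz consider "p12 \<noteq> 0" | "p13 \<noteq> 0" | "p14 \<noteq> 0" | "p23 \<noteq> 0" | "p24 \<noteq> 0" | "p34 \<noteq> 0" by blast
  then show ?thesis
  proof cases
    case 1
    have "p = wedge ((1 / p12) *s r1) r2"
      using 1 rel12 by (simp add: defs field_simps)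
    then show ?thesis by blast
  next
    case 2
    have "p = wedge ((1 / p13) *s r1) r3"
      using 2 rel13 by (simp add: defs field_simps)
    then show ?thesis by blast
  next
    case 3
    have "p = wedge ((1 / p14) *s r1) r4"
      using 3 rel14 by (simp add: defs field_simps)
    then show ?thesis by blast
  next
    case 4
    have "p = wedge ((1 / p23) *s r2) r3"
      using 4 rel14 by (simp add: defs field_simps)
    then show ?thesis by blast
  next
    case 5
    have "p = wedge ((1 / p24) *s r2) r4"
      using 5 rel13 by (simp add: defs field_simps)
    then show ?thesis by blast
  next
    case 6
    have "p = wedge ((1 / p34) *s r3) r4"
      using 6 rel12 by (simp add: defs field_simps)
    then show ?thesis by blast
  qed
qed

lemma PG3_lines_eq: "PG3_lines = line_of ` plucker"
proof -
  have "L \<in> PG3_lines \<longleftrightarrow> L \<in> line_of ` plucker" for L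
  proof
    assume "L \<in> PG3_lines"
    then show "L \<in> line_of ` plucker"
      unfolding PG3_lines_eq_span by (metis line_of_wedge wedge_in_plucker imageI)
  next
    assume "L \<in> line_of ` plucker"
    then obtain p where p: "p \<in> plucker" "L = line_of p" by blast
    then obtain x y where "p = wedge x y" using plucker_wedge by blast
    moreover from p have "p \<noteq> (0, 0, 0, 0, 0, 0)" by (auto simp: plucker_def)
    ultimately show "L \<in> PG3_lines"
      unfolding PG3_lines_eq_span using p(2) line_of_wedge by metis
  qed
  then show ?thesis by blast
qed

lemma line_of_eq_iff:
  assumes "p \<in> plucker" "p' \<in> plucker"
  shows "line_of p' = line_of p \<longleftrightarrow> (\<exists>k. k \<noteq> 0 \<and> p' = scale6 k p)"
proof
  assume eq: "line_of p' = line_of p"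
  obtain x y x' y' where w: "p = wedge x y" "p' = wedge x' y'" using plucker_wedge assms by metis
  have nz: "p \<noteq> (0, 0, 0, 0, 0, 0)" "p' \<noteq> (0, 0, 0, 0, 0, 0)" using assms by (auto simp: plucker_def)
  have "vec.span {x', y'} = vec.span {x, y}"
    using eq line_of_wedge[of x y] line_of_wedge[of x' y'] nz unfolding w by simp
  then have "x' \<in> vec.span {x, y}" "y' \<in> vec.span {x, y}"
    using vec.span_base[of _ "{x', y'}"] by auto
  then obtain \<alpha> \<beta> \<gamma> \<delta> where "x' = \<alpha> *s x + \<beta> *s y" "y' = \<gamma> *s x + \<delta> *s y"
    unfolding span_pair by auto
  then have "p' = scale6 (\<alpha> * \<delta> + \<beta> * \<gamma>) p"
    unfolding w by (simp add: wedge_def scale6_def algebra_simps char2)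
  moreover from this have "\<alpha> * \<delta> + \<beta> * \<gamma> \<noteq> 0" using nz by (auto simp: scale6_def split: prod.splits)
  ultimately show "\<exists>k. k \<noteq> 0 \<and> p' = scale6 k p" by blast
next
  assume "\<exists>k. k \<noteq> 0 \<and> p' = scale6 k p"
  then obtain k where k: "k \<noteq> 0" "p' = scale6 k p" by blast
  have "a * (k * b) + c * (k * d) + e * (k * f) = 0 \<longleftrightarrow> a * b + c * d + e * f = 0" for a b c d e f
  proof -
    have "a * (k * b) + c * (k * d) + e * (k * f) = k * (a * b + c * d + e * f)"
      by (simp add: algebra_simps)
    then show ?thesis using k(1) by simp
  qed
  then show "line_of p' = line_of p"
    unfolding k(2) by (cases p) (simp add: line_of_def scale6_def)
qed

section \<open>SL(2, q) and its twisted tensor representation\<close>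

definition SL :: "('a \<times> 'a \<times> 'a \<times> 'a) set" where
  "SL = {(a, b, c, d). a * d + b * c = 1}"

definition mul :: "'a \<times> 'a \<times> 'a \<times> 'a \<Rightarrow> 'a \<times> 'a \<times> 'a \<times> 'a \<Rightarrow> 'a \<times> 'a \<times> 'a \<times> 'a" where
  "mul = (\<lambda>(a, b, c, d) (a', b', c', d'). (a * a' + b * c', a * b' + b * d', c * a' + d * c', c * b' + d * d'))"

text \<open>The adjugate without signs, which is the inverse on \<open>SL\<close>.\<close>

definition adj :: "'a \<times> 'a \<times> 'a \<times> 'a \<Rightarrow> 'a \<times> 'a \<times> 'a \<times> 'a" where
  "adj = (\<lambda>(a, b, c, d). (d, b, c, a))"

lemma mul_closed: "g \<in> SL \<Longrightarrow> g' \<in> SL \<Longrightarrow> mul g g' \<in> SL"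
proof -
  assume "g \<in> SL" "g' \<in> SL"
  then obtain a b c d a' b' c' d' where g: "g = (a, b, c, d)" "g' = (a', b', c', d')"
    and 1: "a * d + b * c = 1" "a' * d' + b' * c' = 1" by (auto simp: SL_def)
  have "(a * a' + b * c') * (c * b' + d * d') + (a * b' + b * d') * (c * a' + d * c')
     = (a * d + b * c) * (a' * d' + b' * c')" by (simp add: algebra_simps char2)
  with 1 show ?thesis by (simp add: SL_def g mul_def)
qed

lemma adj_closed: "g \<in> SL \<Longrightarrow> adj g \<in> SL"
  by (auto simp: SL_def adj_def ac_simps)

lemma mul_assoc: "mul (mul g g') g'' = mul g (mul g' g'')"
  by (auto simp: mul_def algebra_simps split: prod.splits)

lemma mul_adj: "g \<in> SL \<Longrightarrow> mul g (adj g) = (1, 0, 0, 1)" "g \<in> SL \<Longrightarrow> mul (adj g) g = (1, 0, 0, 1)"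
  by (auto simp: SL_def adj_def mul_def algebra_simps char2)

lemma mul_one: "mul (1, 0, 0, 1) g = g" "mul g (1, 0, 0, 1) = g"
  by (auto simp: mul_def split: prod.splits)

text \<open>The Kronecker product of \<open>fr g\<close>, taken entrywise, with
  \<open>g\<close>.\<close>

definition tw :: "'a \<times> 'a \<times> 'a \<times> 'a \<Rightarrow> 'a^4^4" where
  "tw = (\<lambda>(a, b, c, d). vector [
     vector [fr a * a, fr a * b, a * fr b, fr b * b],
     vector [fr a * c, fr a * d, fr b * c, fr b * d],
     vector [a * fr c, b * fr c, a * fr d, b * fr d],
     vector [fr c * c, fr c * d, c * fr d, fr d * d]])"

lemma tw_apply:
  "(tw (a, b, c, d) *v x) $ 1 = fr a * a * x$1 + fr a * b * x$2 + a * fr b * x$3 + fr b * b * x$4"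
  "(tw (a, b, c, d) *v x) $ 2 = fr a * c * x$1 + fr a * d * x$2 + fr b * c * x$3 + fr b * d * x$4"
  "(tw (a, b, c, d) *v x) $ 3 = a * fr c * x$1 + b * fr c * x$2 + a * fr d * x$3 + b * fr d * x$4"
  "(tw (a, b, c, d) *v x) $ 4 = fr c * c * x$1 + fr c * d * x$2 + c * fr d * x$3 + fr d * d * x$4"
  by (simp_all add: tw_def matrix_vector_mult_def sum_4)

lemma tw_mul: "tw g ** tw g' = tw (mul g g')"
proof -
  have "tw g *v (tw g' *v x) = tw (mul g g') *v x" for x
    by (cases g; cases g') (rule vec4_eqI; simp add: tw_apply mul_def algebra_simps)
  then show ?thesis by (metis matrix_vector_mul_assoc matrix_eq)
qed

lemma tw_one: "tw (1, 0, 0, 1) = mat 1"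
proof -
  have "tw (1, 0, 0, 1) *v x = mat 1 *v x" for x
    by (rule vec4_eqI) (simp_all add: tw_apply)
  then show ?thesis by (metis matrix_eq)
qed

lemma tw_inverse: "g \<in> SL \<Longrightarrow> tw g ** tw (adj g) = mat 1" "g \<in> SL \<Longrightarrow> tw (adj g) ** tw g = mat 1"
  by (simp_all add: tw_mul mul_adj tw_one)

lemma invertible_tw: "g \<in> SL \<Longrightarrow> invertible (tw g)"
  unfolding invertible_def using tw_inverse by blast

text \<open>The second exterior power of \<open>tw\<close>, simplified by determinant 1. Since p14
  and p23 receive the same summand e, their sum s is invariant; (p13, s, p24) transforms as a binary
  quadratic form under g, and (p12, s, p34) under \<open>fr g\<close>.\<close>

definition act :: "'a \<times> 'a \<times> 'a \<times> 'a \<Rightarrow> 'a sextuple \<Rightarrow> 'a sextuple" where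
  "act = (\<lambda>(a, b, c, d) (p12, p13, p14, p23, p24, p34).
     let s = p14 + p23;
         e = (b * c + fr b * fr c) * s + fr a * fr c * p12 + a * c * p13 + fr b * fr d * p34 + b * d * p24
     in (fr a ^ 2 * p12 + fr a * fr b * s + fr b ^ 2 * p34,
         a ^ 2 * p13 + a * b * s + b ^ 2 * p24,
         p14 + e, p23 + e,
         c ^ 2 * p13 + c * d * s + d ^ 2 * p24,
         fr c ^ 2 * p12 + fr c * fr d * s + fr d ^ 2 * p34))"

lemma wedge_tw:
  assumes "g \<in> SL"
  shows "wedge (tw g *v x) (tw g *v y) = act g (wedge x y)"
proof -
  obtain a b c d where g: "g = (a, b, c, d)" and det: "a * d + b * c = 1"
    using assms by (auto simp: SL_def)
  \<comment> \<open>The twisted entries are treated as independent variables. The minors are then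
    polynomial identities in which a determinant factor of one tensor factor appears; both
    determinants become 1 only at the end.\<close>
  define A B C D where "A = fr a" "B = fr b" "C = fr c" "D = fr d"
  have DET: "A * D + B * C = 1"
    using arg_cong[OF det, of fr] by (simp add: A_B_C_D_def)
  define m where "m = (\<lambda>i j. x$i * y$j + x$j * y$i)"
  let ?x = "tw g *v x" and ?y = "tw g *v y"
  note ap = g tw_apply A_B_C_D_def[symmetric]
  have "?x$1 * ?y$2 + ?x$2 * ?y$1 = (a * d + b * c) * (A\<^sup>2 * m 1 2 + A * B * (m 1 4 + m 2 3) + B\<^sup>2 * m 3 4)"
    unfolding m_def ap by (simp add: algebra_simps char2 power2_eq_square)
  moreover have "?x$1 * ?y$3 + ?x$3 * ?y$1 = (A * D + B * C) * (a\<^sup>2 * m 1 3 + a * b * (m 1 4 + m 2 3) + b\<^sup>2 * m 2 4)"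
    unfolding m_def ap by (simp add: algebra_simps char2 power2_eq_square)
  moreover have "?x$2 * ?y$4 + ?x$4 * ?y$2 = (A * D + B * C) * (c\<^sup>2 * m 1 3 + c * d * (m 1 4 + m 2 3) + d\<^sup>2 * m 2 4)"
    unfolding m_def ap by (simp add: algebra_simps char2 power2_eq_square)
  moreover have "?x$3 * ?y$4 + ?x$4 * ?y$3 = (a * d + b * c) * (C\<^sup>2 * m 1 2 + C * D * (m 1 4 + m 2 3) + D\<^sup>2 * m 3 4)"
    unfolding m_def ap by (simp add: algebra_simps char2 power2_eq_square)
  moreover have "?x$1 * ?y$4 + ?x$4 * ?y$1 = (a * d + b * c) * (A * C * m 1 2 + B * D * m 3 4)
      + (A * D + B * C) * (a * c * m 1 3 + b * d * m 2 4)
      + ((a * d) * (A * D) + b * B * c * C) * m 1 4 + (b * c * (A * D) + (a * d) * B * C) * m 2 3"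
    unfolding m_def ap by (simp add: algebra_simps char2)
  moreover have "?x$2 * ?y$3 + ?x$3 * ?y$2 = (a * d + b * c) * (A * C * m 1 2 + B * D * m 3 4)
      + (A * D + B * C) * (a * c * m 1 3 + b * d * m 2 4)
      + ((a * d) * (A * D) + b * B * c * C) * m 2 3 + (b * c * (A * D) + (a * d) * B * C) * m 1 4"
    unfolding m_def ap by (simp add: algebra_simps char2)
  moreover have "a * d = 1 + b * c" "A * D = 1 + B * C"
    using det DET by (simp_all add: add_eq_iff ac_simps)
  ultimately show ?thesis
    unfolding wedge_def act_def g Let_def A_B_C_D_def[symmetric] det DET
    by (simp add: g m_def[symmetric] A_B_C_D_def[symmetric]) (simp add: m_def algebra_simps char2)
qed

lemma act_plucker:
  assumes "g \<in> SL" "p \<in> plucker"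
  shows "act g p \<in> plucker" "(\<lambda>v. tw g *v v) ` line_of p = line_of (act g p)"
proof -
  obtain x y where p: "p = wedge x y" using plucker_wedge assms(2) by blast
  have nz: "p \<noteq> (0, 0, 0, 0, 0, 0)" using assms(2) by (auto simp: plucker_def)
  have w: "act g p = wedge (tw g *v x) (tw g *v y)" by (simp add: p wedge_tw assms(1))
  \<comment> \<open>\<open>act\<close> sends the zero sextuple to itself, so recovering p by the
    inverse shows that \<open>act g p\<close> is nonzero.\<close>
  have "act (adj g) (act g p) = wedge (tw (adj g) *v (tw g *v x)) (tw (adj g) *v (tw g *v y))"
    unfolding w by (rule wedge_tw[symmetric]) (rule adj_closed[OF assms(1)])
  also have "\<dots> = p" by (simp add: matrix_vector_mul_assoc tw_inverse assms(1) p)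
  finally have nz': "act g p \<noteq> (0, 0, 0, 0, 0, 0)"
    using nz by (cases g) (auto simp: act_def adj_def Let_def)
  then show "act g p \<in> plucker" unfolding w by (rule wedge_in_plucker)
  have "(\<lambda>v. tw g *v v) ` vec.span {x, y} = vec.span ((\<lambda>v. tw g *v v) ` {x, y})"
    by (rule vec.span_image[symmetric])
  then show "(\<lambda>v. tw g *v v) ` line_of p = line_of (act g p)"
    using nz nz' unfolding w unfolding p by (simp add: line_of_wedge)
qed

end

section \<open>Counting solutions and stabilizers\<close>

context twisted_field
begin

lemma card_linear_pairs:
  assumes "(u, v) \<noteq> (0, 0)"
  shows "card {(z, w). z * v + u * w = (k::'a)} = CARD('a)"
proof (cases "v = 0")
  case False
  have "{(z, w). z * v + u * w = k} = (\<lambda>w. ((k + u * w) / v, w)) ` UNIV"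
    using False by (auto simp: image_def field_simps char2)
  then show ?thesis by (simp add: card_image inj_on_def)
next
  case True
  then have "{(z, w). z * v + u * w = k} = (\<lambda>z. (z, k / u)) ` UNIV"
    using assms by (auto simp: image_def field_simps)
  then show ?thesis by (simp add: card_image inj_on_def)
qed

lemma card_product_pairs:
  "card {(z, w). z * w = (k::'a)} = (if k = 0 then 2 * CARD('a) - 1 else CARD('a) - 1)"
proof -
  have "card {w. z * w = k} = (if z = 0 then if k = 0 then CARD('a) else 0 else 1)" for z
  proof (cases "z = 0")
    case False
    then have "{w. z * w = k} = {k / z}" by (auto simp: field_simps)
    with False show ?thesis by simp
  qed auto
  then have "card {(z, w). z * w = k} = (if k = 0 then CARD('a) else 0) + (CARD('a) - 1)"
    by (simp add: card_pairs sum_UNIV_If_eq)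
  then show ?thesis by auto
qed

lemma card_SL: "card SL = CARD('a) ^ 3 - CARD('a)"
proof -
  have "card SL = card {((a, c), (d, b)). d * a + c * b = (1::'a)}"
    by (rule bij_betw_same_card[of "\<lambda>(a, b, c, d). ((a, c), (d, b))"],
        rule bij_betw_byWitness[of _ "\<lambda>((a, c), (d, b)). (a, b, c, d)"])
       (auto simp: SL_def ac_simps)
  also have "\<dots> = (\<Sum>(a, c)\<in>UNIV. card {(d, b). d * a + c * b = (1::'a)})"
    by (subst card_pairs, rule sum.cong) (auto split: prod.splits)
  also have "\<dots> = (\<Sum>x\<in>UNIV. if x = (0::'a, 0::'a) then 0 else CARD('a))"
  proof (rule sum.cong)
    fix x :: "'a \<times> 'a"
    show "(case x of (a, c) \<Rightarrow> card {(d, b). d * a + c * b = 1}) = (if x = (0, 0) then 0 else CARD('a))"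
      using card_linear_pairs[of "snd x" "fst x" 1] by (cases x) auto
  qed simp
  also have "\<dots> = (CARD('a) * CARD('a) - 1) * CARD('a)"
    by (simp add: sum_UNIV_If_eq)
  finally show ?thesis by (simp add: algebra_simps power3_eq_cube)
qed

text \<open>In a basis starting with (x, y) such a matrix is upper triangular with diagonal m, 1/m,
  and only the corner entry is free. In the proof c is the free entry if
  \<open>y \<noteq> 0\<close>, and b otherwise.\<close>

lemma card_eigenvector:
  assumes "(x, y) \<noteq> (0, 0)" "m \<noteq> (0::'a)"
  shows "card {(a, b, c, d) \<in> SL. a * x + b * y = m * x \<and> c * x + d * y = m * y} = CARD('a)"
    (is "card ?S = _")
proof (cases "y = 0")
  case False
  let ?f = "\<lambda>c. (1 / m + c * x / y, (m + 1 / m) * x / y + c * (x / y)\<^sup>2, c, m + c * x / y)"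
  have "(a, b, c, d) \<in> ?S \<longleftrightarrow> (a, b, c, d) = ?f c" for a b c d
  proof
    assume S: "(a, b, c, d) \<in> ?S"
    define r where "r = x / y"
    have x: "x = r * y" using False by (simp add: r_def)
    from S have eqs: "(a * r + b) * y = m * r * y" "(c * r + d) * y = m * y" and det: "a * d + b * c = 1"
      by (auto simp: SL_def x algebra_simps)
    then have "a * r + b = m * r" "c * r + d = m" using False by auto
    then have b: "b = a * r + m * r" and d: "d = c * r + m" by (simp_all add: add_eq_iff char2)
    have "m * (a + c * r) = a * d + b * c" unfolding b d by (simp add: algebra_simps char2)
    then have "a + c * r = 1 / m" using assms(2) det by (simp add: field_simps)
    then have a: "a = c * r + 1 / m" by (simp add: add_eq_iff char2 add.commute)
    have "b = (m + 1 / m) * r + c * r\<^sup>2" unfolding b a by (simp add: algebra_simps power2_eq_square)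
    then show "(a, b, c, d) = ?f c" by (simp add: a d r_def ac_simps)
  next
    assume f: "(a, b, c, d) = ?f c"
    define r where "r = x / y"
    have x: "x = r * y" using False by (simp add: r_def)
    have *: "a = 1 / m + c * r" "b = (m + 1 / m) * r + c * r\<^sup>2" "d = m + c * r"
      using f by (auto simp: r_def)
    show "(a, b, c, d) \<in> ?S" using assms(2)
      by (simp add: SL_def * x algebra_simps add_divide_distrib char2 power2_eq_square)
  qed
  then have "?S = range ?f" by (auto simp: image_def)
  then show ?thesis by (simp add: card_image inj_on_def)
next
  case True
  then have x: "x \<noteq> 0" using assms(1) by simp
  have "?S = (\<lambda>b. (m, b, 0, 1 / m)) ` UNIV"
    using x assms(2) by (auto simp: True SL_def image_def field_simps)
  then show ?thesis by (simp add: card_image inj_on_def)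
qed

lemma card_eigenline:
  assumes "(x, y) \<noteq> (0, 0)"
  shows "card {(a, b, c, d) \<in> SL. \<exists>m. m \<noteq> 0 \<and> a * x + b * y = m * x \<and> c * x + d * y = (m::'a) * y}
    = CARD('a) * (CARD('a) - 1)"
proof -
  let ?S = "\<lambda>m. {(a, b, c, d) \<in> SL. a * x + b * y = m * x \<and> c * x + d * y = (m::'a) * y}"
  have "{(a, b, c, d) \<in> SL. \<exists>m. m \<noteq> 0 \<and> a * x + b * y = m * x \<and> c * x + d * y = m * y}
     = (\<Union>m\<in>UNIV - {0}. ?S m)" (is "?T = _") by auto
  then have "card ?T = card (\<Union>m\<in>UNIV - {0}. ?S m)" by (rule arg_cong)
  moreover have "card (\<Union>m\<in>UNIV - {0}. ?S m) = (\<Sum>m\<in>UNIV - {0}. card (?S m))"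
    by (rule card_UN_disjoint) (use assms in auto)
  moreover have "(\<Sum>m\<in>UNIV - {0}. card (?S m)) = (\<Sum>m\<in>UNIV - {0::'a}. CARD('a))"
  proof (rule sum.cong[OF refl])
    fix m :: 'a assume "m \<in> UNIV - {0}"
    then have "m \<noteq> 0" by blast
    then show "card (?S m) = CARD('a)" by (rule card_eigenvector[OF assms])
  qed
  ultimately show ?thesis by (simp add: card_Diff_singleton)
qed

text \<open>In the basis x, y these matrices are diagonal with entries \<open>fr m\<close> and
  \<open>m\<close>, so determinant 1 is the only condition on m.\<close>

lemma card_eigenpair:
  fixes x1 x2 y1 y2 :: 'a
  assumes det: "x1 * y2 + x2 * y1 \<noteq> 0"
  shows "card {(a, b, c, d) \<in> SL. \<exists>m. m \<noteq> 0 \<and> a * x1 + b * x2 = fr m * x1 \<and> c * x1 + d * x2 = fr m * x2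
      \<and> a * y1 + b * y2 = m * y1 \<and> c * y1 + d * y2 = m * y2} = card {m. fr m * m = 1}"
    (is "card ?S = card ?M")
proof -
  define D where "D = x1 * y2 + x2 * y1"
  have D: "D \<noteq> 0" using det by (simp add: D_def)
  \<comment> \<open>This is P diag(fr m, m) P^-1 written out, where P has columns x and y and
    determinant D.\<close>
  define f where "f m = ((fr m * x1 * y2 + m * y1 * x2) / D, (fr m + m) * x1 * y1 / D,
    (fr m + m) * x2 * y2 / D, (fr m * x2 * y1 + m * x1 * y2) / D)" for m
  have fD: "f m = (a, b, c, d) \<longleftrightarrow> a * D = fr m * x1 * y2 + m * y1 * x2 \<and> b * D = (fr m + m) * x1 * y1
     \<and> c * D = (fr m + m) * x2 * y2 \<and> d * D = fr m * x2 * y1 + m * x1 * y2" for m a b c d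
    using D by (auto simp: f_def field_simps)
  have S: "(a, b, c, d) \<in> ?S" if f: "f m = (a, b, c, d)" and m: "fr m * m = 1" for a b c d m
  proof -
    note e = f[unfolded fD]
    have "(a * d + b * c) * D\<^sup>2 = (a * D) * (d * D) + (b * D) * (c * D)"
      by (simp add: algebra_simps power2_eq_square)
    also have "\<dots> = (fr m * m) * D\<^sup>2" 
      unfolding D_def using e[unfolded D_def] by (simp add: algebra_simps char2 power2_eq_square)
    finally have "a * d + b * c = 1" using D m by simp
    moreover have "(a * x1 + b * x2) * D = fr m * x1 * D" "(c * x1 + d * x2) * D = fr m * x2 * D"
      "(a * y1 + b * y2) * D = m * y1 * D" "(c * y1 + d * y2) * D = m * y2 * D"
    proof -
      have "(a * x1 + b * x2) * D = (a * D) * x1 + (b * D) * x2" "(c * x1 + d * x2) * D = (c * D) * x1 + (d * D) * x2"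
        "(a * y1 + b * y2) * D = (a * D) * y1 + (b * D) * y2" "(c * y1 + d * y2) * D = (c * D) * y1 + (d * D) * y2"
        by (simp_all add: algebra_simps)
      then show "(a * x1 + b * x2) * D = fr m * x1 * D" "(c * x1 + d * x2) * D = fr m * x2 * D"
        "(a * y1 + b * y2) * D = m * y1 * D" "(c * y1 + d * y2) * D = m * y2 * D"
        by (simp_all only: e) (simp_all add: D_def algebra_simps char2)
    qed
    moreover have "m \<noteq> 0" using m by auto
    ultimately show ?thesis using D by (auto simp: SL_def)
  qed
  have "?S = f ` ?M"
  proof (intro subset_antisym subsetI)
    fix g assume gS: "g \<in> ?S"
    obtain a b c d where g: "g = (a, b, c, d)" by (cases g) auto
    from gS have det: "a * d + b * c = 1" unfolding g by (simp add: SL_def)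
    from gS obtain m where
      eq: "a * x1 + b * x2 = fr m * x1" "c * x1 + d * x2 = fr m * x2"
        "a * y1 + b * y2 = m * y1" "c * y1 + d * y2 = m * y2"
      unfolding g by blast
    have "(a * d + b * c) * D = (a * x1 + b * x2) * (c * y1 + d * y2) + (c * x1 + d * x2) * (a * y1 + b * y2)"
      by (simp add: D_def algebra_simps char2)
    also have "\<dots> = fr m * m * D" unfolding eq by (simp add: D_def algebra_simps)
    finally have m: "fr m * m = 1" using D det by simp
    have "a * D = (a * x1 + b * x2) * y2 + (a * y1 + b * y2) * x2"
      "b * D = (a * x1 + b * x2) * y1 + (a * y1 + b * y2) * x1"
      "c * D = (c * x1 + d * x2) * y2 + (c * y1 + d * y2) * x2"
      "d * D = (c * x1 + d * x2) * y1 + (c * y1 + d * y2) * x1"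
      by (simp_all add: D_def algebra_simps char2)
    then have "f m = g" unfolding g fD eq by (simp add: algebra_simps)
    with m show "g \<in> f ` ?M" by blast
  next
    fix g assume "g \<in> f ` ?M"
    then obtain m where m: "g = f m" "fr m * m = 1" by blast
    obtain a b c d where g: "f m = (a, b, c, d)" by (cases "f m") auto
    show "g \<in> ?S" unfolding m(1) g by (rule S[OF g m(2)])
  qed
  moreover have "inj_on f ?M"
  proof (rule inj_onI)
    fix m m' assume mm: "m \<in> ?M" "m' \<in> ?M" "f m = f m'"
    obtain a b c d where g: "f m = (a, b, c, d)" by (cases "f m") auto
    from g mm(3) have g': "f m' = (a, b, c, d)" by simp
    have e: "fr m * x1 * y2 + m * y1 * x2 = fr m' * x1 * y2 + m' * y1 * x2"
      "(fr m + m) * x1 * y1 = (fr m' + m') * x1 * y1" "(fr m + m) * x2 * y2 = (fr m' + m') * x2 * y2"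
      "fr m * x2 * y1 + m * x1 * y2 = fr m' * x2 * y1 + m' * x1 * y2"
      using g[unfolded fD] g'[unfolded fD] by metis+
    have "m * y1 * D = m' * y1 * D" "m * y2 * D = m' * y2 * D"
    proof -
      have "m * y1 * D = (fr m * x1 * y2 + m * y1 * x2) * y1 + (fr m + m) * x1 * y1 * y2"
        "m * y2 * D = (fr m + m) * x2 * y2 * y1 + (fr m * x2 * y1 + m * x1 * y2) * y2" for m
        by (simp_all add: D_def algebra_simps char2)
      then show "m * y1 * D = m' * y1 * D" "m * y2 * D = m' * y2 * D" by (simp_all only: e)
    qed
    moreover have "y1 \<noteq> 0 \<or> y2 \<noteq> 0" using det by auto
    ultimately show "m = m'" using D by auto
  qed
  ultimately show ?thesis by (simp add: card_image)
qed

section \<open>The orthogonal group of a binary quadratic form in characteristic two\<close>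

definition rotations :: "'a \<Rightarrow> 'a \<Rightarrow> ('a \<times> 'a \<times> 'a \<times> 'a) set" where
  "rotations z w = {(a, b, c, d) \<in> SL. b = z * (a + d) \<and> c = w * (a + d)}"

text \<open>Trace 0 and determinant 1 make these elements involutions by Cayley-Hamilton.\<close>

definition reflections :: "'a \<Rightarrow> 'a \<Rightarrow> ('a \<times> 'a \<times> 'a \<times> 'a) set" where
  "reflections z w = {(a, b, c, d) \<in> SL. d = a \<and> a = b * w + c * z}"

text \<open>
  An element \<open>g\<close> of \<open>SL\<close> fixes the form \<open>z X\<^sup>2 + X Y + w Y\<^sup>2\<close> iff \<open>g M g\<^sup>T\<close> is the matrix
  \<open>M = (z, 1; 0, w)\<close> or its transpose; the parameter \<open>e\<close>, the Dickson invariant, tells which.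
\<close>
lemma form_stabilizer:
  fixes a b c d z w :: 'a
  assumes det: "a * d + b * c = 1"
  defines "X1 \<equiv> a\<^sup>2 * z + a * b + b\<^sup>2 * w" and "X2 \<equiv> c\<^sup>2 * z + c * d + d\<^sup>2 * w"
    and "e \<equiv> b * c + a * c * z + b * d * w"
  shows "X1 = z \<and> X2 = w \<and> e = 0 \<longleftrightarrow> (a, b, c, d) \<in> rotations z w"
    and "X1 = z \<and> X2 = w \<and> e = 1 \<longleftrightarrow> (a, b, c, d) \<in> reflections z w"
    and "X1 = z \<Longrightarrow> X2 = w \<Longrightarrow> e = 0 \<or> e = 1"
proof -
  \<comment> \<open>With determinant 1 the matrix g M g^T is N = (X1, e + 1; e, X2). The first four
    identities are the entries of g M = N g^-T, the fifth compares determinants and will give e^2 +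
    e = 0; powers of the determinant make them valid before it is set to 1.\<close>
  have i1: "a * z * (a * d + b * c) = X1 * d + (e + (a * d + b * c)) * b"
   and i2: "(c + d * w) * (a * d + b * c) = e * c + X2 * a"
   and i3: "(a + b * w) * (a * d + b * c) = X1 * c + (e + (a * d + b * c)) * a"
   and i4: "c * z * (a * d + b * c) = e * d + X2 * b"
   and i5: "X1 * X2 + (e + (a * d + b * c)) * e = z * w * (a * d + b * c)\<^sup>2"
    by (simp_all add: X1_def X2_def e_def algebra_simps char2 power2_eq_square)
  note i = i1 i2 i3 i4 i5
  note i' = i[unfolded det, simplified]
  show "X1 = z \<and> X2 = w \<and> e = 0 \<longleftrightarrow> (a, b, c, d) \<in> rotations z w"
  proof
    assume "X1 = z \<and> X2 = w \<and> e = 0"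
    then have "a * z = z * d + b" "c + d * w = w * a" using i' by auto
    then have "b = z * (a + d)" "c = w * (a + d)" by (simp_all add: algebra_simps add_eq_iff char2)
    then show "(a, b, c, d) \<in> rotations z w" using det by (auto simp: rotations_def SL_def)
  next
    assume "(a, b, c, d) \<in> rotations z w"
    then have b: "b = z * (a + d)" and c: "c = w * (a + d)" by (auto simp: rotations_def)
    have "X1 = z * (a * d + b * c)" "X2 = w * (a * d + b * c)" "e = 0"
      unfolding X1_def X2_def e_def b c by (simp_all add: algebra_simps char2 power2_eq_square)
    then show "X1 = z \<and> X2 = w \<and> e = 0" by (simp add: det)
  qed
  show "X1 = z \<and> X2 = w \<and> e = 1 \<longleftrightarrow> (a, b, c, d) \<in> reflections z w"
  proof
    assume "X1 = z \<and> X2 = w \<and> e = 1"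
    then have "a + b * w = z * c" "c * z = d + w * b" using i' by (auto simp: char2)
    then have "a = b * w + c * z" "d = b * w + c * z" by (simp_all add: algebra_simps add_eq_iff char2)
    then show "(a, b, c, d) \<in> reflections z w" using det by (auto simp: reflections_def SL_def)
  next
    assume "(a, b, c, d) \<in> reflections z w"
    then have d: "d = a" and a: "a = b * w + c * z" by (auto simp: reflections_def)
    have "X1 = z * (a * d + b * c)" "X2 = w * (a * d + b * c)" "e = a * d + b * c"
      unfolding X1_def X2_def e_def d a by (simp_all add: algebra_simps char2 power2_eq_square)
    then show "X1 = z \<and> X2 = w \<and> e = 1" by (simp add: det)
  qed
  assume "X1 = z" "X2 = w"
  then have "e * (e + 1) = 0" using i'(5) by (simp add: mult.commute)
  then show "e = 0 \<or> e = 1" by (auto simp: add_eq_0)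
qed

lemma rotations_Int_reflections: "rotations z w \<inter> reflections z' w' = {}"
  by (auto simp: rotations_def reflections_def SL_def char2)

text \<open>Conic points are counted on the lines y = m x through the origin: x^2 = 1 / \<phi> m has
  exactly one root, since squaring is bijective.\<close>

lemma card_scaled_values:
  fixes \<phi> :: "'a \<Rightarrow> 'a"
  shows "card {(x, y). x \<noteq> 0 \<and> x\<^sup>2 * \<phi> (y / x) = 1} = card {m. \<phi> m \<noteq> 0}"
proof -
  obtain s where s: "\<And>x. (s x)\<^sup>2 = (x::'a)" using square_surj by metis
  let ?f = "\<lambda>m. (1 / s (\<phi> m), m / s (\<phi> m))"
  let ?S = "{(x, y). x \<noteq> 0 \<and> x\<^sup>2 * \<phi> (y / x) = 1}"
  have s0: "s x = 0 \<longleftrightarrow> x = 0" for x using s[of x] by (metis zero_eq_power2 power_zero_numeral)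
  have "bij_betw ?f {m. \<phi> m \<noteq> 0} ?S"
  proof (rule bij_betwI[of _ _ _ "\<lambda>(x, y). y / x"])
    show "?f \<in> {m. \<phi> m \<noteq> 0} \<rightarrow> ?S"
      by (auto simp: s0 power_divide s)
    show "(\<lambda>(x, y). y / x) \<in> ?S \<rightarrow> {m. \<phi> m \<noteq> 0}" by auto
    show "(\<lambda>(x, y). y / x) (?f m) = m" if "m \<in> {m. \<phi> m \<noteq> 0}" for m
      using that by (simp add: s0)
    show "?f ((\<lambda>(x, y). y / x) p) = p" if "p \<in> ?S" for p
    proof -
      obtain x y where p: "p = (x, y)" "x \<noteq> 0" "x\<^sup>2 * \<phi> (y / x) = 1" using \<open>p \<in> _\<close> by auto
      have "(s (\<phi> (y / x)))\<^sup>2 = (1 / x)\<^sup>2" using p by (simp add: s field_simps)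
      then have "s (\<phi> (y / x)) = 1 / x" by (simp only: square_eq_iff)
      then show ?thesis using p by simp
    qed
  qed
  then show ?thesis by (rule bij_betw_same_card[symmetric])
qed

text \<open>Rotations are d + k T with T = (1, z; w, 0), so they are the norm one elements of the
  algebra with T^2 + T = z w. The direction k = 0 contributes only the identity; the other
  directions m = d / k contribute one element each unless m^2 + m = z w.\<close>

lemma card_rotations: "card (rotations z w) = 1 + (CARD('a) - card {m. m\<^sup>2 + m = z * w})"
proof -
  have "card (rotations z w) = card {(k, d). d\<^sup>2 + d * k + z * w * k\<^sup>2 = 1}"
  proof (rule bij_betw_same_card[of "\<lambda>(a, b, c, d). (a + d, d)"],
      rule bij_betw_byWitness[of _ "\<lambda>(k, d). (d + k, z * k, w * k, d)"])
    show "(\<lambda>(a, b, c, d). (a + d, d)) ` rotations z w \<subseteq> {(k, d). d\<^sup>2 + d * k + z * w * k\<^sup>2 = 1}"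
    proof
      fix x assume "x \<in> (\<lambda>(a, b, c, d). (a + d, d)) ` rotations z w"
      then obtain a b c d where x: "x = (a + d, d)" and "(a, b, c, d) \<in> rotations z w" by auto
      then have "a * d + (z * (a + d)) * (w * (a + d)) = 1" by (auto simp: rotations_def SL_def)
      moreover have "d\<^sup>2 + d * (a + d) + z * w * (a + d)\<^sup>2 = a * d + (z * (a + d)) * (w * (a + d))"
        by (simp add: algebra_simps char2 power2_eq_square)
      ultimately show "x \<in> {(k, d). d\<^sup>2 + d * k + z * w * k\<^sup>2 = 1}" by (simp add: x)
    qed
    show "(\<lambda>(k, d). (d + k, z * k, w * k, d)) ` {(k, d). d\<^sup>2 + d * k + z * w * k\<^sup>2 = 1} \<subseteq> rotations z w"
      by (auto simp: rotations_def SL_def algebra_simps char2 power2_eq_square)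
  qed (auto simp: rotations_def algebra_simps char2)
  also have "{(k, d). d\<^sup>2 + d * k + z * w * k\<^sup>2 = 1} =
     insert (0, 1) {(k, d). k \<noteq> 0 \<and> k\<^sup>2 * ((d / k)\<^sup>2 + d / k + z * w) = 1}"
  proof -
    have "d\<^sup>2 + d * k + z * w * k\<^sup>2 = 1 \<longleftrightarrow>
       (k, d) = (0, 1) \<or> k \<noteq> 0 \<and> k\<^sup>2 * ((d / k)\<^sup>2 + d / k + z * w) = 1" for k d :: 'a
    proof (cases "k = 0")
      case False
      then have "k\<^sup>2 * ((d / k)\<^sup>2 + d / k + z * w) = d\<^sup>2 + d * k + z * w * k\<^sup>2"
        by (simp add: field_simps power2_eq_square)
      with False show ?thesis by simp
    qed (simp add: square_eq_1)
    then show ?thesis by auto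
  qed
  also have "card \<dots> = Suc (card {(k, d). k \<noteq> 0 \<and> k\<^sup>2 * ((d / k)\<^sup>2 + d / k + z * w) = 1})"
    by (rule card_insert_disjoint) auto
  also have "\<dots> = Suc (card {m. \<not> m\<^sup>2 + m = z * w})"
    by (subst card_scaled_values) (simp add: add_eq_0)
  finally show ?thesis by (simp add: card_Collect_not)
qed

text \<open>Squaring commutes with t^2 + t. The equation for reflections yields (z w)^2 where the
  one for rotations has z w.\<close>

lemma card_artin_schreier_square: "card {m. m\<^sup>2 + m = (k::'a)\<^sup>2} = card {m. m\<^sup>2 + m = k}"
proof -
  have "(\<exists>t. t\<^sup>2 + t = k\<^sup>2) \<longleftrightarrow> (\<exists>t. t\<^sup>2 + t = k)"
  proof
    assume "\<exists>t. t\<^sup>2 + t = k\<^sup>2"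
    then obtain t where t: "t\<^sup>2 + t = k\<^sup>2" by blast
    obtain s where "t = s\<^sup>2" using square_surj by blast
    with t have "(s\<^sup>2 + s)\<^sup>2 = k\<^sup>2" by (simp add: add_square)
    then show "\<exists>t. t\<^sup>2 + t = k" by (auto simp only: square_eq_iff)
  next
    assume "\<exists>t. t\<^sup>2 + t = k"
    then obtain t where "t\<^sup>2 + t = k" by blast
    then have "(t\<^sup>2)\<^sup>2 + t\<^sup>2 = k\<^sup>2" by (metis add_square)
    then show "\<exists>t. t\<^sup>2 + t = k\<^sup>2" by blast
  qed
  then show ?thesis by (simp add: card_artin_schreier)
qed

lemma card_reflections: "card (reflections z w) = 1 + (CARD('a) - card {m. m\<^sup>2 + m = z * w})"
proof -
  let ?B = "{(b, c). b \<noteq> 0 \<and> b\<^sup>2 * ((w + c / b * z)\<^sup>2 + c / b) = 1}"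
  have "card (reflections z w) = card {(b, c). (b * w + c * z)\<^sup>2 + b * c = 1}"
    by (rule bij_betw_same_card[of "\<lambda>(a, b, c, d). (b, c)"],
      rule bij_betw_byWitness[of _ "\<lambda>(b, c). (b * w + c * z, b, c, b * w + c * z)"])
      (auto simp: reflections_def SL_def power2_eq_square)
  also have "{(b, c). (b * w + c * z)\<^sup>2 + b * c = 1} = {(b::'a, c). b = 0 \<and> c * z = 1} \<union> ?B"
  proof -
    have "(b * w + c * z)\<^sup>2 + b * c = 1 \<longleftrightarrow> (b = 0 \<and> c * z = 1) \<or> (b \<noteq> 0 \<and> b\<^sup>2 * ((w + c / b * z)\<^sup>2 + c / b) = 1)"
      for b c
    proof (cases "b = 0")
      case False
      then have "b * w + c * z = b * (w + c / b * z)" "b * c = b\<^sup>2 * (c / b)"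
        by (simp_all add: algebra_simps power2_eq_square)
      then have "(b * w + c * z)\<^sup>2 + b * c = (b * (w + c / b * z))\<^sup>2 + b\<^sup>2 * (c / b)"
        by (rule arg_cong2[of _ _ _ _ "\<lambda>x y. x\<^sup>2 + y"])
      then have "b\<^sup>2 * ((w + c / b * z)\<^sup>2 + c / b) = (b * w + c * z)\<^sup>2 + b * c"
        by (simp only: power_mult_distrib distrib_left[of "b\<^sup>2"])
      with False show ?thesis by simp
    qed (simp add: square_eq_1)
    then show ?thesis by auto
  qed
  also have "card \<dots> = card {(b::'a, c). b = 0 \<and> c * z = 1} + card ?B"
    by (rule card_Un_disjoint) auto
  also have "card ?B = card {m. \<not> (w + m * z)\<^sup>2 + m = 0}"
    by (subst card_scaled_values[where \<phi> = "\<lambda>m. (w + m * z)\<^sup>2 + m"]) simp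
  also have "\<dots> = CARD('a) - card {m. (w + m * z)\<^sup>2 + m = 0}" by (rule card_Collect_not)
  finally have *: "card (reflections z w) = card {(b::'a, c). b = 0 \<and> c * z = 1} + (CARD('a) - card {m. (w + m * z)\<^sup>2 + m = 0})" .
  show ?thesis
  proof (cases "z = 0")
    \<comment> \<open>The excluded directions now solve a linear equation with the single root w^2,
      and b = 0 gives nothing: q - 1 reflections, which agrees with 1 + (q - 2).\<close>
    case True
    have "{m::'a. m\<^sup>2 + m = 0} = {0, 1}"
      using artin_schreier_eq_iff[of _ 0] by auto
    moreover have "{m. (w + m * z)\<^sup>2 + m = 0} = {w\<^sup>2}" by (auto simp: True add_eq_0)
    moreover have "{(b::'a, c). b = 0 \<and> c * z = 1} = {}" using True by auto
    ultimately show ?thesis using * q_ge_8 by (simp add: True)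
  next
    case False
    have "{(b::'a, c). b = 0 \<and> c * z = 1} = {(0, 1 / z)}" using False by (auto simp: field_simps)
    moreover have "card {m. (w + m * z)\<^sup>2 + m = 0} = card {t. t\<^sup>2 + t = (z * w)\<^sup>2}"
    proof (rule bij_betw_same_card[of "\<lambda>m. z\<^sup>2 * m"], rule bij_betw_byWitness[of _ "\<lambda>t. t / z\<^sup>2"])
      have key: "(z\<^sup>2 * m)\<^sup>2 + z\<^sup>2 * m + (z * w)\<^sup>2 = z\<^sup>2 * ((w + m * z)\<^sup>2 + m)" for m
        by (simp add: algebra_simps char2 power2_eq_square)
      have key2: "(z\<^sup>2 * m)\<^sup>2 + z\<^sup>2 * m = (z * w)\<^sup>2 \<longleftrightarrow> (w + m * z)\<^sup>2 + m = 0" for m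
        using False by (metis add_eq_0 key mult_eq_0_iff power_eq_0_iff)
      show "(\<lambda>m. z\<^sup>2 * m) ` {m. (w + m * z)\<^sup>2 + m = 0} \<subseteq> {t. t\<^sup>2 + t = (z * w)\<^sup>2}"
        using key2 by blast
      show "(\<lambda>t. t / z\<^sup>2) ` {t. t\<^sup>2 + t = (z * w)\<^sup>2} \<subseteq> {m. (w + m * z)\<^sup>2 + m = 0}"
      proof
        fix m assume "m \<in> (\<lambda>t. t / z\<^sup>2) ` {t. t\<^sup>2 + t = (z * w)\<^sup>2}"
        then obtain t where t: "m = t / z\<^sup>2" "t\<^sup>2 + t = (z * w)\<^sup>2" by blast
        then have "t = z\<^sup>2 * m" using False by simp
        with t(2) show "m \<in> {m. (w + m * z)\<^sup>2 + m = 0}" using key2 by blast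
      qed
    qed (use False in auto)
    ultimately show ?thesis using * by (simp add: card_artin_schreier_square)
  qed
qed

end

section \<open>The stabilizer of the arc\<close>

lemma coeff_sum_list_monom:
  assumes "distinct (map snd cs)" "(c, e) \<in> set cs"
  shows "coeff (\<Sum>(c, e)\<leftarrow>cs. monom c e) e = (c::'b::comm_ring_1)"
proof -
  have 0: "coeff (\<Sum>(c, e)\<leftarrow>cs. monom c e) e = (0::'b)" if "e \<notin> snd ` set cs" for cs :: "('b \<times> nat) list" and e
    using that by (induction cs) auto
  show ?thesis using assms
  proof (induction cs)
    case (Cons ce cs)
    then show ?case using 0[of e cs] by (cases "ce = (c, e)") (auto simp: image_iff split: prod.splits)
  qed simp
qed

text \<open>Turns an identity valid for all t into equations for the coefficients; the exponents may
  be symbolic, such as s + 1, as long as they are distinct and below q.\<close>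

lemma monomials_independent:
  fixes cs :: "('b::{field,finite} \<times> nat) list"
  assumes "\<And>t. (\<Sum>(c, e)\<leftarrow>cs. c * t ^ e) = 0" "distinct (map snd cs)" "\<forall>e\<in>set (map snd cs). e < CARD('b)"
  shows "\<forall>c\<in>set (map fst cs). c = 0"
proof -
  define p where "p = (\<Sum>(c, e)\<leftarrow>cs. monom c e)"
  have "poly p t = (\<Sum>(c, e)\<leftarrow>cs. c * t ^ e)" for t
    unfolding p_def by (induction cs) (auto simp: poly_monom)
  moreover have "degree p < CARD('b)"
    unfolding p_def using assms(3)
  proof (induction cs)
    case Nil
    then show ?case using finite_UNIV_card_ge_0[where ?'a='b] by simp
  next
    case (Cons a cs)
    then show ?case
      by (auto split: prod.splits intro!: degree_add_less le_less_trans[OF degree_monom_le])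
  qed
  ultimately have "p = 0" using assms(1) by (intro poly_eq_0_finite_field) auto
  then show ?thesis using coeff_sum_list_monom[OF assms(2)] unfolding p_def by fastforce
qed

context twisted_field
begin

text \<open>The pure tensor of \<open>fr (x, y)\<close> and (x, y): a homogeneous parametrisation of
  the arc that includes the point at infinity.\<close>

definition arc_vector :: "'a \<Rightarrow> 'a \<Rightarrow> 'a^4" where
  "arc_vector x y = vector [fr x * x, fr x * y, x * fr y, fr y * y]"

lemma tw_arc_vector: "tw (a, b, c, d) *v arc_vector x y = arc_vector (a * x + b * y) (c * x + d * y)"
  by (rule vec4_eqI) (simp_all add: tw_apply arc_vector_def algebra_simps)

lemma arc_vector_scale: "arc_vector (k * x) (k * y) = (fr k * k) *s arc_vector x y"
  by (rule vec4_eqI) (simp_all add: arc_vector_def algebra_simps)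

lemma arc_vector_eq_0: "arc_vector x y = 0 \<longleftrightarrow> (x, y) = (0, 0)"
  by (auto simp: arc_vector_def vec_eq_iff forall_4)

lemma span_singleton_scale:
  assumes "k \<noteq> (0::'a)"
  shows "vec.span {k *s v} = vec.span {v :: 'a^4}"
proof -
  have "j *s v \<in> range (\<lambda>i. i *s (k *s v))" for j
    by (rule range_eqI[of _ _ "j / k"]) (use assms in simp)
  then show ?thesis by (auto simp: vec.span_singleton)
qed

lemma arc_eq: "arc h = {vec.span {arc_vector x y} |x y. (x, y) \<noteq> (0, 0)}"
proof -
  have 1: "PG3_point 1 t (t ^ (2^h)) (t ^ (2^h + 1)) = vec.span {arc_vector 1 t}" for t
    by (simp add: PG3_point_def arc_vector_def fr_def mult.commute)
  have 2: "PG3_point 0 0 0 1 = vec.span {arc_vector 0 1}"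
    by (simp add: PG3_point_def arc_vector_def)
  have 3: "vec.span {arc_vector x y} \<in> arc h" if "(x, y) \<noteq> (0, 0)" for x y
  proof (cases "x = 0")
    case True
    then have "arc_vector x y = (fr y * y) *s arc_vector 0 1"
      using arc_vector_scale[of y 0 1] by simp
    moreover have "fr y * y \<noteq> 0" using True that by simp
    ultimately show ?thesis unfolding arc_def 2 by (simp add: span_singleton_scale)
  next
    case False
    then have "arc_vector x y = (fr x * x) *s arc_vector 1 (y / x)"
      using arc_vector_scale[of x 1 "y / x"] by simp
    moreover have "fr x * x \<noteq> 0" using False by simp
    ultimately have "vec.span {arc_vector x y} = vec.span {arc_vector 1 (y / x)}"
      by (simp add: span_singleton_scale)
    then show ?thesis unfolding arc_def 1 by blast
  qed
  have 4: "L \<in> {vec.span {arc_vector x y} |x y. (x, y) \<noteq> (0, 0)}" if "L \<in> arc h" for L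
    using that unfolding arc_def 1 2 by fastforce
  show ?thesis
  proof (intro subset_antisym subsetI)
    fix L assume "L \<in> {vec.span {arc_vector x y} |x y. (x, y) \<noteq> (0, 0)}"
    then obtain x y where "L = vec.span {arc_vector x y}" "(x, y) \<noteq> (0, 0)" by blast
    then show "L \<in> arc h" using 3 by simp
  qed (rule 4)
qed

lemma projectivity_span: "projectivity M (vec.span {v}) = vec.span {M *v v :: 'a^4}"
  using vec.span_image[of M "{v}"] by (simp add: projectivity_def PG3_subspaces_def)

lemma projectivity_tw_arc:
  assumes "g \<in> SL"
  shows "projectivity (tw g) ` arc h = arc h"
proof -
  have sub: "projectivity (tw g) ` arc h \<subseteq> arc h" if "g \<in> SL" for g
  proof
    fix P assume "P \<in> projectivity (tw g) ` arc h"
    then obtain x y where P: "P = projectivity (tw g) (vec.span {arc_vector x y})" "(x, y) \<noteq> (0, 0)"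
      unfolding arc_eq by blast
    obtain a b c d where g: "g = (a, b, c, d)" by (cases g) auto
    have "arc_vector (a * x + b * y) (c * x + d * y) \<noteq> 0"
    proof
      assume "arc_vector (a * x + b * y) (c * x + d * y) = 0"
      then have "tw (adj g) *v (tw g *v arc_vector x y) = 0"
        by (simp add: g tw_arc_vector)
      then show False using P(2) that by (simp add: matrix_vector_mul_assoc tw_inverse arc_vector_eq_0)
    qed
    then show "P \<in> arc h"
      unfolding P(1) projectivity_span unfolding g tw_arc_vector arc_eq arc_vector_eq_0 by blast
  qed
  have "P \<in> projectivity (tw g) ` arc h" if "P \<in> arc h" for P
  proof -
    have P: "P \<in> PG3_subspaces" using that arc_subset_points by (auto simp: PG3_points_def PG3_subspaces_def)
    have "projectivity (tw g) (projectivity (tw (adj g)) P) = P"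
      using projectivity_mult[of "tw g" "tw (adj g)"] P assms
      by (metis compose_eq projectivity_one restrict_apply' tw_inverse(1))
    moreover have "projectivity (tw (adj g)) P \<in> arc h" using sub[OF adj_closed[OF assms]] that by blast
    ultimately show ?thesis by (metis imageI)
  qed
  then show ?thesis using sub[OF assms] by blast
qed

text \<open>Otherwise t^4 = t on a field with at least 8 elements. This excludes the exchange of X2
  and X3, that is, of the two rulings of the quadric.\<close>

lemma frob_double_not_identity: "\<not> (\<forall>t. fr (fr t) = t)"
proof
  assume *: "\<forall>t. fr (fr t) = t"
  have "gcd n 2 \<le> 2" "gcd n 2 > 0" by (simp_all add: gcd_le2_nat)
  then have "gcd n (2 * h) = 1 \<or> gcd n (2 * h) = 2" unfolding gcd_double by linarith
  moreover have "t ^ (2 ^ gcd n (2 * h)) = t" for t :: 'a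
    by (rule frob_gcd_fixed) (use * in \<open>simp add: fr_def mult_2 power_add power_mult\<close>)
  ultimately have "(\<forall>t::'a. t ^ 2 = t) \<or> (\<forall>t::'a. t ^ 4 = t)" by fastforce
  then have t4: "t ^ 4 = t" for t :: 'a
  proof
    assume "\<forall>t::'a. t ^ 2 = t"
    then have "(t ^ 2) ^ 2 = t" by simp
    then show ?thesis by simp
  qed blast
  have "\<forall>c\<in>set (map fst [(1::'a, 1::nat), (1, 4)]). c = 0"
    by (rule monomials_independent) (use t4 q_ge_8 in \<open>simp_all add: add_self\<close>)
  then show False by simp
qed

text \<open>The letters b, c, d, e stand for the four rows and the digits for columns 2 and 3 of a
  matrix whose outer columns are multiples of unit vectors; \<open>rows\<close> says that the
  all-one vector has eigenvalue \<open>\<gamma>\<close>.\<close>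

lemma arc_rigidity_entries:
  fixes \<alpha> \<gamma> \<delta> b2 b3 c2 c3 d2 d3 e2 e3 :: 'a
  assumes nz: "\<alpha> \<noteq> 0" "\<gamma> \<noteq> 0" "\<delta> \<noteq> 0"
    and rows: "\<alpha> + b2 + b3 = \<gamma>" "c2 + c3 = \<gamma>" "d2 + d3 = \<gamma>" "e2 + e3 + \<delta> = \<gamma>"
    and arc: "\<And>t. \<exists>k x y. \<alpha> + b2 * t + b3 * fr t = k * (fr x * x) \<and> c2 * t + c3 * fr t = k * (fr x * y)
        \<and> d2 * t + d3 * fr t = k * (x * fr y) \<and> e2 * t + e3 * fr t + \<delta> * (fr t * t) = k * (fr y * y)"
  shows "b2 = 0 \<and> b3 = 0 \<and> c3 = 0 \<and> d2 = 0 \<and> e2 = 0 \<and> e3 = 0"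
proof -
  define L1 L2 L3 L4 where "L1 t = \<alpha> + b2 * t + b3 * fr t" and "L2 t = c2 * t + c3 * fr t"
    and "L3 t = d2 * t + d3 * fr t" and "L4 t = e2 * t + e3 * fr t + \<delta> * (fr t * t)" for t
  note L = L1_def L2_def L3_def L4_def
  have kxy: "\<exists>k x y. L1 t = k * (fr x * x) \<and> L2 t = k * (fr x * y) \<and> L3 t = k * (x * fr y) \<and> L4 t = k * (fr y * y)"
    for t using arc[of t] by (simp add: L)
  \<comment> \<open>\<open>R1\<close> is the quadric; \<open>R2\<close> expresses that L3 / L1 is
    the \<open>fr\<close>-image of L2 / L1, as on the arc.\<close>
  have R1: "L1 t * L4 t = L2 t * L3 t" for t using kxy[of t] by auto
  have R2: "fr (L2 t) * L1 t = fr (L1 t) * L3 t" for t using kxy[of t] by auto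
  \<comment> \<open>h may exceed n, so \<open>fr\<close> is rewritten with an exponent s below q
    before degrees are compared.\<close>
  define m s where "m = h mod n" and "s = (2::nat) ^ m"
  have fr_s: "fr t = t ^ s" for t
  proof -
    have "t ^ (2 ^ h) = t ^ (2 ^ (n * (h div n) + m))" by (simp add: m_def)
    also have "\<dots> = (t ^ (2 ^ (n * (h div n)))) ^ (2 ^ m)" by (simp only: power_add power_mult)
    finally show ?thesis by (simp add: fr_def s_def frob_period)
  qed
  have m: "0 < m" "m < n"
  proof -
    have "m \<noteq> 0"
    proof
      assume "m = 0"
      then have "n dvd h" by (simp add: m_def dvd_eq_mod_eq_0)
      then have "gcd n h = n" by (simp add: gcd_nat.absorb1)
      then show False using coprime_nh n_ge_3 by simp
    qed
    then show "0 < m" "m < n" using n_ge_3 by (auto simp: m_def)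
  qed
  have pw: "t ^ Suc s = fr t * t" "t ^ (s + 1) = fr t * t" "t ^ (s + 2) = fr t * t\<^sup>2" 
    "t ^ (2 * s) = (fr t)\<^sup>2" "t ^ (2 * s + 1) = (fr t)\<^sup>2 * t" for t
  proof -
    have "t ^ (2 * s) = (t ^ s)\<^sup>2" by (metis power_mult mult.commute)
    then show "t ^ Suc s = fr t * t" "t ^ (s + 1) = fr t * t" "t ^ (s + 2) = fr t * t\<^sup>2"
      "t ^ (2 * s) = (fr t)\<^sup>2" "t ^ (2 * s + 1) = (fr t)\<^sup>2 * t"
      by (simp_all add: fr_s power_add) (simp add: power2_eq_square)
  qed
  \<comment> \<open>The generic exponents 1, 2, s, s + 1, s + 2, 2 s, 2 s + 1 are distinct and below
    q except at the two ends: s = 2 merges s with 2, and 2 s = q turns t^(2 s) into t.\<close>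
  consider "m = 1" | "m = n - 1" "m > 1" | "m > 1" "m < n - 1" using m by linarith
  then show ?thesis
  proof cases
    case 1
    then have s2: "s = 2" by (simp add: s_def)
    have fr2: "fr t = t\<^sup>2" for t by (simp add: fr_s s2)
    \<comment> \<open>For s = 2 the arc is a twisted cubic; this further quadric through it supplies
      the equations lost by the merging of exponents.\<close>
    have R3: "(L2 t)\<^sup>2 = L1 t * L3 t" for t using kxy[of t] by (auto simp: fr2 power2_eq_square)
    have "\<forall>c\<in>set (map fst [(\<alpha> * e2, 1::nat), (\<alpha> * e3 + b2 * e2 + c2 * d2, 2),
        (\<alpha> * \<delta> + b2 * e3 + b3 * e2 + c2 * d3 + c3 * d2, 3), (b2 * \<delta> + b3 * e3 + c3 * d3, 4), (b3 * \<delta>, 5)]). c = 0"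
    proof (rule monomials_independent)
      show "(\<Sum>(c, e)\<leftarrow>[(\<alpha> * e2, 1::nat), (\<alpha> * e3 + b2 * e2 + c2 * d2, 2),
        (\<alpha> * \<delta> + b2 * e3 + b3 * e2 + c2 * d3 + c3 * d2, 3), (b2 * \<delta> + b3 * e3 + c3 * d3, 4), (b3 * \<delta>, 5)]. c * t ^ e) = 0"
        for t
      proof -
        have "L1 t * L4 t + L2 t * L3 t = 0" using R1 by (simp add: add_self)
        then show ?thesis by (simp add: L fr2 algebra_simps eval_nat_numeral)
      qed
    qed (use q_ge_8 in auto)
    then have 1: "e2 = 0" "b3 = 0" "\<alpha> * e3 = c2 * d2" "b2 * \<delta> = c3 * d3"
      using nz by (auto simp: add_eq_0)
    have "\<forall>c\<in>set (map fst [(\<alpha> * d2, 1::nat), (c2\<^sup>2 + \<alpha> * d3 + b2 * d2, 2), (b2 * d3, 3), (c3\<^sup>2, 4)]). c = 0"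
    proof (rule monomials_independent)
      show "(\<Sum>(c, e)\<leftarrow>[(\<alpha> * d2, 1::nat), (c2\<^sup>2 + \<alpha> * d3 + b2 * d2, 2), (b2 * d3, 3), (c3\<^sup>2, 4)]. c * t ^ e) = 0" for t
      proof -
        have "(L2 t)\<^sup>2 + L1 t * L3 t = 0" using R3 by (simp add: add_self)
        then show ?thesis by (simp add: L 1 fr2 algebra_simps two_eq_0 eval_nat_numeral)
      qed
    qed (use q_ge_8 in auto)
    then have "d2 = 0" "c3 = 0" "b2 * d3 = 0" using nz by auto
    then show ?thesis using 1 rows nz by auto
  next
    case 2
    have sq: "2 * s = CARD('a)" using 2(1) m n_ge_3 unfolding card_UNIV s_def by (simp flip: power_Suc)
    have s4: "4 \<le> s" using power_increasing[of 2 m "2::nat"] 2(2) by (simp add: s_def)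
    have frsq: "(fr t)\<^sup>2 = t" for t
      using power_card_eq_same[of t] unfolding sq[symmetric] pw .
    \<comment> \<open>Here squaring inverts \<open>fr\<close>, so the situation is that of the
      twisted cubic with X2 and X3 interchanged.\<close>
    have R3: "(L3 t)\<^sup>2 = L1 t * L2 t" for t
    proof -
      obtain k x y where k: "L1 t = k * (fr x * x)" "L2 t = k * (fr x * y)" "L3 t = k * (x * fr y)" using kxy by blast
      have "(k * (x * fr y))\<^sup>2 = k\<^sup>2 * x\<^sup>2 * (fr y)\<^sup>2" by (simp add: power_mult_distrib)
      also have "\<dots> = k\<^sup>2 * x * (fr x)\<^sup>2 * y" by (simp only: frsq) (simp add: power2_eq_square)
      finally show ?thesis by (simp add: k power2_eq_square ac_simps)
    qed
    have "\<forall>c\<in>set (map fst [(\<alpha> * e2 + b3 * e3 + c3 * d3, 1), (b2 * e2 + b3 * \<delta> + c2 * d2, 2), (\<alpha> * e3, s),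
        (\<alpha> * \<delta> + b2 * e3 + b3 * e2 + c2 * d3 + c3 * d2, s + 1), (b2 * \<delta>, s + 2)]). c = 0"
    proof (rule monomials_independent)
      show "(\<Sum>(c, e)\<leftarrow>[(\<alpha> * e2 + b3 * e3 + c3 * d3, 1), (b2 * e2 + b3 * \<delta> + c2 * d2, 2), (\<alpha> * e3, s),
        (\<alpha> * \<delta> + b2 * e3 + b3 * e2 + c2 * d3 + c3 * d2, s + 1), (b2 * \<delta>, s + 2)]. c * t ^ e) = 0"
        for t
      proof -
        define T where "T = fr t"
        have TT: "T * T = t" using frsq[of t] by (simp add: T_def power2_eq_square)
        then have TTz: "T * (T * z) = t * z" for z by (simp flip: mult.assoc)
        have "L1 t * L4 t + L2 t * L3 t = 0" using R1 by (simp add: add_self)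
        then show ?thesis
          by (simp only: list.map sum_list.Cons sum_list.Nil prod.case pw fr_s[symmetric] T_def[symmetric] L)
             (simp add: algebra_simps power2_eq_square TT TTz)
      qed
    qed (use s4 sq in auto)
    then have 1: "e3 = 0" "b2 = 0" "\<alpha> * e2 = c3 * d3" "b3 * \<delta> = c2 * d2"
      using nz by (auto simp: add_eq_0)
    have "\<forall>c\<in>set (map fst [(\<alpha> * c2 + b3 * c3 + d3\<^sup>2, 1), (d2\<^sup>2, 2), (\<alpha> * c3, s), (b3 * c2, s + 1)]). c = 0"
    proof (rule monomials_independent)
      show "(\<Sum>(c, e)\<leftarrow>[(\<alpha> * c2 + b3 * c3 + d3\<^sup>2, 1), (d2\<^sup>2, 2), (\<alpha> * c3, s), (b3 * c2, s + 1)]. c * t ^ e) = 0" for t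
      proof -
        define T where "T = fr t"
        have TT: "T * T = t" using frsq[of t] by (simp add: T_def power2_eq_square)
        then have TTz: "T * (T * z) = t * z" for z by (simp flip: mult.assoc)
        have "(L3 t)\<^sup>2 + L1 t * L2 t = 0" using R3 by (simp add: add_self)
        then show ?thesis
          by (simp only: list.map sum_list.Cons sum_list.Nil prod.case pw fr_s[symmetric] T_def[symmetric] L 1 add_square)
             (simp add: algebra_simps power2_eq_square TT TTz)
      qed
    qed (use s4 sq in auto)
    then have "d2 = 0" "c3 = 0" using nz by auto
    then show ?thesis using 1 nz by auto
  next
    case 3
    have s4: "4 \<le> s" using power_increasing[of 2 m "2::nat"] 3(1) by (simp add: s_def)
    have sq: "4 * s \<le> CARD('a)"
      using power_increasing[of "m + 2" n "2::nat"] 3(2) unfolding card_UNIV s_def by (simp add: power_add mult.commute)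
    have "\<forall>c\<in>set (map fst [(\<alpha> * e2, 1::nat), (b2 * e2 + c2 * d2, 2), (\<alpha> * e3, s),
        (\<alpha> * \<delta> + b2 * e3 + b3 * e2 + c2 * d3 + c3 * d2, s + 1), (b2 * \<delta>, s + 2),
        (b3 * e3 + c3 * d3, 2 * s), (b3 * \<delta>, 2 * s + 1)]). c = 0"
    proof (rule monomials_independent)
      show "(\<Sum>(c, e)\<leftarrow>[(\<alpha> * e2, 1::nat), (b2 * e2 + c2 * d2, 2), (\<alpha> * e3, s),
        (\<alpha> * \<delta> + b2 * e3 + b3 * e2 + c2 * d3 + c3 * d2, s + 1), (b2 * \<delta>, s + 2),
        (b3 * e3 + c3 * d3, 2 * s), (b3 * \<delta>, 2 * s + 1)]. c * t ^ e) = 0"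
        for t
      proof -
        define T where "T = fr t"
        have "L1 t * L4 t + L2 t * L3 t = 0" using R1 by (simp add: add_self)
        then show ?thesis
          by (simp only: list.map sum_list.Cons sum_list.Nil prod.case pw fr_s[symmetric] T_def[symmetric] L)
             (simp add: algebra_simps power2_eq_square)
      qed
    qed (use s4 sq in auto)
    then have 1: "e2 = 0" "e3 = 0" "b2 = 0" "b3 = 0" "c2 * d2 = 0" "c3 * d3 = 0"
      using nz by auto
    \<comment> \<open>The quadric alone leaves two solutions, the scalar matrices and those
      exchanging X2 and X3; on the second kind \<open>R2\<close> would read fr (fr t) = t.\<close>
    have "c2 \<noteq> 0"
    proof
      assume c2: "c2 = 0"
      then have c3: "c3 = \<gamma>" "d3 = 0" "d2 = \<gamma>" using rows 1 nz by auto
      have "fr (fr t) = t" for t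
      proof -
        have "fr (L2 t) * L1 t = fr (L1 t) * L3 t" by (rule R2)
        then show ?thesis using rows nz by (simp add: L 1 c2 c3)
      qed
      then show False using frob_double_not_identity by blast
    qed
    then show ?thesis using 1 rows nz by auto
  qed
qed

lemma arc_rigidity:
  fixes N :: "'a^4^4"
  assumes N1: "N *v arc_vector 1 0 = \<alpha> *s arc_vector 1 0" and N2: "N *v arc_vector 0 1 = \<delta> *s arc_vector 0 1"
    and N3: "N *v arc_vector 1 1 = \<gamma> *s arc_vector 1 1" and nz: "\<alpha> \<noteq> 0" "\<gamma> \<noteq> 0" "\<delta> \<noteq> 0"
    and arc: "\<And>t. \<exists>k x y. N *v arc_vector 1 t = k *s arc_vector x y"
  shows "N *v v = \<alpha> *s v"
proof -
  note comp = vec_eq_iff forall_4 matrix_vector_mult_def sum_4 arc_vector_def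
  have c1: "N$1$1 = \<alpha>" "N$2$1 = 0" "N$3$1 = 0" "N$4$1 = 0" using N1 by (simp_all add: comp)
  have c4: "N$1$4 = 0" "N$2$4 = 0" "N$3$4 = 0" "N$4$4 = \<delta>" using N2 by (simp_all add: comp)
  have rows: "\<alpha> + N$1$2 + N$1$3 = \<gamma>" "N$2$2 + N$2$3 = \<gamma>" "N$3$2 + N$3$3 = \<gamma>" "N$4$2 + N$4$3 + \<delta> = \<gamma>"
    using N3 by (simp_all add: comp c1 c4)
  have 0: "N$1$2 = 0 \<and> N$1$3 = 0 \<and> N$2$3 = 0 \<and> N$3$2 = 0 \<and> N$4$2 = 0 \<and> N$4$3 = 0"
    by (rule arc_rigidity_entries[OF nz rows]) (use arc in \<open>simp add: comp c1 c4\<close>)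
  then show ?thesis using rows by (simp add: comp c1 c4)
qed

lemma arc_stabilizer:
  assumes inv: "invertible (M :: 'a^4^4)" and M: "projectivity M ` arc h = arc h"
  shows "\<exists>g\<in>SL. projectivity M = projectivity (tw g)"
proof -
  obtain M' where M': "M' ** M = mat 1" using inv unfolding invertible_def by blast
  have inj: "v = v'" if "M *v v = M *v v'" for v v'
    using arg_cong[OF that, of "(*v) M'"] by (simp add: matrix_vector_mul_assoc M')
  have img: "\<exists>k x' y'. k \<noteq> 0 \<and> (x', y') \<noteq> (0, 0) \<and> M *v arc_vector x y = k *s arc_vector x' y'"
    if "(x, y) \<noteq> (0, 0)" for x y
  proof -
    have "vec.span {arc_vector x y} \<in> arc h" unfolding arc_eq using that by blast
    then have "vec.span {M *v arc_vector x y} \<in> arc h"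
      unfolding projectivity_span[symmetric] using M by blast
    then obtain x' y' where xy: "vec.span {M *v arc_vector x y} = vec.span {arc_vector x' y'}" "(x', y') \<noteq> (0, 0)"
      unfolding arc_eq by blast
    have "M *v arc_vector x y \<in> vec.span {arc_vector x' y'}"
      using vec.span_base[of "M *v arc_vector x y" "{M *v arc_vector x y}"] xy(1) by simp
    then obtain k where k: "M *v arc_vector x y = k *s arc_vector x' y'"
      by (auto simp: vec.span_singleton)
    have "k \<noteq> 0"
    proof
      assume "k = 0"
      then have "M *v arc_vector x y = M *v 0" using k by simp
      then show False using inj arc_vector_eq_0 that by blast
    qed
    then show ?thesis using k xy(2) by blast
  qed
  obtain k1 x1 y1 where P1: "k1 \<noteq> 0" "(x1, y1) \<noteq> (0, 0)" "M *v arc_vector 1 0 = k1 *s arc_vector x1 y1"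
    using img[of 1 0] by auto
  obtain k2 x2 y2 where P2: "k2 \<noteq> 0" "(x2, y2) \<noteq> (0, 0)" "M *v arc_vector 0 1 = k2 *s arc_vector x2 y2"
    using img[of 0 1] by auto
  obtain k3 x3 y3 where P3: "k3 \<noteq> 0" "(x3, y3) \<noteq> (0, 0)" "M *v arc_vector 1 1 = k3 *s arc_vector x3 y3"
    using img[of 1 1] by auto
  \<comment> \<open>Proportional parameters would give proportional images, contradicting
    injectivity of M on distinct arc points.\<close>
  have indep: "x * y' + x' * y \<noteq> 0"
    if "k \<noteq> 0" "(x, y) \<noteq> (0, 0)" "M *v arc_vector u v = k *s arc_vector x y"
      and "k' \<noteq> 0" "(x', y') \<noteq> (0, 0)" "M *v arc_vector u' v' = k' *s arc_vector x' y'"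
      and ne: "\<And>c. arc_vector u' v' \<noteq> c *s arc_vector u v" for k x y u v k' x' y' u' v'
  proof
    assume 0: "x * y' + x' * y = 0"
    then have 0: "x * y' = x' * y" by (simp only: add_eq_0)
    have "\<exists>c. x' = c * x \<and> y' = c * y"
    proof (cases "x = 0")
      case True
      then have "x' = 0" "y \<noteq> 0" using 0 that(2) by auto
      then show ?thesis by (intro exI[of _ "y' / y"]) (simp add: True)
    next
      case False
      then show ?thesis using 0 by (intro exI[of _ "x' / x"]) (simp add: field_simps)
    qed
    then obtain c where c: "x' = c * x" "y' = c * y" by blast
    have "M *v arc_vector u' v' = (k' * (fr c * c)) *s arc_vector x y"
      by (simp add: that(6) c arc_vector_scale)
    also have "\<dots> = (k' * (fr c * c) / k) *s (k *s arc_vector x y)" using that(1) by simp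
    also have "\<dots> = M *v ((k' * (fr c * c) / k) *s arc_vector u v)"
      by (simp only: that(3)[symmetric] vector_scalar_commute)
    finally show False using inj ne by blast
  qed
  have "x1 * y2 + x2 * y1 \<noteq> 0"
    by (rule indep[OF P1 P2]) (simp add: arc_vector_def vec_eq_iff forall_4)
  moreover have "x1 * y3 + x3 * y1 \<noteq> 0"
    by (rule indep[OF P1 P3]) (simp add: arc_vector_def vec_eq_iff forall_4)
  moreover have "x2 * y3 + x3 * y2 \<noteq> 0"
    by (rule indep[OF P2 P3]) (simp add: arc_vector_def vec_eq_iff forall_4)
  \<comment> \<open>Cramer coefficients of the third image parameter in terms of the first two: the
    usual construction of the element of PGL(2, q) with three prescribed images.\<close>
  moreover define D l1 l2 where "D = x1 * y2 + x2 * y1" and "l1 = (x2 * y3 + x3 * y2) / D"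
    and "l2 = (x1 * y3 + x3 * y1) / D"
  ultimately have nz: "D \<noteq> 0" "l1 \<noteq> 0" "l2 \<noteq> 0" by auto
  have "D * x3 = (x2 * y3 + x3 * y2) * x1 + (x1 * y3 + x3 * y1) * x2"
    "D * y3 = (x2 * y3 + x3 * y2) * y1 + (x1 * y3 + x3 * y1) * y2"
    by (simp_all add: D_def algebra_simps char2)
  then have l: "x3 = l1 * x1 + l2 * x2" "y3 = l1 * y1 + l2 * y2"
    using nz(1) by (simp_all add: l1_def l2_def field_simps)
  \<comment> \<open>l1 l2 D is the determinant before scaling. It has a square root, so determinant
    1 can be reached: SL(2, q) covers PGL(2, q).\<close>
  obtain \<mu> where \<mu>: "l1 * l2 * D = \<mu>\<^sup>2" using square_surj by blast
  then have \<mu>0: "\<mu> \<noteq> 0" using nz by auto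
  define g where "g = (l1 * x1 / \<mu>, l2 * x2 / \<mu>, l1 * y1 / \<mu>, l2 * y2 / \<mu>)"
  have "(l1 * x1 / \<mu>) * (l2 * y2 / \<mu>) + (l2 * x2 / \<mu>) * (l1 * y1 / \<mu>) = l1 * l2 * D / \<mu>\<^sup>2"
    by (simp add: D_def power2_eq_square add_divide_distrib[symmetric] algebra_simps)
  then have g: "g \<in> SL" unfolding SL_def g_def using \<mu> \<mu>0 by simp
  define N where "N = tw (adj g) ** M"
  have tw_scale: "arc_vector (k * x / \<mu>) (k * y / \<mu>) = (fr (k / \<mu>) * (k / \<mu>)) *s arc_vector x y" for k x y
    using arc_vector_scale[of "k / \<mu>" x y] by simp
  have N: "\<exists>j. j \<noteq> 0 \<and> N *v v = j *s v" if "M *v v = k *s w" "k \<noteq> 0" "tw g *v v = c *s w" "c \<noteq> 0" for v w k c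
  proof -
    have "M *v v = (k / c) *s (tw g *v v)" using that by simp
    then have "N *v v = (k / c) *s (tw (adj g) *v (tw g *v v))"
      by (simp add: N_def matrix_vector_mul_assoc[symmetric] vector_scalar_commute)
    then have "N *v v = (k / c) *s v" by (simp add: matrix_vector_mul_assoc tw_inverse g)
    then show ?thesis using that by (intro exI[of _ "k / c"]) simp
  qed
  have "\<exists>j. j \<noteq> 0 \<and> N *v arc_vector 1 0 = j *s arc_vector 1 0"
    by (rule N[OF P1(3,1), of "fr (l1 / \<mu>) * (l1 / \<mu>)"])
       (use nz \<mu>0 in \<open>simp_all add: g_def tw_arc_vector tw_scale del: fr_simps\<close>)
  moreover have "\<exists>j. j \<noteq> 0 \<and> N *v arc_vector 0 1 = j *s arc_vector 0 1"
    by (rule N[OF P2(3,1), of "fr (l2 / \<mu>) * (l2 / \<mu>)"])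
       (use nz \<mu>0 in \<open>simp_all add: g_def tw_arc_vector tw_scale del: fr_simps\<close>)
  moreover have "\<exists>j. j \<noteq> 0 \<and> N *v arc_vector 1 1 = j *s arc_vector 1 1"
  proof (rule N[OF P3(3,1), of "fr (1 / \<mu>) * (1 / \<mu>)"])
    have "tw g *v arc_vector 1 1 = arc_vector (1 * x3 / \<mu>) (1 * y3 / \<mu>)"
      by (simp add: g_def tw_arc_vector l add_divide_distrib)
    then show "tw g *v arc_vector 1 1 = (fr (1 / \<mu>) * (1 / \<mu>)) *s arc_vector x3 y3"
      unfolding tw_scale .
  qed (use \<mu>0 in simp)
  ultimately obtain \<alpha> \<delta> \<gamma> where \<alpha>: "\<alpha> \<noteq> 0" "\<gamma> \<noteq> 0" "\<delta> \<noteq> 0" and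
    fixed: "N *v arc_vector 1 0 = \<alpha> *s arc_vector 1 0" "N *v arc_vector 0 1 = \<delta> *s arc_vector 0 1"
    "N *v arc_vector 1 1 = \<gamma> *s arc_vector 1 1" by blast
  have arcN: "\<exists>k x y. N *v arc_vector 1 t = k *s arc_vector x y" for t
  proof -
    obtain a b c d where adj: "adj g = (a, b, c, d)" by (cases "adj g") auto
    obtain k x y where "M *v arc_vector 1 t = k *s arc_vector x y" using img[of 1 t] by auto
    then have "N *v arc_vector 1 t = k *s arc_vector (a * x + b * y) (c * x + d * y)"
      by (simp add: N_def matrix_vector_mul_assoc[symmetric] vector_scalar_commute adj tw_arc_vector)
    then show ?thesis by blast
  qed
  have Nv: "N *v v = \<alpha> *s v" for v by (rule arc_rigidity[OF fixed \<alpha> arcN])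
  have Mv: "M *v v = \<alpha> *s (tw g *v v)" for v
  proof -
    have "M *v v = tw g *v (N *v v)"
      by (simp add: N_def matrix_vector_mul_assoc matrix_mul_assoc tw_inverse g)
    then show ?thesis by (simp add: Nv vector_scalar_commute)
  qed
  have "projectivity M U = projectivity (tw g) U" for U
  proof (cases "U \<in> PG3_subspaces")
    case True
    have "(\<lambda>v. M *v v) ` U = (\<lambda>v. tw g *v v) ` ((\<lambda>v. \<alpha> *s v) ` U)"
      by (simp add: image_image Mv vector_scalar_commute)
    also have "(\<lambda>v. \<alpha> *s v) ` U = U"
    proof -
      have sc: "c *s v \<in> U" if "v \<in> U" for c v
        using True that by (simp add: PG3_subspaces_def vec.subspace_scale)
      have "v = \<alpha> *s ((1 / \<alpha>) *s v)" for v using \<alpha>(1) by simp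
      then show ?thesis using sc by blast
    qed
    finally show ?thesis using True by (simp add: projectivity_def)
  qed (simp add: projectivity_def)
  then show ?thesis using g by blast
qed

lemma carrier_G_arc: "carrier (G_arc h) = (\<lambda>g. projectivity (tw g)) ` SL"
proof -
  have "projectivity (tw g) \<in> carrier (G_arc h)" if "g \<in> SL" for g
    using projectivity_tw_arc[OF that] invertible_tw[OF that] by (auto simp: G_arc_def PGL4_def)
  moreover have "f \<in> (\<lambda>g. projectivity (tw g)) ` SL" if "f \<in> carrier (G_arc h)" for f
  proof -
    from that obtain M where "f = projectivity M" "invertible M" "projectivity M ` arc h = arc h"
      by (auto simp: G_arc_def PGL4_def)
    then show ?thesis using arc_stabilizer by (metis imageI)
  qed
  ultimately show ?thesis by blast
qed

end

section \<open>Parametrisation of the lines\<close>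

lemma card_sections: "card (S :: ('a::finite \<times> 'b::finite) set) = (\<Sum>x\<in>UNIV. card {y. (x, y) \<in> S})"
  using card_pairs[of "\<lambda>x y. (x, y) \<in> S"] by simp

lemma card_swap: "card {(x, y). P x y} = card {(y, x). P x y}"
  by (rule bij_betw_same_card[of prod.swap], rule bij_betw_byWitness[of _ prod.swap]) auto

lemma sum_UNIV_If:
  fixes P :: "'a::finite \<Rightarrow> bool" and A B :: nat
  shows "(\<Sum>x\<in>UNIV. if P x then A else B) = card {x. P x} * A + (CARD('a) - card {x. P x}) * B"
  by (simp add: sum.If_cases card_Collect_not[symmetric] Collect_neg_eq)

text \<open>The orbits of size m partition the points lying in them. The factor m is kept instead of
  dividing; at m = 0 the equation says nothing, and that value is treated separately later.\<close>

lemma count_image_mset_orbits: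
  assumes fin: "finite E" and refl: "\<And>x. x \<in> E \<Longrightarrow> x \<in> orb x" and sub: "\<And>x. x \<in> E \<Longrightarrow> orb x \<subseteq> E"
    and trans: "\<And>x y. x \<in> E \<Longrightarrow> y \<in> orb x \<Longrightarrow> orb y = orb x"
  shows "m * count (image_mset card (mset_set (orb ` E))) m = card {x \<in> E. card (orb x) = m}"
proof -
  let ?C = "{B \<in> orb ` E. card B = m}"
  have finP: "finite (orb ` E)" using fin by simp
  have "count (image_mset card (mset_set (orb ` E))) m = card ?C"
    using finP by (simp add: count_image_mset' conj_commute eq_commute[of m])
  moreover have "{x \<in> E. card (orb x) = m} = \<Union>?C"
  proof (intro subset_antisym subsetI)
    fix y assume "y \<in> {x \<in> E. card (orb x) = m}"
    then show "y \<in> \<Union>?C" using refl[of y] by blast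
  next
    fix y assume "y \<in> \<Union>?C"
    then obtain x where x: "x \<in> E" "y \<in> orb x" "card (orb x) = m" by blast
    then show "y \<in> {x \<in> E. card (orb x) = m}" using trans[OF x(1,2)] sub[OF x(1)] by auto
  qed
  moreover have "m * card ?C = card (\<Union>?C)"
  proof (rule card_partition)
    show "finite ?C" using finP by simp
    show "finite (\<Union>?C)" by (rule finite_subset[OF _ fin]) (use sub in blast)
    show "\<And>c. c \<in> ?C \<Longrightarrow> card c = m" by blast
    show "\<And>c1 c2. \<lbrakk>c1 \<in> ?C; c2 \<in> ?C; c1 \<noteq> c2\<rbrakk> \<Longrightarrow> c1 \<inter> c2 = {}"
    proof -
      fix c1 c2 assume "c1 \<in> ?C" "c2 \<in> ?C" "c1 \<noteq> c2"
      then obtain x1 x2 where x: "x1 \<in> E" "c1 = orb x1" "x2 \<in> E" "c2 = orb x2" by blast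
      show "c1 \<inter> c2 = {}"
      proof (rule ccontr)
        assume "c1 \<inter> c2 \<noteq> {}"
        then obtain y where "y \<in> orb x1" "y \<in> orb x2" using x by blast
        then have "orb x1 = orb x2" using trans[OF x(1)] trans[OF x(3)] by metis
        with x \<open>c1 \<noteq> c2\<close> show False by simp
      qed
    qed
  qed
  ultimately show ?thesis by simp
qed

context twisted_field
begin

section \<open>Orbits and stabilizers of lines under SL(2, q)\<close>

definition move :: "'a \<times> 'a \<times> 'a \<times> 'a \<Rightarrow> ('a^4) set \<Rightarrow> ('a^4) set" where
  "move g L = (\<lambda>v. tw g *v v) ` L"

definition orb :: "('a^4) set \<Rightarrow> ('a^4) set set" where
  "orb L = (\<lambda>g. move g L) ` SL"

definition stab :: "('a^4) set \<Rightarrow> ('a \<times> 'a \<times> 'a \<times> 'a) set" where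
  "stab L = {g \<in> SL. move g L = L}"

lemma one_in_SL: "(1, 0, 0, 1) \<in> SL"
  by (simp add: SL_def)

lemma move_one: "move (1, 0, 0, 1) L = L"
  by (simp add: move_def tw_one)

lemma move_mul: "move (mul g g') L = move g (move g' L)"
  by (simp add: move_def image_image tw_mul[symmetric] matrix_vector_mul_assoc)

lemma orb_refl: "L \<in> orb L"
  unfolding orb_def by (rule image_eqI[OF _ one_in_SL]) (simp add: move_one)

lemma orb_eq:
  assumes "L' \<in> orb L"
  shows "orb L' = orb L"
proof -
  have sub: "orb (move g L) \<subseteq> orb L" if "g \<in> SL" for g L
    unfolding orb_def
  proof (rule image_subsetI)
    fix g' assume "g' \<in> SL"
    then show "move g' (move g L) \<in> (\<lambda>g. move g L) ` SL"
      unfolding move_mul[symmetric] using mul_closed[OF _ that] by (rule_tac imageI) 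
  qed
  obtain g where g: "g \<in> SL" "L' = move g L" using assms by (auto simp: orb_def)
  then have "L = move (adj g) L'" by (simp add: move_mul[symmetric] mul_adj move_one)
  then have "orb L \<subseteq> orb L'" using sub[OF adj_closed[OF g(1)], of L'] by simp
  then show ?thesis using sub[OF g(1), of L] g(2) by simp
qed

text \<open>Orbit-stabilizer: the fibres of \<open>g \<mapsto> move g L\<close> are the left cosets
  of \<open>stab L\<close>.\<close>

lemma card_orb: "card (stab L) * card (orb L) = CARD('a) ^ 3 - CARD('a)"
proof -
  have "card SL = card (stab L) * card ((\<lambda>g. move g L) ` SL)"
  proof (rule card_uniform_fibres)
    fix g assume g: "g \<in> SL"
    have "mul g (mul (adj g) g') = g'" "mul (adj g) (mul g g') = g'" for g'
      using g by (simp_all add: mul_assoc[symmetric] mul_adj mul_one)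
    moreover have "move g' L = move g L \<longleftrightarrow> move (mul (adj g) g') L = L" for g'
      using g by (metis move_mul mul_adj move_one)
    ultimately have "bij_betw (mul g) (stab L) {g' \<in> SL. move g' L = move g L}"
      using g by (intro bij_betw_byWitness[of _ "mul (adj g)"]) (auto simp: stab_def mul_closed adj_closed)
    then show "card {g' \<in> SL. move g' L = move g L} = card (stab L)"
      by (rule bij_betw_same_card[symmetric])
  qed simp
  then show ?thesis by (simp add: orb_def card_SL)
qed

lemma move_line_of: "g \<in> SL \<Longrightarrow> p \<in> plucker \<Longrightarrow> move g (line_of p) = line_of (act g p)"
  by (simp add: move_def act_plucker)

lemma stab_line_of:
  assumes "p \<in> plucker"
  shows "stab (line_of p) = {g \<in> SL. \<exists>k. k \<noteq> 0 \<and> act g p = scale6 k p}"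
proof -
  have "move g (line_of p) = line_of p \<longleftrightarrow> (\<exists>k. k \<noteq> 0 \<and> act g p = scale6 k p)" if "g \<in> SL" for g
    unfolding move_line_of[OF that assms] by (rule line_of_eq_iff[OF assms act_plucker(1)[OF that assms]])
  then show ?thesis unfolding stab_def by (intro Collect_cong conj_cong refl)
qed

lemma orb_subset_lines: "L \<in> PG3_lines \<Longrightarrow> orb L \<subseteq> PG3_lines"
  unfolding PG3_lines_eq orb_def
proof (rule image_subsetI)
  fix g assume g: "g \<in> SL" and "L \<in> line_of ` plucker"
  then obtain p where p: "p \<in> plucker" "L = line_of p" by blast
  show "move g L \<in> line_of ` plucker"
    unfolding p(2) move_line_of[OF g p(1)] by (rule imageI) (rule act_plucker(1)[OF g p(1)])
qed

lemma G_arc_line_orbits_eq: "G_arc_line_orbits h = orb ` PG3_lines"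
proof -
  have "orbit (G_arc h) (\<lambda>g L. g L) L = orb L" if "L \<in> PG3_lines" for L
  proof -
    have "projectivity M L = (\<lambda>v. M *v v) ` L" for M
      using that by (simp add: projectivity_def PG3_lines_def PG3_subspaces_def)
    then show ?thesis
      by (auto simp: orbit_def carrier_G_arc orb_def move_def)
  qed
  then show ?thesis by (auto simp: G_arc_line_orbits_def orbits_def)
qed

text \<open>
  The Pluecker relation of a line with \<open>p14 + p23 = 1\<close> becomes \<open>e\<^sup>2 + e = z v + u w + u v\<close> once the
  difference \<open>(u, v)\<close> of the two forms replaces the second one and \<open>p14\<close> is shifted by \<open>tr\<close>, which
  absorbs the Frobenius twist.  These lines include the ones external to the quadric, whose points on it
  lie in a quadratic extension; the lines with \<open>p14 + p23 = 0\<close> include the ones contained in it.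
\<close>
definition secant_coords :: "('a \<times> 'a) \<times> ('a \<times> 'a) \<times> 'a \<Rightarrow> 'a sextuple" where
  "secant_coords = (\<lambda>((u, v), (z, w), e). let E = e + tr ((z + u) * (w + v)) in
     (fr (z + u), z, E, E + 1, w, fr (w + v)))"

definition secant_params :: "(('a \<times> 'a) \<times> ('a \<times> 'a) \<times> 'a) set" where
  "secant_params = {((u, v), (z, w), e). e\<^sup>2 + e = z * v + u * w + u * v}"

text \<open>The sum of the coordinates of two generators of the quadric, one from each ruling: those
  with first tensor factor \<open>fr y\<close> and with second tensor factor x. For nonzero x and y
  it is a line through their common point, tangent to the quadric there.\<close>

definition tangent_coords :: "('a \<times> 'a) \<times> ('a \<times> 'a) \<Rightarrow> 'a sextuple" where
  "tangent_coords = (\<lambda>((x1, x2), (y1, y2)). let G = fr y1 * fr y2 + x1 * x2 in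
     (fr y1 ^ 2, x1\<^sup>2, G, G, x2\<^sup>2, fr y2 ^ 2))"

definition tangent_params :: "(('a \<times> 'a) \<times> ('a \<times> 'a)) set" where
  "tangent_params = UNIV - {((0, 0), (0, 0))}"

lemma secant_coords_relation:
  "((u, v), (z, w), e) \<in> secant_params \<longleftrightarrow> secant_coords ((u, v), (z, w), e) \<in> plucker"
proof -
  define N where "N = (z + u) * (w + v)"
  define E where "E = e + tr N"
  have "E\<^sup>2 + E = e\<^sup>2 + e + (tr N ^ 2 + tr N)"
    by (simp add: E_def add_square ac_simps)
  then have "E\<^sup>2 + E = e\<^sup>2 + e + (fr N + N)" by (simp only: tr_square)
  then have "fr (z + u) * fr (w + v) + z * w + E * (E + 1) = e\<^sup>2 + e + (z * v + u * w + u * v)"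
    by (simp add: N_def algebra_simps power2_eq_square char2)
  then have "fr (z + u) * fr (w + v) + z * w + E * (E + 1) = 0 \<longleftrightarrow> e\<^sup>2 + e = z * v + u * w + u * v"
    by (simp only: add_eq_0)
  moreover have "(fr (z + u), z, E, E + 1, w, fr (w + v)) \<noteq> (0, 0, 0, 0, 0, 0)" by auto
  ultimately show ?thesis
    unfolding secant_params_def secant_coords_def plucker_def Let_def prod.case mem_Collect_eq
      N_def[symmetric] E_def[symmetric] by blast
qed

lemma secant_coords_inj: "secant_coords t = secant_coords t' \<Longrightarrow> t = t'"
  by (auto simp: secant_coords_def Let_def split: prod.splits)

lemma tangent_coords_in_plucker: "s \<in> tangent_params \<Longrightarrow> tangent_coords s \<in> plucker"
  by (auto simp: tangent_params_def tangent_coords_def plucker_def Let_def algebra_simps power2_eq_square char2 split: prod.splits)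

lemma tangent_coords_scale:
  "tangent_coords ((fr m * x1, fr m * x2), (m * y1, m * y2)) = scale6 (fr m ^ 2) (tangent_coords ((x1, x2), (y1, y2)))"
  by (simp add: tangent_coords_def scale6_def Let_def algebra_simps power2_eq_square)

lemma tangent_coords_eq_scale_iff:
  "(\<exists>k. k \<noteq> 0 \<and> tangent_coords ((x1', x2'), (y1', y2')) = scale6 k (tangent_coords ((x1, x2), (y1, y2))))
   \<longleftrightarrow> (\<exists>m. m \<noteq> 0 \<and> x1' = fr m * x1 \<and> x2' = fr m * x2 \<and> y1' = m * y1 \<and> y2' = m * y2)"
    (is "?L \<longleftrightarrow> ?R")
proof
  assume ?L
  then obtain k where k: "k \<noteq> 0" "tangent_coords ((x1', x2'), (y1', y2')) = scale6 k (tangent_coords ((x1, x2), (y1, y2)))"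
    by blast
  obtain r where r: "k = r\<^sup>2" using square_surj by blast
  obtain m where m: "r = fr m" using fr_surj by blast
  have "x1'\<^sup>2 = (fr m * x1)\<^sup>2" "x2'\<^sup>2 = (fr m * x2)\<^sup>2" "(fr y1')\<^sup>2 = (fr (m * y1))\<^sup>2" "(fr y2')\<^sup>2 = (fr (m * y2))\<^sup>2"
    using k(2) by (simp_all add: tangent_coords_def scale6_def Let_def r m power_mult_distrib)
  then have "x1' = fr m * x1" "x2' = fr m * x2" "y1' = m * y1" "y2' = m * y2"
    by (simp_all only: square_eq_iff fr_eq_iff)
  moreover have "m \<noteq> 0" using k(1) r m by auto
  ultimately show ?R by blast
next
  assume ?R
  then show ?L using tangent_coords_scale by (metis fr_eq_0 power_eq_0_iff)
qed

lemma act_tangent_coords: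
  assumes "(a, b, c, d) \<in> SL"
  shows "act (a, b, c, d) (tangent_coords ((x1, x2), (y1, y2))) =
    tangent_coords ((a * x1 + b * x2, c * x1 + d * x2), (a * y1 + b * y2, c * y1 + d * y2))"
proof -
  have det: "a * d + b * c = 1" using assms by (simp add: SL_def)
  have DET: "fr a * fr d + fr b * fr c = 1" using arg_cong[OF det, of fr] by simp
  have "fr (a * y1 + b * y2) * fr (c * y1 + d * y2) + (a * x1 + b * x2) * (c * x1 + d * x2)
    = (fr a * fr d + fr b * fr c) * (fr y1 * fr y2) + (a * d + b * c) * (x1 * x2) + (fr a * fr c * (fr y1)\<^sup>2 + a * c * x1\<^sup>2
       + fr b * fr d * (fr y2)\<^sup>2 + b * d * x2\<^sup>2)"
    by (simp add: algebra_simps power2_eq_square)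
  also have "\<dots> = fr y1 * fr y2 + x1 * x2 + (fr a * fr c * (fr y1)\<^sup>2 + a * c * x1\<^sup>2
       + fr b * fr d * (fr y2)\<^sup>2 + b * d * x2\<^sup>2)"
    by (simp add: det DET)
  finally have G: "fr (a * y1 + b * y2) * fr (c * y1 + d * y2) + (a * x1 + b * x2) * (c * x1 + d * x2)
    = fr y1 * fr y2 + x1 * x2 + (fr a * fr c * (fr y1)\<^sup>2 + a * c * x1\<^sup>2
       + fr b * fr d * (fr y2)\<^sup>2 + b * d * x2\<^sup>2)" .
  show ?thesis
    unfolding act_def tangent_coords_def Let_def prod.case G
    by (simp add: add_self add_square power_mult_distrib)
qed

lemma PG3_lines_eq_params:
  "PG3_lines = (\<lambda>t. line_of (secant_coords t)) ` secant_params \<union> (\<lambda>s. line_of (tangent_coords s)) ` tangent_params"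
    (is "_ = ?S \<union> ?T")
proof (intro subset_antisym subsetI)
  fix L assume "L \<in> ?S \<union> ?T"
  then show "L \<in> PG3_lines"
    unfolding PG3_lines_eq using secant_coords_relation tangent_coords_in_plucker by fast
next
  fix L :: "('a^4) set" assume "L \<in> PG3_lines"
  then obtain p where p: "p \<in> plucker" "L = line_of p" unfolding PG3_lines_eq by blast
  obtain p12 p13 p14 p23 p24 p34 where pp: "p = (p12, p13, p14, p23, p24, p34)" by (cases p) auto
  have nz: "p \<noteq> (0, 0, 0, 0, 0, 0)" and rel: "p12 * p34 + p13 * p24 + p14 * p23 = 0"
    using p by (auto simp: plucker_def pp)
  show "L \<in> ?S \<union> ?T"
  proof (cases "p14 + p23 = 0")
    case True
    then have eq: "p23 = p14" by (simp add: add_eq_0)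
    obtain x1 x2 r1 r2 where x: "p13 = x1\<^sup>2" "p24 = x2\<^sup>2" "p12 = r1\<^sup>2" "p34 = r2\<^sup>2" using square_surj by metis
    obtain y1 y2 where y: "r1 = fr y1" "r2 = fr y2" using fr_surj by metis
    \<comment> \<open>With p14 = p23 the Pluecker relation is a sum of squares, so its square root
      determines p14 and leaves the four roots free.\<close>
    have "p14\<^sup>2 = (r1 * r2 + x1 * x2)\<^sup>2"
      using rel by (simp add: eq x add_square power_mult_distrib power2_eq_square[symmetric] add_eq_0)
    then have "p14 = r1 * r2 + x1 * x2" by (simp only: square_eq_iff)
    then have "p = tangent_coords ((x1, x2), (y1, y2))"
      by (simp add: pp tangent_coords_def Let_def eq x y)
    moreover from this nz have "((x1, x2), (y1, y2)) \<in> tangent_params"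
      by (auto simp: tangent_params_def tangent_coords_def)
    ultimately show ?thesis using p by blast
  next
    case False
    define k where "k = 1 / (p14 + p23)"
    have k: "k \<noteq> 0" using False by (simp add: k_def)
    obtain x y where xy: "k * p12 = fr x" "k * p34 = fr y" using fr_surj by metis
    \<comment> \<open>Inverts \<open>secant_coords\<close> after scaling to p14 + p23 = 1: (u, v) is
      the difference of the untwisted forms, and adding \<open>tr\<close> again undoes the
      shift.\<close>
    define t where "t = ((k * p13 + x, k * p24 + y), (k * p13, k * p24), k * p14 + tr (x * y))"
    have "k * p14 + k * p23 = k * (p14 + p23)" by (simp add: distrib_left)
    also have "\<dots> = 1" using False by (simp add: k_def)
    finally have "k * p23 = k * p14 + 1" by (simp add: add_eq_iff two_eq_0)
    then have t: "secant_coords t = scale6 k p"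
      by (simp add: t_def pp secant_coords_def scale6_def Let_def add_self_left xy two_eq_0 del: fr_simps)
    have "scale6 k p \<noteq> (0, 0, 0, 0, 0, 0)" using nz k by (auto simp: pp scale6_def)
    moreover have "(k * p12) * (k * p34) + (k * p13) * (k * p24) + (k * p14) * (k * p23) = 
        k\<^sup>2 * (p12 * p34 + p13 * p24 + p14 * p23)" by (simp add: algebra_simps power2_eq_square)
    ultimately have kp: "scale6 k p \<in> plucker" using rel k by (auto simp: plucker_def pp scale6_def)
    then have "t \<in> secant_params" using t secant_coords_relation unfolding t_def by metis
    moreover have "L = line_of (secant_coords t)"
      using line_of_eq_iff[OF p(1) kp] k unfolding t p(2) by metis
    ultimately show ?thesis by blast
  qed
qed

lemma secant_tangent_disjoint:
  "(\<lambda>t. line_of (secant_coords t)) ` secant_params \<inter> (\<lambda>s. line_of (tangent_coords s)) ` tangent_params = {}"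
proof -
  have "line_of (secant_coords t) \<noteq> line_of (tangent_coords s)"
    if t: "t \<in> secant_params" and s: "s \<in> tangent_params" for t s
  proof
    assume "line_of (secant_coords t) = line_of (tangent_coords s)"
    moreover have "secant_coords t \<in> plucker" using secant_coords_relation t by (cases t) auto
    ultimately obtain k where "k \<noteq> 0" "secant_coords t = scale6 k (tangent_coords s)"
      using line_of_eq_iff tangent_coords_in_plucker[OF s] by blast
    then show False
      by (auto simp: secant_coords_def tangent_coords_def scale6_def Let_def split: prod.splits)
  qed
  then show ?thesis by blast
qed

lemma inj_on_secant_line: "inj_on (\<lambda>t. line_of (secant_coords t)) secant_params"
proof (rule inj_onI)
  fix t t' assume t: "t \<in> secant_params" "t' \<in> secant_params" "line_of (secant_coords t) = line_of (secant_coords t')"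
  have "secant_coords t \<in> plucker" "secant_coords t' \<in> plucker"
    using t secant_coords_relation by (metis prod.exhaust)+
  then obtain k where k: "secant_coords t = scale6 k (secant_coords t')"
    using t(3) line_of_eq_iff by blast
  \<comment> \<open>p14 + p23 equals 1 on both sides.\<close>
  then have "k = 1"
    by (auto simp: secant_coords_def scale6_def Let_def distrib_left split: prod.splits)
  then have "secant_coords t = secant_coords t'" using k by (cases "secant_coords t'") (auto simp: scale6_def)
  then show "t = t'" by (rule secant_coords_inj)
qed

lemma stab_secant_line:
  assumes "((u, v), (z, w), e) \<in> secant_params"
  shows "stab (line_of (secant_coords ((u, v), (z, w), e)))
    = (rotations z w \<inter> rotations (z + u) (w + v)) \<union> (reflections z w \<inter> reflections (z + u) (w + v))"
proof -
  define x y E where "x = z + u" and "y = w + v" and "E = e + tr ((z + u) * (w + v))"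
  define p where "p = secant_coords ((u, v), (z, w), e)"
  have p: "p = (fr x, z, E, E + 1, w, fr y)"
    by (simp add: p_def secant_coords_def x_def y_def E_def Let_def)
  have pp: "p \<in> plucker" unfolding p_def using assms secant_coords_relation by blast
  have iff: "(\<exists>k. k \<noteq> 0 \<and> act (a, b, c, d) p = scale6 k p) \<longleftrightarrow>
     (a, b, c, d) \<in> (rotations z w \<inter> rotations x y) \<union> (reflections z w \<inter> reflections x y)"
    if g: "(a, b, c, d) \<in> SL" for a b c d
  proof -
    have det: "a * d + b * c = 1" using g by (simp add: SL_def)
    define \<delta> \<delta>' where "\<delta> = b * c + a * c * z + b * d * w" and "\<delta>' = b * c + a * c * x + b * d * y"
    have act: "act (a, b, c, d) p = (fr (a\<^sup>2 * x + a * b + b\<^sup>2 * y), a\<^sup>2 * z + a * b + b\<^sup>2 * w,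
        E + (\<delta> + fr \<delta>'), E + 1 + (\<delta> + fr \<delta>'), c\<^sup>2 * z + c * d + d\<^sup>2 * w, fr (c\<^sup>2 * x + c * d + d\<^sup>2 * y))"
    proof -
      have "E + (E + 1) = 1" by (rule add_self_left)
      then show ?thesis by (simp add: p act_def Let_def \<delta>_def \<delta>'_def ac_simps)
    qed
    have "(\<exists>k. k \<noteq> 0 \<and> act (a, b, c, d) p = scale6 k p) \<longleftrightarrow> act (a, b, c, d) p = p"
    proof
      assume "\<exists>k. k \<noteq> 0 \<and> act (a, b, c, d) p = scale6 k p"
      then obtain k where k: "act (a, b, c, d) p = scale6 k p" by blast
      then have "E + (\<delta> + fr \<delta>') = k * E" "E + 1 + (\<delta> + fr \<delta>') = k * (E + 1)"
        unfolding act by (auto simp: p scale6_def)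
      then have "(E + (\<delta> + fr \<delta>')) + (E + 1 + (\<delta> + fr \<delta>')) = k * E + k * (E + 1)" by simp
      then have "k = 1" by (simp add: algebra_simps char2)
      then show "act (a, b, c, d) p = p" using k by (simp add: p scale6_def)
    next
      assume "act (a, b, c, d) p = p"
      then show "\<exists>k. k \<noteq> 0 \<and> act (a, b, c, d) p = scale6 k p"
        by (intro exI[of _ 1]) (simp add: p scale6_def)
    qed
    also have "\<dots> \<longleftrightarrow> (a\<^sup>2 * z + a * b + b\<^sup>2 * w = z \<and> c\<^sup>2 * z + c * d + d\<^sup>2 * w = w) \<and>
        (a\<^sup>2 * x + a * b + b\<^sup>2 * y = x \<and> c\<^sup>2 * x + c * d + d\<^sup>2 * y = y) \<and> \<delta> = fr \<delta>'"
      unfolding act unfolding p by (auto simp add: add_eq_0 simp del: fr_simps)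
    \<comment> \<open>Both Dickson invariants lie in {0, 1}, where \<open>fr\<close> is the
      identity, so \<open>\<delta> = fr \<delta>'\<close> means that they agree: two rotations or
      two reflections.\<close>
    also have "\<dots> \<longleftrightarrow> (a, b, c, d) \<in> (rotations z w \<inter> rotations x y) \<union> (reflections z w \<inter> reflections x y)"
      unfolding Un_iff Int_iff form_stabilizer(1,2)[OF det, symmetric] \<delta>_def[symmetric] \<delta>'_def[symmetric]
      using form_stabilizer(3)[OF det, of z w] form_stabilizer(3)[OF det, of x y]
      unfolding \<delta>_def[symmetric] \<delta>'_def[symmetric] by (auto simp: add_eq_0)
    finally show ?thesis .
  qed
  show ?thesis
    unfolding stab_line_of[OF pp] x_def[symmetric] y_def[symmetric] p_def[symmetric]
  proof (rule Set.set_eqI)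
    fix g :: "'a \<times> 'a \<times> 'a \<times> 'a"
    obtain a b c d where g: "g = (a, b, c, d)" by (cases g) auto
    have "g \<in> SL" if "g \<in> (rotations z w \<inter> rotations x y) \<union> (reflections z w \<inter> reflections x y)"
      using that by (auto simp: g rotations_def reflections_def)
    then show "g \<in> {g \<in> SL. \<exists>k. k \<noteq> 0 \<and> act g p = scale6 k p} \<longleftrightarrow>
        g \<in> (rotations z w \<inter> rotations x y) \<union> (reflections z w \<inter> reflections x y)"
      using iff[of a b c d] unfolding g mem_Collect_eq by metis
  qed
qed

end

section \<open>Orbit sizes\<close>

context twisted_field
begin

text \<open>The difference u X^2 + v Y^2 of the forms is the square of a linear form with zero (sqrt
  v, sqrt u). The first form takes the value z v + sqrt (u v) + w u there, so (u w + v z)^2 = u v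
  says that the forms share a root.\<close>

lemma card_secant_stab:
  assumes t: "((u, v), (z, w), e) \<in> secant_params"
  defines "S \<equiv> card (stab (line_of (secant_coords ((u, v), (z, w), e))))"
  shows "(u, v) = (0, 0) \<Longrightarrow> \<exists>t. t\<^sup>2 + t = z * w \<Longrightarrow> S = 2 * (CARD('a) - 1)"
    and "(u, v) = (0, 0) \<Longrightarrow> \<nexists>t. t\<^sup>2 + t = z * w \<Longrightarrow> S = 2 * (CARD('a) + 1)"
    and "(u, v) \<noteq> (0, 0) \<Longrightarrow> (u * w + v * z)\<^sup>2 = u * v \<Longrightarrow> S = 1"
    and "(u, v) \<noteq> (0, 0) \<Longrightarrow> (u * w + v * z)\<^sup>2 \<noteq> u * v \<Longrightarrow> S = 2"
proof -
  have S: "S = card (rotations z w \<inter> rotations (z + u) (w + v)) + card (reflections z w \<inter> reflections (z + u) (w + v))"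
    unfolding S_def stab_secant_line[OF t]
    by (intro card_Un_disjoint finite) (use rotations_Int_reflections[of z w z w] in blast)
  {
    assume "(u, v) = (0, 0)"
    then have S: "S = 2 * (1 + (CARD('a) - card {m. m\<^sup>2 + m = z * w}))"
      unfolding S by (simp add: card_rotations card_reflections)
    show "\<exists>t. t\<^sup>2 + t = z * w \<Longrightarrow> S = 2 * (CARD('a) - 1)"
      unfolding S card_artin_schreier using q_ge_8 by simp
    show "\<nexists>t. t\<^sup>2 + t = z * w \<Longrightarrow> S = 2 * (CARD('a) + 1)"
      unfolding S card_artin_schreier by simp
  next
    assume uv: "(u, v) \<noteq> (0, 0)"
    have "rotations z w \<inter> rotations (z + u) (w + v) = {(1, 0, 0, 1)}"
    proof (intro subset_antisym subsetI)
      fix g assume g: "g \<in> rotations z w \<inter> rotations (z + u) (w + v)"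
      obtain a b c d where abcd: "g = (a, b, c, d)" by (cases g) auto
      have det: "a * d + b * c = 1" and b: "b = z * (a + d)" "b = (z + u) * (a + d)"
        and c: "c = w * (a + d)" "c = (w + v) * (a + d)"
        using g by (auto simp: abcd rotations_def SL_def)
      have "u * (a + d) = z * (a + d) + (z + u) * (a + d)" "v * (a + d) = w * (a + d) + (w + v) * (a + d)"
        by (simp_all add: algebra_simps char2)
      then have "u * (a + d) = 0" "v * (a + d) = 0"
        unfolding b(1)[symmetric] c(1)[symmetric] unfolding b(2)[symmetric] c(2)[symmetric] by (simp_all add: add_self)
      then have "a + d = 0" using uv by auto
      moreover from this have "b = 0" "c = 0" using b(1) c(1) by simp_all
      ultimately show "g \<in> {(1, 0, 0, 1)}"
        using det by (simp add: abcd add_eq_0 square_eq_1 flip: power2_eq_square)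
    qed (auto simp: rotations_def SL_def char2)
    then have S: "S = 1 + card (reflections z w \<inter> reflections (z + u) (w + v))" using S by simp
    \<comment> \<open>A common reflection has (b, c) proportional to (u, v); with factor k its
      determinant is k^2 D. Hence there is none for D = 0 and exactly one otherwise.\<close>
    define D where "D = (u * w + v * z)\<^sup>2 + u * v"
    have ref: "(a, b, c, d) \<in> reflections z w \<inter> reflections (z + u) (w + v) \<longleftrightarrow>
        (\<exists>k. k\<^sup>2 * D = 1 \<and> (a, b, c, d) = (k * (u * w + v * z), k * u, k * v, k * (u * w + v * z)))" for a b c d
    proof
      assume "(a, b, c, d) \<in> reflections z w \<inter> reflections (z + u) (w + v)"
      then have det: "a * d + b * c = 1" and d: "d = a" and a: "a = b * w + c * z" "a = b * (w + v) + c * (z + u)"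
        by (auto simp: reflections_def SL_def)
      have "a + a = b * v + c * u"
        by (subst (1) a(1), subst a(2)) (simp add: algebra_simps char2)
      then have bv: "b * v = c * u" by (simp add: add_self) (simp add: add_eq_0 eq_commute[of 0])
      obtain k where k: "b = k * u" "c = k * v"
      proof (cases "u = 0")
        case True
        then have "v \<noteq> 0" "b = 0" using uv bv by auto
        then show ?thesis by (intro that[of "c / v"]) (simp_all add: True)
      next
        case False
        then show ?thesis using bv by (intro that[of "b / u"]) (simp_all add: field_simps)
      qed
      have a': "a = k * (u * w + v * z)" unfolding a(1) k by (simp add: algebra_simps)
      have "k\<^sup>2 * D = a * d + b * c" unfolding d a' k D_def by (simp add: algebra_simps power2_eq_square)
      then show "\<exists>k. k\<^sup>2 * D = 1 \<and> (a, b, c, d) = (k * (u * w + v * z), k * u, k * v, k * (u * w + v * z))"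
        using det d a' k by auto
    next
      assume "\<exists>k. k\<^sup>2 * D = 1 \<and> (a, b, c, d) = (k * (u * w + v * z), k * u, k * v, k * (u * w + v * z))"
      then obtain k where k: "k\<^sup>2 * D = 1" and abcd: "a = k * (u * w + v * z)" "b = k * u" "c = k * v" "d = a" by blast
      have "a * d + b * c = k\<^sup>2 * D" unfolding abcd(4) abcd(1-3) D_def by (simp add: algebra_simps power2_eq_square)
      moreover have "a = b * w + c * z" "a = b * (w + v) + c * (z + u)"
        unfolding abcd(1-3) by (simp_all add: algebra_simps char2)
      ultimately show "(a, b, c, d) \<in> reflections z w \<inter> reflections (z + u) (w + v)"
        using k abcd(4) by (auto simp: reflections_def SL_def)
    qed
    show "S = 1" if "(u * w + v * z)\<^sup>2 = u * v"
    proof -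
      have "D = 0" using that by (simp add: D_def add_self)
      then have "(a, b, c, d) \<notin> reflections z w \<inter> reflections (z + u) (w + v)" for a b c d
        unfolding ref by simp
      then have "reflections z w \<inter> reflections (z + u) (w + v) = {}" by (metis equals0I prod.exhaust)
      then show ?thesis using S by simp
    qed
    show "S = 2" if "(u * w + v * z)\<^sup>2 \<noteq> u * v"
    proof -
      have D: "D \<noteq> 0" using that by (simp add: D_def add_eq_0)
      obtain k where k: "1 / D = k\<^sup>2" using square_surj by blast
      have k_iff: "j\<^sup>2 * D = 1 \<longleftrightarrow> j = k" for j
      proof -
        have "j\<^sup>2 * D = 1 \<longleftrightarrow> j\<^sup>2 = k\<^sup>2" using D by (auto simp: k[symmetric] field_simps)
        then show ?thesis by (simp only: square_eq_iff)
      qed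
      let ?g = "(k * (u * w + v * z), k * u, k * v, k * (u * w + v * z))"
      have "g \<in> reflections z w \<inter> reflections (z + u) (w + v) \<longleftrightarrow> g = ?g" for g
        by (cases g) (simp only: ref k_iff simp_thms ex_simps)
      then have "reflections z w \<inter> reflections (z + u) (w + v) = {?g}" by blast
      then show ?thesis using S by simp
    qed
  }
qed

lemma card_roots_sum:
  fixes f :: "'b::finite \<Rightarrow> 'a"
  shows "card {(x, e). e\<^sup>2 + e = f x} = 2 * card {x. \<exists>t. t\<^sup>2 + t = f x}"
proof -
  have "card {(x, e). e\<^sup>2 + e = f x} = (\<Sum>x\<in>UNIV. if \<exists>t. t\<^sup>2 + t = f x then 2 else 0)"
    by (simp add: card_pairs card_artin_schreier)
  then show ?thesis by (simp add: sum_UNIV_If)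
qed

lemma artin_schreier_eq_0: "e\<^sup>2 + e = (0::'a) \<longleftrightarrow> e = 0 \<or> e = 1"
  using artin_schreier_eq_iff[of e 0] by simp

text \<open>Triples (z, w, e) with e^2 + e = z w are counted twice: each solvable pair has two e,
  while e fixes the product z w, which is 0 for two values of e only.\<close>

lemma card_split_pairs: "2 * card {(z, w). \<exists>t. t\<^sup>2 + t = z * (w::'a)} = CARD('a) * (CARD('a) + 1)"
proof -
  have "2 * card {(z, w). \<exists>t. t\<^sup>2 + t = z * (w::'a)} = card {(x, e). e\<^sup>2 + e = (\<lambda>(z, w). z * (w::'a)) x}"
    by (subst card_roots_sum) (simp add: case_prod_beta split_def)
  also have "\<dots> = card {(e, x). e\<^sup>2 + e = (\<lambda>(z, w). z * (w::'a)) x}"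
    by (rule card_swap)
  also have "\<dots> = (\<Sum>e\<in>UNIV. card {(z, w). z * w = e\<^sup>2 + (e::'a)})"
    by (subst card_pairs, rule sum.cong[OF refl], rule arg_cong[of _ _ card]) auto
  also have "\<dots> = (\<Sum>e\<in>UNIV. if e\<^sup>2 + (e::'a) = 0 then 2 * CARD('a) - 1 else CARD('a) - 1)"
    by (simp only: card_product_pairs)
  also have "\<dots> = 2 * (2 * CARD('a) - 1) + (CARD('a) - 2) * (CARD('a) - 1)"
  proof -
    have "\<exists>t::'a. t\<^sup>2 + t = 0" by (intro exI[of _ 0]) simp
    then show ?thesis by (subst sum_UNIV_If) (simp add: card_artin_schreier)
  qed
  also have "\<dots> = CARD('a) * (CARD('a) + 1)"
  proof -
    obtain k where k: "CARD('a) = k + 2" using q_ge_8 by (metis add.commute le_add_diff_inverse2 le_trans numeral_le_iff semiring_norm(71) semiring_norm(68))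
    show ?thesis unfolding k by (simp add: algebra_simps)
  qed
  finally show ?thesis .
qed

lemma card_origin_section:
  fixes S :: "(('b::{finite,zero} \<times> 'b) \<times> 'c::finite) set"
  assumes "\<And>u v y. ((u, v), y) \<in> S \<Longrightarrow> (u, v) = (0, 0)"
  shows "card S = card {y. ((0, 0), y) \<in> S}"
proof -
  have "S = Pair (0, 0) ` {y. ((0, 0), y) \<in> S}" using assms by auto
  then have "card S = card (Pair (0::'b, 0::'b) ` {y. ((0, 0), y) \<in> S})" by simp
  then show ?thesis by (simp add: card_image inj_on_def)
qed

lemma card_nonorigin_sections:
  fixes S :: "(('a \<times> 'a) \<times> 'c::finite) set"
  assumes "\<And>y. ((0, 0), y) \<notin> S" and "\<And>u v. (u, v) \<noteq> (0, 0) \<Longrightarrow> card {y. ((u, v), y) \<in> S} = k"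
  shows "card S = (CARD('a)\<^sup>2 - 1) * k"
proof -
  have "card S = (\<Sum>x\<in>UNIV. if x = (0::'a, 0::'a) then 0 else k)"
    unfolding card_sections[of S] by (rule sum.cong) (use assms in auto)
  then show ?thesis by (simp add: sum_UNIV_If_eq power2_eq_square)
qed

definition secant_size :: "('a \<times> 'a) \<times> ('a \<times> 'a) \<times> 'a \<Rightarrow> nat" where
  "secant_size = (\<lambda>((u, v), (z, w), e).
     if (u, v) = (0, 0) then
       if \<exists>t. t\<^sup>2 + t = z * w then CARD('a) * (CARD('a) + 1) div 2 else CARD('a) * (CARD('a) - 1) div 2
     else if (u * w + v * z)\<^sup>2 = u * v then CARD('a) ^ 3 - CARD('a) else (CARD('a) ^ 3 - CARD('a)) div 2)"

lemma cube_minus_factor: "CARD('a) ^ 3 - CARD('a) = (CARD('a) - 1) * (CARD('a) * (CARD('a) + 1))"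
  "CARD('a) ^ 3 - CARD('a) = (CARD('a) + 1) * (CARD('a) * (CARD('a) - 1))"
  "CARD('a) ^ 3 - CARD('a) = (CARD('a)\<^sup>2 - 1) * CARD('a)"
  by (simp_all add: algebra_simps power3_eq_cube power2_eq_square)

lemma card_orb_secant:
  assumes "t \<in> secant_params"
  shows "card (orb (line_of (secant_coords t))) = secant_size t"
proof -
  obtain u v z w e where t: "t = ((u, v), (z, w), e)" by (metis prod.exhaust)
  let ?L = "line_of (secant_coords t)"
  note c = card_orb[of ?L]
  note s = card_secant_stab[OF assms[unfolded t], folded t]
  consider "(u, v) = (0, 0)" "\<exists>t. t\<^sup>2 + t = z * w" | "(u, v) = (0, 0)" "\<nexists>t. t\<^sup>2 + t = z * w"
    | "(u, v) \<noteq> (0, 0)" "(u * w + v * z)\<^sup>2 = u * v" | "(u, v) \<noteq> (0, 0)" "(u * w + v * z)\<^sup>2 \<noteq> u * v" by blast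
  then show ?thesis
  proof cases
    case 1
    have "(CARD('a) - 1) * (2 * card (orb ?L)) = (CARD('a) - 1) * (CARD('a) * (CARD('a) + 1))"
      using c unfolding s(1)[OF 1] cube_minus_factor(1) by (simp only: ac_simps)
    then have "2 * card (orb ?L) = CARD('a) * (CARD('a) + 1)" using q_ge_8 by simp
    then have "card (orb ?L) = CARD('a) * (CARD('a) + 1) div 2" by linarith
    then show ?thesis using 1 by (simp add: secant_size_def t)
  next
    case 2
    have "(CARD('a) + 1) * (2 * card (orb ?L)) = (CARD('a) + 1) * (CARD('a) * (CARD('a) - 1))"
      using c unfolding s(2)[OF 2] cube_minus_factor(2) by (simp only: ac_simps)
    then have "2 * card (orb ?L) = CARD('a) * (CARD('a) - 1)" by (simp only: mult_cancel1) simp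
    then have "card (orb ?L) = CARD('a) * (CARD('a) - 1) div 2" by linarith
    then show ?thesis using 2 by (simp add: secant_size_def t)
  next
    case 3
    then show ?thesis using c unfolding s(3)[OF 3] by (auto simp: secant_size_def t)
  next
    case 4
    then show ?thesis using c unfolding s(4)[OF 4] by (auto simp: secant_size_def t)
  qed
qed

text \<open>Peels off one class at a time while s may equal values of f elsewhere, so that no
  comparison of orbit sizes is needed.\<close>

lemma card_filter_If:
  assumes "finite X" "A \<subseteq> X"
  shows "card {x \<in> X. (if x \<in> A then s else f x) = m} = (if s = m then card A else 0) + card {x \<in> X - A. f x = m}"
proof -
  have "{x \<in> X. (if x \<in> A then s else f x) = m} = (if s = m then A else {}) \<union> {x \<in> X - A. f x = m}"
    using assms(2) by (auto split: if_splits)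
  also have "card \<dots> = card (if s = m then A else {}) + card {x \<in> X - A. f x = m}"
    by (rule card_Un_disjoint) (use assms finite_subset in auto)
  finally show ?thesis by simp
qed

lemma card_filter_const: "card {x \<in> X. s = m} = (if s = m then card X else 0)"
  by simp

lemma card_secant_size:
  defines "q \<equiv> CARD('a)"
  shows "card {t \<in> secant_params. secant_size t = m} =
     (if q * (q + 1) div 2 = m then q * (q + 1) else 0) + (if q * (q - 1) div 2 = m then q * (q - 1) else 0)
   + (if q ^ 3 - q = m then 2 * (q ^ 3 - q) else 0) + (if (q ^ 3 - q) div 2 = m then (q - 2) * (q ^ 3 - q) else 0)"
proof -
  define A where "A = {((u, v), (z, w), e) \<in> secant_params. (u, v) = (0, 0) \<and> (\<exists>t. t\<^sup>2 + t = z * w)}"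
  define A' where "A' = {((u, v), (z, w), e) \<in> secant_params. (u, v) = (0, 0)}"
  define B where "B = {((u, v), (z, w), e) \<in> secant_params. (u, v) \<noteq> (0, 0) \<and> (u * w + v * z)\<^sup>2 = u * v}"
  define B' where "B' = {((u, v), (z, w), e) \<in> secant_params. (u, v) \<noteq> (0, 0)}"
  have sp: "((u, v), (z, w), e) \<in> secant_params \<longleftrightarrow> e\<^sup>2 + e = z * v + u * w + u * v" for u v z w e
    by (simp add: secant_params_def)
  have e01: "{e::'a. e\<^sup>2 + e = 0} = {0, 1}" by (auto simp: artin_schreier_eq_0)
  have A: "card A = q * (q + 1)"
  proof -
    have "card A = card {y. ((0, 0), y) \<in> A}" by (rule card_origin_section) (auto simp: A_def)
    also have "{y. ((0, 0), y) \<in> A} = {(z, w). \<exists>t. t\<^sup>2 + t = z * w} \<times> {0, 1}"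
      by (auto simp: A_def sp artin_schreier_eq_0)
    finally show ?thesis using card_split_pairs by (simp add: card_cartesian_product q_def)
  qed
  have A': "card A' = 2 * q\<^sup>2"
  proof -
    have "card A' = card {y. ((0, 0), y) \<in> A'}" by (rule card_origin_section) (auto simp: A'_def)
    also have "{y. ((0, 0), y) \<in> A'} = UNIV \<times> {0, 1}"
      by (auto simp: A'_def sp artin_schreier_eq_0)
    finally show ?thesis by (simp add: card_cartesian_product q_def power2_eq_square)
  qed
  have B: "card B = (q\<^sup>2 - 1) * (2 * q)"
    unfolding q_def
  proof (rule card_nonorigin_sections)
    fix u v :: 'a assume uv: "(u, v) \<noteq> (0, 0)"
    \<comment> \<open>The shared root condition becomes z v + u w = r, whereupon the relation reads
      e^2 + e = r^2 + r and has the two roots r and r + 1.\<close>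
    obtain r where r: "u * v = r\<^sup>2" using square_surj by blast
    have iff: "((u, v), (z, w), e) \<in> B \<longleftrightarrow> z * v + u * w = r \<and> (e = r \<or> e = r + 1)" for z w e
    proof -
      have "((u, v), (z, w), e) \<in> B \<longleftrightarrow> e\<^sup>2 + e = (z * v + u * w) + r\<^sup>2 \<and> (u * w + v * z)\<^sup>2 = r\<^sup>2"
        using uv by (simp add: B_def sp r)
      also have "\<dots> \<longleftrightarrow> z * v + u * w = r \<and> e\<^sup>2 + e = r\<^sup>2 + r"
        by (auto simp only: square_eq_iff ac_simps)
      finally show ?thesis by (simp only: artin_schreier_eq_iff)
    qed
    have "{y. ((u, v), y) \<in> B} = {(z, w). z * v + u * w = r} \<times> {r, r + 1}"
      by (auto simp: iff)
    then show "card {y. ((u, v), y) \<in> B} = 2 * CARD('a)"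
      using card_linear_pairs[OF uv] by (simp add: card_cartesian_product)
  qed (auto simp: B_def)
  have B': "card B' = (q\<^sup>2 - 1) * (q * q)"
    unfolding q_def
  proof (rule card_nonorigin_sections)
    fix u v :: 'a assume uv: "(u, v) \<noteq> (0, 0)"
    have "card {y. ((u, v), y) \<in> B'} = card {(x, e). e\<^sup>2 + e = (\<lambda>(z, w). z * v + u * w + u * v) x}"
      using uv by (intro arg_cong[of _ _ card]) (auto simp: B'_def sp)
    also have "\<dots> = card {(e, x). e\<^sup>2 + e = (\<lambda>(z, w). z * v + u * w + u * v) x}" by (rule card_swap)
    also have "\<dots> = (\<Sum>e\<in>UNIV. card {(z, w). z * v + u * w = e\<^sup>2 + e + u * v})"
    proof -
      have "e\<^sup>2 + e = z * v + u * w + u * v \<longleftrightarrow> z * v + u * w = e\<^sup>2 + e + u * v" for e z w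
        using add_eq_iff[of "z * v + u * w" "u * v" "e\<^sup>2 + e"] by (simp only: add.commute[of "u * v"] eq_commute)
      then show ?thesis by (subst card_pairs, intro sum.cong[OF refl] arg_cong[of _ _ card]) auto
    qed
    also have "\<dots> = CARD('a) * CARD('a)" by (simp add: card_linear_pairs[OF uv])
    finally show "card {y. ((u, v), y) \<in> B'} = CARD('a) * CARD('a)" .
  qed (auto simp: B'_def)
  have AA': "card (A' - A) = q * (q - 1)"
  proof -
    have "card (A' - A) = card A' - card A" by (rule card_Diff_subset) (auto simp: A_def A'_def)
    then show ?thesis unfolding A A' by (simp add: algebra_simps power2_eq_square)
  qed
  have BB': "card (B' - B) = (q - 2) * (q ^ 3 - q)"
  proof -
    have "card (B' - B) = card B' - card B" by (rule card_Diff_subset) (auto simp: B_def B'_def)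
    also have "\<dots> = (q\<^sup>2 - 1) * ((q - 2) * q)"
      unfolding B B' by (simp only: diff_mult_distrib2[symmetric] diff_mult_distrib[of q 2 q])
    also have "\<dots> = (q - 2) * ((q\<^sup>2 - 1) * q)" by (rule mult.left_commute)
    finally show ?thesis by (simp add: q_def cube_minus_factor(3))
  qed
  have sub: "A \<subseteq> A'" "B \<subseteq> B'" "A' \<inter> B' = {}" "A' \<union> B' = secant_params"
    by (auto simp: A_def A'_def B_def B'_def)
  have size: "secant_size t = (if t \<in> A then q * (q + 1) div 2 else if t \<in> A' - A then q * (q - 1) div 2
      else if t \<in> B then q ^ 3 - q else (q ^ 3 - q) div 2)" if "t \<in> secant_params" for t
    using that by (auto simp: secant_size_def A_def A'_def B_def q_def split: prod.splits)
  have "{t \<in> secant_params. secant_size t = m} = {t \<in> secant_params. (if t \<in> A then q * (q + 1) div 2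
      else if t \<in> A' - A then q * (q - 1) div 2 else if t \<in> B then q ^ 3 - q else (q ^ 3 - q) div 2) = m}"
    by (intro Collect_cong conj_cong refl) (simp only: size)
  then have "card {t \<in> secant_params. secant_size t = m} = card \<dots>" by (rule arg_cong)
  also have "\<dots> = (if q * (q + 1) div 2 = m then card A else 0) + ((if q * (q - 1) div 2 = m then card (A' - A) else 0)
      + ((if q ^ 3 - q = m then card B else 0)
      + (if (q ^ 3 - q) div 2 = m then card (secant_params - A - (A' - A) - B) else 0)))"
  proof -
    have "A \<subseteq> secant_params" "A' - A \<subseteq> secant_params - A" "B \<subseteq> secant_params - A - (A' - A)"
      using sub by auto
    then show ?thesis by (simp only: card_filter_If[OF finite] card_filter_const)
  qed
  also have "secant_params - A - (A' - A) - B = B' - B" using sub by auto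
  finally show ?thesis unfolding A AA' BB' unfolding B q_def cube_minus_factor(3)
    by (simp only: ac_simps)
qed


text \<open>The cases are the generators of the quadric (one ruling for x = 0, the other for y = 0),
  the tangents at points of the arc other than generators, and such tangents at the remaining points
  of the quadric.\<close>

definition tangent_size :: "('a \<times> 'a) \<times> ('a \<times> 'a) \<Rightarrow> nat" where
  "tangent_size = (\<lambda>((x1, x2), (y1, y2)).
     if (x1, x2) = (0, 0) \<or> (y1, y2) = (0, 0) then CARD('a) + 1
     else if x1 * y2 + x2 * y1 = 0 then CARD('a)\<^sup>2 - 1
     else (CARD('a) ^ 3 - CARD('a)) div card {m::'a. fr m * m = 1})"

lemma stab_tangent_line:
  assumes "((x1, x2), (y1, y2)) \<in> tangent_params"
  shows "stab (line_of (tangent_coords ((x1, x2), (y1, y2)))) = {(a, b, c, d) \<in> SL. \<exists>m. m \<noteq> 0 \<and>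
      a * x1 + b * x2 = fr m * x1 \<and> c * x1 + d * x2 = fr m * x2 \<and>
      a * y1 + b * y2 = m * y1 \<and> c * y1 + d * y2 = m * y2}"
  unfolding stab_line_of[OF tangent_coords_in_plucker[OF assms]]
proof (rule Set.set_eqI)
  fix g :: "'a \<times> 'a \<times> 'a \<times> 'a"
  obtain a b c d where g: "g = (a, b, c, d)" by (cases g) auto
  show "g \<in> {g \<in> SL. \<exists>k. k \<noteq> 0 \<and> act g (tangent_coords ((x1, x2), y1, y2)) = scale6 k (tangent_coords ((x1, x2), y1, y2))} \<longleftrightarrow>
     g \<in> {(a, b, c, d) \<in> SL. \<exists>m. m \<noteq> 0 \<and>
      a * x1 + b * x2 = fr m * x1 \<and> c * x1 + d * x2 = fr m * x2 \<and>
      a * y1 + b * y2 = m * y1 \<and> c * y1 + d * y2 = m * y2}"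
  proof (cases "g \<in> SL")
    case True
    show ?thesis
      using True unfolding g mem_Collect_eq prod.case act_tangent_coords[OF True[unfolded g]] tangent_coords_eq_scale_iff
      by blast
  qed (simp add: g)
qed

lemma fr_Ex: "(\<exists>m. m \<noteq> 0 \<and> P (fr m)) \<longleftrightarrow> (\<exists>m. m \<noteq> 0 \<and> P m)"
  by (metis fr_surj fr_eq_0)

lemma card_orb_tangent:
  assumes "s \<in> tangent_params"
  shows "card (orb (line_of (tangent_coords s))) = tangent_size s"
proof -
  obtain x1 x2 y1 y2 where s: "s = ((x1, x2), (y1, y2))" by (metis prod.exhaust)
  let ?L = "line_of (tangent_coords s)"
  note c = card_orb[of ?L]
  note st = stab_tangent_line[OF assms[unfolded s], folded s]
  consider "(x1, x2) = (0, 0)" "(y1, y2) \<noteq> (0, 0)" | "(x1, x2) \<noteq> (0, 0)" "(y1, y2) = (0, 0)"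
    | "(x1, x2) \<noteq> (0, 0)" "(y1, y2) \<noteq> (0, 0)" "x1 * y2 + x2 * y1 = 0" | "x1 * y2 + x2 * y1 \<noteq> 0"
    using assms by (auto simp: s tangent_params_def)
  then show ?thesis
  proof cases
    case 1
    then have "card (stab ?L) = CARD('a) * (CARD('a) - 1)"
      unfolding st using card_eigenline[OF 1(2)] by simp
    then have "(CARD('a) * (CARD('a) - 1)) * card (orb ?L) = (CARD('a) * (CARD('a) - 1)) * (CARD('a) + 1)"
      using c unfolding cube_minus_factor(2) by (simp only: ac_simps)
    then have "card (orb ?L) = CARD('a) + 1" using q_ge_8 by (simp only: mult_cancel1) simp
    then show ?thesis using 1 by (simp add: tangent_size_def s)
  next
    case 2
    have "card (stab ?L) = CARD('a) * (CARD('a) - 1)"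
      unfolding st using 2(2) card_eigenline[OF 2(1)]
        fr_Ex[where P = "\<lambda>m. a * x1 + b * x2 = m * x1 \<and> c * x1 + d * x2 = m * x2" for a b c d] by simp
    then have "(CARD('a) * (CARD('a) - 1)) * card (orb ?L) = (CARD('a) * (CARD('a) - 1)) * (CARD('a) + 1)"
      using c unfolding cube_minus_factor(2) by (simp only: ac_simps)
    then have "card (orb ?L) = CARD('a) + 1" using q_ge_8 by (simp only: mult_cancel1) simp
    then show ?thesis using 2 by (simp add: tangent_size_def s)
  next
    case 3
    obtain k where k: "y1 = k * x1" "y2 = k * x2"
    proof (cases "x1 = 0")
      case True
      then show ?thesis using 3 by (intro that[of "y2 / x2"]) auto
    next
      case False
      then show ?thesis using 3(3) by (intro that[of "y1 / x1"]) (auto simp: field_simps add_eq_0)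
    qed
    have k0: "k \<noteq> 0" using 3(2) k by auto
    \<comment> \<open>Parallel vectors have the same eigenvalue, so \<open>fr m = m\<close>; the
      fixed field of \<open>fr\<close> is F_2, which leaves m = 1.\<close>
    have "(\<exists>m. m \<noteq> 0 \<and> a * x1 + b * x2 = fr m * x1 \<and> c * x1 + d * x2 = fr m * x2 \<and>
      a * y1 + b * y2 = m * y1 \<and> c * y1 + d * y2 = m * y2) \<longleftrightarrow>
       a * x1 + b * x2 = 1 * x1 \<and> c * x1 + d * x2 = 1 * x2" for a b c d
    proof
      assume "\<exists>m. m \<noteq> 0 \<and> a * x1 + b * x2 = fr m * x1 \<and> c * x1 + d * x2 = fr m * x2 \<and>
        a * y1 + b * y2 = m * y1 \<and> c * y1 + d * y2 = m * y2"
      then obtain m where m: "m \<noteq> 0" "a * x1 + b * x2 = fr m * x1" "c * x1 + d * x2 = fr m * x2"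
        "a * y1 + b * y2 = m * y1" "c * y1 + d * y2 = m * y2" by blast
      have "k * (a * x1 + b * x2) = k * (m * x1)" "k * (c * x1 + d * x2) = k * (m * x2)"
        using m(4,5) by (simp_all add: k algebra_simps)
      then have "fr m * x1 = m * x1" "fr m * x2 = m * x2" using k0 m(2,3) by auto
      then have "fr m = m" using 3(1) by auto
      then have "m = 1" using m(1) fr_fixed_iff by blast
      then show "a * x1 + b * x2 = 1 * x1 \<and> c * x1 + d * x2 = 1 * x2" using m by simp
    next
      assume *: "a * x1 + b * x2 = 1 * x1 \<and> c * x1 + d * x2 = 1 * x2"
      have "a * y1 + b * y2 = k * (a * x1 + b * x2)" "c * y1 + d * y2 = k * (c * x1 + d * x2)"
        by (simp_all add: k algebra_simps)
      then show "\<exists>m. m \<noteq> 0 \<and> a * x1 + b * x2 = fr m * x1 \<and> c * x1 + d * x2 = fr m * x2 \<and>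
        a * y1 + b * y2 = m * y1 \<and> c * y1 + d * y2 = m * y2"
        using * by (intro exI[of _ 1]) (simp add: k)
    qed
    then have "card (stab ?L) = CARD('a)"
      unfolding st using card_eigenvector[OF 3(1), of 1] by simp
    then have "CARD('a) * card (orb ?L) = CARD('a) * (CARD('a)\<^sup>2 - 1)"
      using c unfolding cube_minus_factor(3) by (simp only: ac_simps)
    then have "card (orb ?L) = CARD('a)\<^sup>2 - 1" by (simp only: mult_cancel1) simp
    then show ?thesis using 3 by (auto simp: tangent_size_def s)
  next
    case 4
    have "card (stab ?L) = card {m::'a. fr m * m = 1}"
      unfolding st by (rule card_eigenpair[OF 4])
    moreover have "1 \<in> {m::'a. fr m * m = 1}" by simp
    then have "card {m::'a. fr m * m = 1} \<noteq> 0" by (metis card_eq_0_iff finite empty_iff)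
    ultimately have "card (orb ?L) = (CARD('a) ^ 3 - CARD('a)) div card {m::'a. fr m * m = 1}"
      using c by (metis nonzero_mult_div_cancel_left)
    moreover have "(x1, x2) \<noteq> (0, 0)" "(y1, y2) \<noteq> (0, 0)" using 4 by auto
    ultimately show ?thesis using 4 by (auto simp: tangent_size_def s)
  qed
qed

lemma card_tangent_fibre:
  assumes "s \<in> tangent_params"
  shows "card {s' \<in> tangent_params. line_of (tangent_coords s') = line_of (tangent_coords s)} = CARD('a) - 1"
proof -
  obtain x1 x2 y1 y2 where s: "s = ((x1, x2), (y1, y2))" by (metis prod.exhaust)
  let ?f = "\<lambda>m. ((fr m * x1, fr m * x2), (m * y1, m * y2))"
  have nz: "x1 \<noteq> 0 \<or> x2 \<noteq> 0 \<or> y1 \<noteq> 0 \<or> y2 \<noteq> 0" using assms by (auto simp: s tangent_params_def)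
  have "s' \<in> tangent_params \<and> line_of (tangent_coords s') = line_of (tangent_coords s) \<longleftrightarrow> s' \<in> ?f ` (UNIV - {0})" for s'
  proof
    assume s': "s' \<in> tangent_params \<and> line_of (tangent_coords s') = line_of (tangent_coords s)"
    then have "\<exists>k. k \<noteq> 0 \<and> tangent_coords s' = scale6 k (tangent_coords s)"
      using line_of_eq_iff[OF tangent_coords_in_plucker[OF assms] tangent_coords_in_plucker[of s']] by blast
    then show "s' \<in> ?f ` (UNIV - {0})"
      unfolding s by (cases s'; cases "fst s'"; cases "snd s'") (auto simp: tangent_coords_eq_scale_iff)
  next
    assume "s' \<in> ?f ` (UNIV - {0})"
    then obtain m where m: "m \<noteq> 0" "s' = ?f m" by blast
    then have t: "s' \<in> tangent_params" using nz by (auto simp: tangent_params_def)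
    have "\<exists>k. k \<noteq> 0 \<and> tangent_coords s' = scale6 k (tangent_coords s)"
      unfolding s m(2) tangent_coords_eq_scale_iff using m(1) by blast
    then show "s' \<in> tangent_params \<and> line_of (tangent_coords s') = line_of (tangent_coords s)"
      using t line_of_eq_iff[OF tangent_coords_in_plucker[OF assms] tangent_coords_in_plucker[OF t]] by blast
  qed
  then have "{s' \<in> tangent_params. line_of (tangent_coords s') = line_of (tangent_coords s)} = ?f ` (UNIV - {0})"
    by (simp only: Set.set_eq_iff mem_Collect_eq) blast
  moreover have "inj_on ?f (UNIV - {0})"
    using nz by (auto simp: inj_on_def)
  ultimately show ?thesis by (simp add: card_image card_Diff_singleton)
qed

lemma card_tangent_size:
  defines "q \<equiv> CARD('a)"
  shows "card {s \<in> tangent_params. tangent_size s = m} =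
     (if q + 1 = m then 2 * (q\<^sup>2 - 1) else 0) + (if q\<^sup>2 - 1 = m then (q\<^sup>2 - 1) * (q - 1) else 0)
   + (if (q ^ 3 - q) div card {m::'a. fr m * m = 1} = m then (q\<^sup>2 - 1) * (q\<^sup>2 - q) else 0)"
proof -
  define A1 where "A1 = {(x, y) \<in> tangent_params. x = (0, 0)}"
  define A2 where "A2 = {(x, y) \<in> tangent_params. y = (0, 0)}"
  define B where "B = {((x1, x2), (y1, y2)). (x1, x2) \<noteq> (0::'a, 0::'a) \<and> (y1, y2) \<noteq> (0::'a, 0::'a) \<and> x1 * y2 + x2 * y1 = 0}"
  define C where "C = {((x1, x2), (y1, y2)). x1 * y2 + x2 * y1 \<noteq> (0::'a)}"
  have "A1 = {(0, 0)} \<times> (UNIV - {(0, 0)})" "A2 = (UNIV - {(0, 0)}) \<times> {(0, 0)}"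
    by (auto simp: A1_def A2_def tangent_params_def)
  then have A: "card A1 = q\<^sup>2 - 1" "card A2 = q\<^sup>2 - 1"
    by (simp_all add: card_cartesian_product card_Diff_singleton q_def power2_eq_square)
  have kernel: "card {(y1, y2). x1 * y2 + x2 * y1 = 0} = CARD('a)" if "(x1, x2) \<noteq> (0, 0)" for x1 x2 :: 'a
  proof -
    have "{(y1, y2). x1 * y2 + x2 * y1 = 0} = {(z, w). z * x2 + x1 * w = 0}" by (auto simp: ac_simps)
    then show ?thesis using card_linear_pairs[OF that, of 0] by simp
  qed
  have B: "card B = (q\<^sup>2 - 1) * (q - 1)"
    unfolding q_def
  proof (rule card_nonorigin_sections)
    fix x1 x2 :: 'a assume x: "(x1, x2) \<noteq> (0, 0)"
    have "{y. ((x1, x2), y) \<in> B} = {(y1, y2). x1 * y2 + x2 * y1 = 0} - {(0, 0)}" using x by (auto simp: B_def)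
    then show "card {y. ((x1, x2), y) \<in> B} = CARD('a) - 1" using kernel[OF x] by (simp add: card_Diff_singleton)
  qed (auto simp: B_def)
  have C: "card C = (q\<^sup>2 - 1) * (q\<^sup>2 - q)"
    unfolding q_def
  proof (rule card_nonorigin_sections)
    fix x1 x2 :: 'a assume x: "(x1, x2) \<noteq> (0, 0)"
    have "{y. ((x1, x2), y) \<in> C} = UNIV - {(y1, y2). x1 * y2 + x2 * y1 = 0}" by (auto simp: C_def)
    then show "card {y. ((x1, x2), y) \<in> C} = CARD('a)\<^sup>2 - CARD('a)"
      using kernel[OF x] by (simp add: card_Diff_subset power2_eq_square)
  qed (auto simp: C_def)
  have sub: "A1 \<inter> A2 = {}" "(A1 \<union> A2) \<inter> B = {}" "(A1 \<union> A2) \<inter> C = {}" "B \<inter> C = {}"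
    "A1 \<union> A2 \<union> B \<union> C = tangent_params"
    by (auto simp: A1_def A2_def B_def C_def tangent_params_def)
  let ?z = "(q ^ 3 - q) div card {m::'a. fr m * m = 1}"
  have size: "tangent_size s = (if s \<in> A1 \<union> A2 then q + 1 else if s \<in> B then q\<^sup>2 - 1 else ?z)"
    if "s \<in> tangent_params" for s
    using that by (auto simp: tangent_size_def A1_def A2_def B_def q_def split: prod.splits)
  have "{s \<in> tangent_params. tangent_size s = m} = {s \<in> tangent_params. (if s \<in> A1 \<union> A2 then q + 1
      else if s \<in> B then q\<^sup>2 - 1 else ?z) = m}"
    by (intro Collect_cong conj_cong refl) (simp only: size)
  then have "card {s \<in> tangent_params. tangent_size s = m} = card \<dots>" by (rule arg_cong)
  also have "\<dots> = (if q + 1 = m then card (A1 \<union> A2) else 0) + ((if q\<^sup>2 - 1 = m then card B else 0)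
      + (if ?z = m then card (tangent_params - (A1 \<union> A2) - B) else 0))"
  proof -
    have "A1 \<union> A2 \<subseteq> tangent_params" "B \<subseteq> tangent_params - (A1 \<union> A2)" using sub by auto
    then show ?thesis by (simp only: card_filter_If[OF finite] card_filter_const)
  qed
  also have "tangent_params - (A1 \<union> A2) - B = C" using sub by auto
  also have "card (A1 \<union> A2) = 2 * (q\<^sup>2 - 1)" using sub(1) by (simp add: card_Un_disjoint A)
  finally show ?thesis unfolding B C by (simp only: ac_simps)
qed

lemma card_lines_of_orbit_size:
  defines "q \<equiv> CARD('a)"
  shows "card {L \<in> PG3_lines. card (orb L) = m} =
     (if q * (q + 1) div 2 = m then q * (q + 1) else 0) + (if q * (q - 1) div 2 = m then q * (q - 1) else 0)
   + (if q ^ 3 - q = m then 2 * (q ^ 3 - q) else 0) + (if (q ^ 3 - q) div 2 = m then (q - 2) * (q ^ 3 - q) else 0)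
   + (if q + 1 = m then 2 * (q + 1) else 0) + (if q\<^sup>2 - 1 = m then q\<^sup>2 - 1 else 0)
   + (if (q ^ 3 - q) div card {m::'a. fr m * m = 1} = m then q ^ 3 - q else 0)"
proof -
  let ?S = "{t \<in> secant_params. secant_size t = m}" and ?T = "{s \<in> tangent_params. tangent_size s = m}"
  let ?f = "\<lambda>t. line_of (secant_coords t)" and ?g = "\<lambda>s. line_of (tangent_coords s)"
  have "{L \<in> PG3_lines. card (orb L) = m} = ?f ` ?S \<union> ?g ` ?T"
    unfolding PG3_lines_eq_params using card_orb_secant card_orb_tangent by (auto simp: image_iff)
  moreover have "?f ` ?S \<inter> ?g ` ?T = {}" using secant_tangent_disjoint by blast
  ultimately have "card {L \<in> PG3_lines. card (orb L) = m} = card (?f ` ?S) + card (?g ` ?T)"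
    by (simp add: card_Un_disjoint)
  moreover have "card (?f ` ?S) = card ?S"
    by (rule card_image) (rule inj_on_subset[OF inj_on_secant_line], blast)
  \<comment> \<open>Each such line has q - 1 parameters, namely the free rescalings (fr m x, m
    y).\<close>
  moreover have "card ?T = (q - 1) * card (?g ` ?T)"
    unfolding q_def
  proof (rule card_uniform_fibres)
    fix s assume s: "s \<in> ?T"
    have "tangent_size s' = m" if "s' \<in> tangent_params" "?g s' = ?g s" for s'
      using card_orb_tangent[OF that(1)] card_orb_tangent[of s] that(2) s by simp
    then have "{s' \<in> ?T. ?g s' = ?g s} = {s' \<in> tangent_params. ?g s' = ?g s}" by blast
    then show "card {s' \<in> ?T. ?g s' = ?g s} = CARD('a) - 1"
      using card_tangent_fibre[of s] s by simp
  qed simp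
  moreover have "card ?T = (q - 1) * ((if q + 1 = m then 2 * (q + 1) else 0) + (if q\<^sup>2 - 1 = m then q\<^sup>2 - 1 else 0)
     + (if (q ^ 3 - q) div card {m::'a. fr m * m = 1} = m then q ^ 3 - q else 0))"
  proof -
    obtain k where k: "q = k + 1" using q_ge_8 by (metis q_def Suc_eq_plus1 Suc_le_D numeral_eq_Suc)
    have "2 * (q\<^sup>2 - 1) = (q - 1) * (2 * (q + 1))" "(q\<^sup>2 - 1) * (q - 1) = (q - 1) * (q\<^sup>2 - 1)"
      "(q\<^sup>2 - 1) * (q\<^sup>2 - q) = (q - 1) * (q ^ 3 - q)"
      by (simp_all add: k algebra_simps power2_eq_square power3_eq_cube)
    then show ?thesis unfolding card_tangent_size[folded q_def] by (simp only: distrib_left if_distrib[of "(*) (q - 1)"] mult_0_right)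
  qed
  moreover have "q - 1 \<noteq> 0" using q_ge_8 by (simp add: q_def)
  ultimately show ?thesis
    using card_secant_size[of m, folded q_def] by (simp only: mult_cancel1) simp
qed

text \<open>The equation makes \<open>fr\<close> invert m, so fr (fr m) = m and m is fixed by the
  Frobenius power of index gcd n 2: m = 1 for odd n and m^3 = 1 for even n. Conversely, if n is even
  then h is odd and 3 divides 2^h + 1.\<close>

lemma card_twisted_norm_one: "card {m::'a. fr m * m = 1} = (if even n then 3 else 1)"
proof -
  have period: "m ^ (2 ^ gcd n 2) = m" if "fr m * m = 1" for m :: 'a
  proof -
    have m: "m \<noteq> 0" using that by auto
    then have "fr m = inverse m" using that by (simp add: inverse_eq_divide eq_divide_eq)
    then have "fr (fr m) = m" by simp
    moreover have "fr (fr m) = m ^ (2 ^ (2 * h))" by (simp add: fr_def mult_2 power_add power_mult)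
    ultimately show ?thesis using frob_gcd_fixed[of m "2 * h"] by (simp add: gcd_double)
  qed
  show ?thesis
  proof (cases "even n")
    case False
    then have "gcd n 2 = 1" by (simp add: coprime_iff_gcd_eq_1[symmetric])
    then have one: "m = 1" if "fr m * m = 1" for m :: 'a
      using period[OF that] that by (auto simp: power2_eq_square)
    have "{m::'a. fr m * m = 1} = {1}"
    proof (rule Set.set_eqI)
      show "m \<in> {m. fr m * m = 1} \<longleftrightarrow> m \<in> {1}" for m :: 'a
        using one[of m] by auto
    qed
    with False show ?thesis by simp
  next
    case True
    then have g2: "gcd n 2 = 2" by (simp add: gcd_nat.absorb2)
    have "odd h"
    proof
      assume "even h"
      then have "2 dvd gcd n h" using True by simp
      then show False using coprime_nh by simp
    qed
    then obtain j where j: "h = 2 * j + 1" by (rule oddE)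
    have "[(2::nat) ^ h + 1 = 1 ^ j * 2 + 1] (mod 3)"
      unfolding j power_add power_mult power_one_right
      by (intro cong_add cong_mult cong_pow) (simp_all add: cong_def)
    then have "3 dvd (2::nat) ^ h + 1" by (simp add: cong_def dvd_eq_mod_eq_0)
    then obtain r where r: "(2::nat) ^ h + 1 = 3 * r" by blast
    have norm_iff: "fr m * m = 1 \<longleftrightarrow> m ^ 3 = 1" for m :: 'a
    proof
      assume m: "fr m * m = 1"
      then have "m ^ 4 = m" using period g2 by fastforce
      then have "m * m ^ 3 = m * 1" by (simp add: power_Suc[symmetric] del: power_Suc)
      moreover have "m \<noteq> 0" using m by auto
      ultimately show "m ^ 3 = 1" by (simp only: mult_cancel_left) simp
    next
      assume "m ^ 3 = 1"
      have "fr m * m = m ^ (2 ^ h + 1)" by (simp add: fr_def)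
      also have "\<dots> = (m ^ 3) ^ r" unfolding r by (rule power_mult)
      finally show "fr m * m = 1" using \<open>m ^ 3 = 1\<close> by simp
    qed
    obtain i where i: "n = 2 * i" using True by blast
    have "[(2::nat) ^ n = 1 ^ i] (mod 3)"
      unfolding i power_mult by (intro cong_pow) (simp add: cong_def)
    then have "CARD('a) mod 3 = 1" by (simp add: cong_def card_UNIV)
    then obtain l where l: "CARD('a) = 3 * l + 1" by (metis mult_div_mod_eq)
    have l2: "2 \<le> l" using q_ge_8 l by simp
    \<comment> \<open>With q = 3 l + 1 the witness is x^l for an x with x^l \<noteq> 1; such a
      nonzero x exists because x^(l + 1) = x for all x would be an identity of degree below
      q.\<close>
    obtain \<omega> :: 'a where w: "\<omega> \<noteq> 1" "\<omega> ^ 3 = 1"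
    proof -
      have "\<exists>x::'a. x ^ (l + 1) \<noteq> x"
      proof (rule ccontr)
        assume "\<not> ?thesis"
        then have same: "x ^ (l + 1) = x" for x :: 'a by blast
        have "\<forall>c\<in>set (map fst [(1::'a, 1::nat), (1, l + 1)]). c = 0"
          by (rule monomials_independent) (use l l2 in \<open>simp_all add: same[unfolded Suc_eq_plus1[symmetric]] add_self del: power_Suc\<close>)
        then show False by simp
      qed
      then obtain x :: 'a where x: "x ^ (l + 1) \<noteq> x" by blast
      then have x0: "x \<noteq> 0" using l2 by (auto simp: power_0_left)
      have "x * (x ^ l) ^ 3 = x * 1"
        using power_card_eq_same[of x] unfolding l by (simp add: power_add power_mult[symmetric] mult.commute)
      then have "(x ^ l) ^ 3 = 1" using x0 by (simp only: mult_cancel_left) simp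
      moreover have "x ^ l \<noteq> 1" using x by auto
      ultimately show ?thesis using that by blast
    qed
    have "(\<omega> + 1) * (\<omega>\<^sup>2 + \<omega> + 1) = \<omega> ^ 3 + 1"
      by (simp add: algebra_simps power2_eq_square power3_eq_cube char2)
    then have w0: "\<omega>\<^sup>2 + \<omega> + 1 = 0" using w by (simp add: add_self add_eq_0)
    have "m ^ 3 = 1 \<longleftrightarrow> m = 1 \<or> m = \<omega> \<or> m = \<omega>\<^sup>2" for m
    proof -
      have "(m + 1) * (m + \<omega>) * (m + \<omega>\<^sup>2) = m ^ 3 + (\<omega>\<^sup>2 + \<omega> + 1) * m\<^sup>2 + (\<omega>\<^sup>2 + \<omega> + \<omega> ^ 3) * m + \<omega> ^ 3"
        by (simp add: algebra_simps power2_eq_square power3_eq_cube)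
      then have "(m + 1) * (m + \<omega>) * (m + \<omega>\<^sup>2) = m ^ 3 + 1" by (simp add: w w0)
      then show ?thesis by (metis add_eq_0 mult_eq_0_iff)
    qed
    then have "{m::'a. fr m * m = 1} = {1, \<omega>, \<omega>\<^sup>2}" by (auto simp: norm_iff)
    moreover have "\<omega>\<^sup>2 \<noteq> 1" using w(1) square_eq_1 by blast
    moreover have "\<omega>\<^sup>2 \<noteq> \<omega>"
    proof
      assume "\<omega>\<^sup>2 = \<omega>"
      then show False using w0 by (simp add: add_self)
    qed
    ultimately show ?thesis using w(1) True by simp
  qed
qed

lemma line_orbit_sizes:
  defines "q \<equiv> CARD('a)" and "K \<equiv> card {m::'a. fr m * m = 1}" and "orbs \<equiv> G_arc_line_orbits h :: ('a^4) set set set"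
  shows "image_mset card (mset_set orbs) =
        replicate_mset 2 (q + 1)
      + replicate_mset 2 (q * (q - 1) div 2)
      + replicate_mset 2 (q * (q + 1) div 2)
      + replicate_mset 1 (q ^ 2 - 1)
      + replicate_mset K ((q ^ 3 - q) div K)
      + replicate_mset (2 * (q - 2)) ((q ^ 3 - q) div 2)
      + replicate_mset 2 (q ^ 3 - q)" (is "?M = ?R")
proof (rule multiset_eqI)
  fix m
  \<comment> \<open>K is the order of the stabilizer of the line with x = (1, 0) and y = (0, 1), so
    orbit-stabilizer makes the division by K exact.\<close>
  have K: "K dvd q ^ 3 - q"
  proof -
    have s: "((1, 0), (0, 1)) \<in> tangent_params" by (simp add: tangent_params_def)
    have "stab (line_of (tangent_coords ((1, 0), (0, 1)))) = {(a, b, c, d) \<in> SL. \<exists>m. m \<noteq> 0 \<and>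
      a * 1 + b * 0 = fr m * 1 \<and> c * 1 + d * 0 = fr m * 0 \<and> a * 0 + b * 1 = m * 0 \<and> c * 0 + d * 1 = m * 1}"
      by (rule stab_tangent_line[OF s])
    also have "card \<dots> = K" unfolding K_def by (rule card_eigenpair) simp
    finally show ?thesis using card_orb unfolding q_def by (metis dvd_triv_left)
  qed
  have ev: "2 dvd q" using card_UNIV n_ge_3 by (simp add: q_def)
  have q0: "q \<ge> 8" unfolding q_def by (rule q_ge_8)
  have half: "2 * (q * (q - 1) div 2) = q * (q - 1)" "2 * (q * (q + 1) div 2) = q * (q + 1)"
    "2 * ((q ^ 3 - q) div 2) = q ^ 3 - q" "K * ((q ^ 3 - q) div K) = q ^ 3 - q"
    using ev K by (simp_all add: power3_eq_cube)
  have twice: "2 * (q - 2) * ((q ^ 3 - q) div 2) = (q - 2) * (q ^ 3 - q)"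
    using half(3) by (metis mult.assoc mult.left_commute)
  have repl: "m * count (replicate_mset k x) m = (if x = m then k * x else 0)" for k x
    by simp
  have "m * count ?M m = card {L \<in> PG3_lines. card (orb L) = m}"
    unfolding orbs_def G_arc_line_orbits_eq
  proof (rule count_image_mset_orbits)
    show "finite (PG3_lines :: ('a^4) set set)" by (rule finite)
    show "\<And>L. L \<in> orb L" by (rule orb_refl)
    show "\<And>L. L \<in> PG3_lines \<Longrightarrow> orb L \<subseteq> PG3_lines" by (rule orb_subset_lines)
    show "\<And>L L'. L' \<in> orb L \<Longrightarrow> orb L' = orb L" by (rule orb_eq)
  qed
  also have "\<dots> = m * count ?R m"
    unfolding card_lines_of_orbit_size q_def[symmetric] K_def[symmetric] count_union distrib_left[of m] repl half twice
    by (simp only: mult_1 ac_simps)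
  finally have eq: "m * count ?M m = m * count ?R m" .
  show "count ?M m = count ?R m"
  proof (cases "m = 0")
    case False
    then show ?thesis using eq by simp
  next
    \<comment> \<open>Multiplication by m = 0 loses all information; instead, no orbit is empty and
      none of the listed sizes is 0.\<close>
    case True
    have "card (orb L) \<noteq> 0" for L :: "('a^4) set"
      using orb_refl[of L] by (auto simp: card_eq_0_iff)
    then have "0 \<notin># ?M" by (auto simp: orbs_def G_arc_line_orbits_eq)
    then have M: "count ?M m = 0" by (simp add: True count_eq_zero_iff)
    have pos: "q * (q - 1) > 0" "q * (q + 1) > 0" "q ^ 3 - q > 0" "q ^ 2 - 1 > 0"
    proof -
      have "1 < q\<^sup>2" using q0 by (intro one_less_power) simp_all
      then show "q ^ 2 - 1 > 0" by simp
      then show "q ^ 3 - q > 0" using q0 unfolding q_def cube_minus_factor(3) by simp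
    qed (use q0 in simp_all)
    have "q * (q - 1) div 2 \<noteq> 0" "q * (q + 1) div 2 \<noteq> 0" "(q ^ 3 - q) div 2 \<noteq> 0" "(q ^ 3 - q) div K \<noteq> 0"
      using half pos by (metis less_not_refl mult_0_right)+
    then have "count ?R m = 0" using pos True by (simp only: count_union count_replicate_mset) simp
    then show ?thesis using M by simp
  qed
qed

end

theorem theorem4p8:
  fixes q n h :: nat and \<xi> :: int
    and orbs :: "('a::{field,finite}^4) set set set"
  assumes "CARD('a) = q"
    and "q = 2 ^ n" and "n \<ge> 3"
    and "h > 0" and "gcd n h = 1"
    and "\<xi> \<in> {1, -1}" and "[int q = \<xi>] (mod 3)"
    and "orbs = G_arc_line_orbits h"
  shows "int (card orbs) = 2 * int q + 7 + \<xi>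
    \<and> image_mset card (mset_set orbs) =
        replicate_mset 2 (q + 1)
      + replicate_mset 2 (q * (q - 1) div 2)
      + replicate_mset 2 (q * (q + 1) div 2)
      + replicate_mset 1 (q ^ 2 - 1)
      + replicate_mset (nat (2 + \<xi>)) ((q ^ 3 - q) div nat (2 + \<xi>))
      + replicate_mset (2 * (q - 2)) ((q ^ 3 - q) div 2)
      + replicate_mset 2 (q ^ 3 - q)"
proof -
  interpret twisted_field n h "TYPE('a)"
    by unfold_locales (use assms in auto)
  have "(2::int) ^ n mod 3 = (if even n then 1 else 2)"
  proof -
    have 4: "(4::int) ^ k mod 3 = 1" for k
      by (induction k) (auto simp: mod_mult_right_eq[of 4, symmetric])
    show ?thesis
    proof (cases "even n")
      case True
      then obtain k where "n = 2 * k" by blast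
      then show ?thesis using 4 by (simp add: power_mult)
    next
      case False
      then obtain k where k: "n = 2 * k + 1" by (rule oddE)
      have "(2::int) ^ n mod 3 = 2 * (4 ^ k mod 3) mod 3"
        by (simp add: k power_mult mod_mult_right_eq)
      then show ?thesis using False by (simp add: 4)
    qed
  qed
  then have "(if even n then 1 else 2) = \<xi> mod 3"
    using assms(2,7) by (simp add: cong_def)
  then have \<xi>: "nat (2 + \<xi>) = (if even n then 3 else 1)" "2 + \<xi> = (if even n then 3 else 1)"
    using assms(6) by (auto split: if_splits)
  have sizes: "image_mset card (mset_set orbs) =
        replicate_mset 2 (q + 1)
      + replicate_mset 2 (q * (q - 1) div 2)
      + replicate_mset 2 (q * (q + 1) div 2)
      + replicate_mset 1 (q ^ 2 - 1)
      + replicate_mset (nat (2 + \<xi>)) ((q ^ 3 - q) div nat (2 + \<xi>))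
      + replicate_mset (2 * (q - 2)) ((q ^ 3 - q) div 2)
      + replicate_mset 2 (q ^ 3 - q)"
    using line_orbit_sizes unfolding card_twisted_norm_one \<xi>(1)[symmetric] assms(1) assms(8)[symmetric] .
  have "card orbs = size (image_mset card (mset_set orbs))" by simp
  \<comment> \<open>9 collects the fixed multiplicities 2 + 2 + 2 + 1 + 2.\<close>
  also have "\<dots> = 9 + nat (2 + \<xi>) + 2 * (q - 2)"
    unfolding sizes by simp
  finally have "int (card orbs) = 2 * int q + 7 + \<xi>"
    using q_ge_8 \<xi> unfolding assms(1) by (simp split: if_splits)
  with sizes show ?thesis by blast
qed

end
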